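(* Let $D=\mathbb T^d$ and let $\rho_0$ be a smooth density on $D$ with $\int_D\rho_0\,dx=1$ and $0<C_1^{-1}\le\rho_0\le C_1<\infty$ for some $C_1>1$. View the group $\mathsf{SDiff}(D)$ of smooth volume-preserving diffeomorphisms as a submanifold of $\mathsf{Diff}(D)$, with the metric $\mathsf G_X(\xi,\eta)=\int_D\xi\cdot\eta\,\rho_0\,dx$. For every $X\in\mathsf{SDiff}(D)$, with $\rho=\rho_0\circ X^{-1}$, the second fundamental form $\Pi_X$ of $\mathsf{SDiff}(D)$ at $X$ is given by $$\Pi_X(u\circ X,v\circ X)=\mathbf Q_\rho(u\cdot\nabla v)\circ X$$ for all smooth divergence-free vector fields $u,v$ on $D$.
   Context: $\mathsf{Diff}(D)$ is the group of smooth diffeomorphisms of $D$, with tangent space at $X$ the smooth maps $\xi:D\to\mathbb R^d$, and $\mathsf G_X(\xi,\eta)=\int_D\xi\cdot\eta\,\rho_0\,dx$ (which does not depend on $X$, so that the ambient covariant derivative is ordinary directional differentiation in $X$). $T_X\mathsf{SDiff}(D)=\{v\circ X: v\text{ smooth, divergence free}\}$, with $\mathsf G$-orthogonal complement the normal space $N_X=\{\rho_0^{-1}\,(\nabla\varphi)\circ X\}$, $\varphi$ scalar. The second fundamental form $\Pi_X(\xi,\eta)$ for $\xi,\eta\in T_X\mathsf{SDiff}(D)$ is the normal component (the $\mathsf G_X$-orthogonal projection to $N_X$) of the ambient derivative at $X$ in direction $\xi$ of any smooth extension of $\eta$ to a tangent vector field on $\mathsf{SDiff}(D)$ (e.g.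 $Y\mapsto v\circ Y$ if $\eta=v\circ X$). For a smooth density $\rho$ bounded above and away from zero, $\Delta_\rho\varphi=\nabla\cdot(\rho^{-1}\nabla\varphi)$, $\Delta_\rho^{-1}$ is its inverse on zero-mean smooth functions, and $\mathbf Q_\rho w=\rho^{-1}\nabla\Delta_\rho^{-1}\nabla\cdot w$. *)

theory Defs
  imports "HOL-Analysis.Analysis"
begin

section \<open>The flat torus\<close>

definition lattice_equiv :: "real^'d::finite \<Rightarrow> real^'d \<Rightarrow> bool" where
  "lattice_equiv x y \<longleftrightarrow> (\<forall>i. x $ i - y $ i \<in> \<int>)"

lemma equivp_lattice_equiv: "equivp (lattice_equiv :: real^'d::finite \<Rightarrow> _)"
proof (rule equivpI)
  show "reflp (lattice_equiv :: real^'d \<Rightarrow> _)"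
    by (auto simp: reflp_def lattice_equiv_def)
  show "symp (lattice_equiv :: real^'d \<Rightarrow> _)"
    unfolding symp_def lattice_equiv_def by (metis Ints_minus minus_diff_eq)
  show "transp (lattice_equiv :: real^'d \<Rightarrow> _)"
  proof (rule transpI)
    fix x y z :: "real^'d"
    assume *: "lattice_equiv x y" "lattice_equiv y z"
    have "x $ i - z $ i \<in> \<int>" for i
    proof -
      have "(x $ i - y $ i) + (y $ i - z $ i) \<in> \<int>"
        using * unfolding lattice_equiv_def by (intro Ints_add) auto
      then show ?thesis by simp
    qed
    then show "lattice_equiv x z" by (simp add: lattice_equiv_def)
  qed
qed

quotient_type (overloaded) 'd torus = "real^'d::finite" / lattice_equiv
  morphisms rep_torus to_torus
  by (rule equivp_lattice_equiv)

lift_definition translate :: "'d::finite torus \<Rightarrow> real^'d \<Rightarrow> 'd torus" is "\<lambda>x h. x + h"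
  by (simp add: lattice_equiv_def)

lemma translate_to_torus: "translate (to_torus x) h = to_torus (x + h)"
  by transfer (simp add: lattice_equiv_def)

text \<open>The volume measure, on the quotient Borel \<open>\<sigma>\<close>-algebra. The faces of the closed unit
  cube are null sets, so it serves as a fundamental domain.\<close>

definition vol :: "'d::finite torus measure" where
  "vol = distr (restrict_space lborel (cbox 0 (\<chi> i. 1)))
           (sigma UNIV {A. to_torus -` A \<in> sets borel}) to_torus"

section \<open>Smoothness and differential operators\<close>

primrec Ck :: "nat \<Rightarrow> ('a::euclidean_space \<Rightarrow> 'b::euclidean_space) \<Rightarrow> bool" where
  "Ck 0 f \<longleftrightarrow> continuous_on UNIV f"
| "Ck (Suc k) f \<longleftrightarrow>
     (\<exists>f'. (\<forall>x. (f has_derivative f' x) (at x)) \<and> (\<forall>h. Ck k (\<lambda>x. f' x h)))"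

definition smooth :: "('a::euclidean_space \<Rightarrow> 'b::euclidean_space) \<Rightarrow> bool" where
  "smooth f \<longleftrightarrow> (\<forall>k. Ck k f)"

definition smooth_fun :: "('d::finite torus \<Rightarrow> 'b::euclidean_space) \<Rightarrow> bool" where
  "smooth_fun f \<longleftrightarrow> smooth (\<lambda>x. f (to_torus x))"

definition D_at :: "('d::finite torus \<Rightarrow> 'b::euclidean_space) \<Rightarrow> 'd torus \<Rightarrow> real^'d \<Rightarrow> 'b" where
  "D_at f p = frechet_derivative (\<lambda>h. f (translate p h)) (at 0)"

definition grad :: "('d::finite torus \<Rightarrow> real) \<Rightarrow> 'd torus \<Rightarrow> real^'d" where
  "grad \<phi> p = (\<chi> i. D_at \<phi> p (axis i 1))"

definition dvg :: "('d::finite torus \<Rightarrow> real^'d) \<Rightarrow> 'd torus \<Rightarrow> real" where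
  "dvg w p = (\<Sum>i\<in>UNIV. D_at w p (axis i 1) $ i)"

text \<open>\<open>advect u v\<close> is \<open>u \<cdot> \<nabla>v\<close>.\<close>

definition advect :: "('d::finite torus \<Rightarrow> real^'d) \<Rightarrow> ('d torus \<Rightarrow> real^'d) \<Rightarrow> 'd torus \<Rightarrow> real^'d" where
  "advect u v p = D_at v p (u p)"

section \<open>Diffeomorphism groups\<close>

text \<open>Since \<open>\<real>\<^sup>d\<close> is simply connected, every smooth self-map of the torus has a global smooth
  lift.\<close>

definition smooth_map :: "('d::finite torus \<Rightarrow> 'd torus) \<Rightarrow> bool" where
  "smooth_map X \<longleftrightarrow> (\<exists>L. smooth L \<and> (\<forall>x. X (to_torus x) = to_torus (L x)))"

definition Diff :: "('d::finite torus \<Rightarrow> 'd torus) set" where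
  "Diff = {X. bij X \<and> smooth_map X \<and> smooth_map (inv X)}"

text \<open>Orientation-reversing maps (Jacobian determinant \<open>-1\<close>) are not excluded.\<close>

definition SDiff :: "('d::finite torus \<Rightarrow> 'd torus) set" where
  "SDiff = {X \<in> Diff. \<forall>A\<in>sets vol. emeasure vol (X -` A) = emeasure vol A}"

definition tangent_SDiff :: "('d::finite torus \<Rightarrow> 'd torus) \<Rightarrow> ('d torus \<Rightarrow> real^'d) set" where
  "tangent_SDiff X = {v \<circ> X | v. smooth_fun v \<and> (\<forall>p. dvg v p = 0)}"

definition G_metric ::
  "('d::finite torus \<Rightarrow> real) \<Rightarrow> ('d torus \<Rightarrow> real^'d) \<Rightarrow> ('d torus \<Rightarrow> real^'d) \<Rightarrow> real" where
  "G_metric \<rho>0 \<xi> \<eta> = (\<integral>p. (\<xi> p \<bullet> \<eta> p) * \<rho>0 p \<partial>vol)"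

text \<open>The \<open>G\<close>-orthogonal complement of the tangent space; by the Hodge decomposition its
  elements are exactly the maps \<open>\<rho>0\<inverse> (\<nabla>\<phi>) \<circ> X\<close>.\<close>

definition normal_space ::
  "('d::finite torus \<Rightarrow> real) \<Rightarrow> ('d torus \<Rightarrow> 'd torus) \<Rightarrow> ('d torus \<Rightarrow> real^'d) set" where
  "normal_space \<rho>0 X = {\<zeta>. smooth_fun \<zeta> \<and> (\<forall>\<xi>\<in>tangent_SDiff X. G_metric \<rho>0 \<xi> \<zeta> = 0)}"

text \<open>The value \<open>0\<close> is only a default for arguments with no orthogonal projection. For smooth
  \<open>w\<close> and a smooth positive \<open>\<rho>0\<close> the projection exists, by elliptic theory.\<close>

definition is_normal_component ::
  "('d::finite torus \<Rightarrow> real) \<Rightarrow> ('d torus \<Rightarrow> 'd torus) \<Rightarrow> ('d torus \<Rightarrow> real^'d) \<Rightarrow>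
     ('d torus \<Rightarrow> real^'d) \<Rightarrow> bool" where
  "is_normal_component \<rho>0 X w n \<longleftrightarrow>
     n \<in> normal_space \<rho>0 X \<and> (\<forall>\<zeta>\<in>normal_space \<rho>0 X. G_metric \<rho>0 (\<lambda>p. w p - n p) \<zeta> = 0)"

definition normal_component ::
  "('d::finite torus \<Rightarrow> real) \<Rightarrow> ('d torus \<Rightarrow> 'd torus) \<Rightarrow> ('d torus \<Rightarrow> real^'d) \<Rightarrow>
     'd torus \<Rightarrow> real^'d" where
  "normal_component \<rho>0 X w =
     (if \<exists>n. is_normal_component \<rho>0 X w n then THE n. is_normal_component \<rho>0 X w n else (\<lambda>p. 0))"

section \<open>The second fundamental form\<close>

text \<open>A curve in a space of maps of a compact manifold is smooth for the Frechet structure iff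
  it is jointly smooth in time and space. The function \<open>\<Gamma>\<close> lifts the curve to \<open>\<real>\<^sup>d\<close>.\<close>

definition curve_lift :: "(real \<Rightarrow> 'd::finite torus \<Rightarrow> 'd torus) \<Rightarrow> ((real \<times> (real^'d)) \<Rightarrow> real^'d) \<Rightarrow> bool" where
  "curve_lift \<gamma> \<Gamma> \<longleftrightarrow> smooth \<Gamma> \<and> (\<forall>t x. \<gamma> t (to_torus x) = to_torus (\<Gamma> (t, x)))"

definition smooth_curve_SDiff :: "(real \<Rightarrow> 'd::finite torus \<Rightarrow> 'd torus) \<Rightarrow> bool" where
  "smooth_curve_SDiff \<gamma> \<longleftrightarrow> (\<forall>t. \<gamma> t \<in> SDiff) \<and> (\<exists>\<Gamma>. curve_lift \<gamma> \<Gamma>)"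

definition velocity_at_0 ::
  "(real \<Rightarrow> 'd::finite torus \<Rightarrow> 'd torus) \<Rightarrow> ('d torus \<Rightarrow> real^'d) \<Rightarrow> bool" where
  "velocity_at_0 \<gamma> \<xi> \<longleftrightarrow>
     (\<exists>\<Gamma>. curve_lift \<gamma> \<Gamma> \<and>
       (\<forall>x. ((\<lambda>t. \<Gamma> (t, x)) has_vector_derivative \<xi> (to_torus x)) (at 0)))"

text \<open>Smoothness of a vector field on \<open>SDiff\<close> is tested along smooth curves, which for Frechet
  manifolds is equivalent to smoothness.\<close>

definition smooth_tangent_field ::
  "(('d::finite torus \<Rightarrow> 'd torus) \<Rightarrow> 'd torus \<Rightarrow> real^'d) \<Rightarrow> bool" where
  "smooth_tangent_field F \<longleftrightarrow>
     (\<forall>Y\<in>SDiff. F Y \<in> tangent_SDiff Y) \<and>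
     (\<forall>\<gamma>. smooth_curve_SDiff \<gamma> \<longrightarrow>
        smooth (\<lambda>(t, x). F (\<gamma> t) (to_torus x) :: real^'d))"

text \<open>As \<open>G_metric\<close> does not depend on the base point, the ambient covariant derivative of a
  field \<open>F\<close> in direction \<open>\<xi>\<close> is the \<open>t\<close>-derivative of \<open>F (\<gamma> t)\<close> for any curve \<open>\<gamma>\<close> in \<open>SDiff\<close>
  with initial velocity \<open>\<xi>\<close>.\<close>

definition second_fundamental_form ::
  "('d::finite torus \<Rightarrow> real) \<Rightarrow> ('d torus \<Rightarrow> 'd torus) \<Rightarrow>
     ('d torus \<Rightarrow> real^'d) \<Rightarrow> ('d torus \<Rightarrow> real^'d) \<Rightarrow> 'd torus \<Rightarrow> real^'d" where
  "second_fundamental_form \<rho>0 X \<xi> \<eta> =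
     (THE n. \<forall>F \<gamma>. smooth_tangent_field F \<and> F X = \<eta> \<and>
        smooth_curve_SDiff \<gamma> \<and> \<gamma> 0 = X \<and> velocity_at_0 \<gamma> \<xi> \<longrightarrow>
        normal_component \<rho>0 X (\<lambda>p. vector_derivative (\<lambda>t. F (\<gamma> t) p) (at 0)) = n)"

section \<open>The operator \<open>Q\<close>\<close>

definition weighted_laplacian ::
  "('d::finite torus \<Rightarrow> real) \<Rightarrow> ('d torus \<Rightarrow> real) \<Rightarrow> 'd torus \<Rightarrow> real" where
  "weighted_laplacian \<rho> \<phi> = dvg (\<lambda>p. inverse (\<rho> p) *\<^sub>R grad \<phi> p)"

definition zero_mean_smooth :: "('d::finite torus \<Rightarrow> real) set" where
  "zero_mean_smooth = {\<phi>. smooth_fun \<phi> \<and> (\<integral>p. \<phi> p \<partial>vol) = 0}"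

text \<open>The value \<open>0\<close> is only a default for arguments outside the range of \<open>weighted_laplacian\<close>;
  for a smooth positive \<open>\<rho>\<close> this range is all of \<open>zero_mean_smooth\<close>.\<close>

definition weighted_laplacian_inv ::
  "('d::finite torus \<Rightarrow> real) \<Rightarrow> ('d torus \<Rightarrow> real) \<Rightarrow> 'd torus \<Rightarrow> real" where
  "weighted_laplacian_inv \<rho> f =
     (if f \<in> weighted_laplacian \<rho> ` zero_mean_smooth
      then inv_into zero_mean_smooth (weighted_laplacian \<rho>) f else (\<lambda>p. 0))"

definition Q_op ::
  "('d::finite torus \<Rightarrow> real) \<Rightarrow> ('d torus \<Rightarrow> real^'d) \<Rightarrow> 'd torus \<Rightarrow> real^'d" where
  "Q_op \<rho> w p = inverse (\<rho> p) *\<^sub>R grad (weighted_laplacian_inv \<rho> (dvg w)) p"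

end

theory Submission
  imports Defs
begin

text \<open>Let \<open>\<gamma>\<close> be a curve in \<open>SDiff\<close> through \<open>X\<close> with velocity \<open>u \<circ> X\<close> and \<open>F\<close> a tangent field with
  \<open>F X = v \<circ> X\<close>. Then \<open>F (\<gamma> t)\<close> has derivative \<open>a \<circ> X\<close> at \<open>0\<close>, where \<open>a - u \<cdot> \<nabla>v\<close> is divergence
  free: it is the time derivative of the divergence free fields \<open>F (\<gamma> t) \<circ> (\<gamma> t)\<^sup>-\<^sup>1\<close>. The normal
  component of \<open>a \<circ> X\<close> only depends on the divergence of \<open>a\<close>. The normal space consists of the
  maps \<open>\<rho>0\<^sup>-\<^sup>1 (\<nabla>\<phi>) \<circ> X\<close>, since a field orthogonal to all divergence free fields is a gradient, so
  the normal component of \<open>a \<circ> X\<close> exists if and only if the Poisson problem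
  \<open>\<nabla> \<cdot> (\<rho>\<^sup>-\<^sup>1 \<nabla>\<phi>) = \<nabla> \<cdot> a\<close> is solvable, and then it is \<open>(\<rho>\<^sup>-\<^sup>1 \<nabla>\<phi>) \<circ> X\<close>. If it were not solvable,
  both sides of the theorem would take their default value \<open>0\<close>; hence no elliptic existence theory
  enters. What has to be constructed is one curve with velocity \<open>u \<circ> X\<close>, namely the flow of \<open>u\<close>
  composed with \<open>X\<close>, which requires the smooth dependence of solutions of differential equations
  on initial values and the invariance of the volume under the flow.\<close>

section \<open>Functions of class \<open>C\<^sup>k\<close>\<close>

text \<open>The definite description in \<open>second_fundamental_form\<close> quantifies over all
  pairs \<open>F\<close>, \<open>\<gamma>\<close>; with no admissible pair every \<open>n\<close>
  would satisfy it. This is why a curve must be exhibited, and it has to be smooth jointly in time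
  and space. Differentiability of solutions in the initial value is obtained without remainder
  estimates: Hadamard's formula writes an increment of the right-hand side as the displacement
  applied to an integral that stays continuous as the displacement shrinks to \<open>0\<close>, so
  the difference quotient of a solution solves a linear equation even at increment \<open>0\<close>,
  where its value is the derivative. \<open>SDiff\<close> is defined through measures of sets, while
  the divergence theorem controls integrals of smooth functions; the two meet because the sets on
  which finitely many smooth functions are positive generate the measurable sets. Analysis on the
  torus runs through periodic lifts. Its main tool is the vanishing of the integral of a divergence,
  used in weak form with test functions chosen to produce integrals of squares.\<close>

abbreviation FD :: "('a::euclidean_space \<Rightarrow> 'b::euclidean_space) \<Rightarrow> 'a \<Rightarrow> 'a \<Rightarrow> 'b" where
  "FD f x \<equiv> frechet_derivative f (at x)"

lemma Ck_SucI:
  assumes "\<And>x. (f has_derivative f' x) (at x)" "\<And>h. Ck k (\<lambda>x. f' x h)"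
  shows "Ck (Suc k) f"
  using assms by auto

lemma Ck_Suc_has_derivative:
  assumes "Ck (Suc k) f"
  shows "(f has_derivative FD f x) (at x)"
  using assms frechet_derivative_at by (metis Ck.simps(2))

text \<open>Derivatives are unique, so the existential witness in \<open>Ck\<close> can be replaced
  by \<open>FD\<close>, which spares later proofs the choice of a witness.\<close>

lemma Ck_Suc_FD:
  assumes "Ck (Suc k) f"
  shows "Ck k (\<lambda>x. FD f x h)"
proof -
  from assms obtain f' where f': "\<And>x. (f has_derivative f' x) (at x)" "\<And>h. Ck k (\<lambda>x. f' x h)"
    by auto
  have "FD f x = f' x" for x
    using frechet_derivative_at[OF f'(1)] by simp
  with f'(2) show ?thesis by simp
qed

lemma Ck_SucD: "Ck (Suc k) f \<Longrightarrow> Ck k f"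
proof (induction k arbitrary: f)
  case 0
  then show ?case
    by (auto simp: continuous_on_eq_continuous_at intro: has_derivative_continuous)
next
  case (Suc k)
  show ?case
    using Suc.prems Suc.IH Ck_Suc_has_derivative[OF Suc.prems] Ck_Suc_FD[OF Suc.prems]
    by (intro Ck_SucI[where f' = "FD f"]) blast+
qed

lemma Ck_imp_continuous: "Ck k f \<Longrightarrow> continuous_on UNIV f"
proof (induction k)
  case (Suc k)
  then show ?case using Ck_SucD by blast
qed simp

lemma Ck_const: "Ck k (\<lambda>x. c)"
proof (induction k arbitrary: c)
  case (Suc k)
  show ?case by (rule Ck_SucI[where f' = "\<lambda>_ _. 0"]) (auto simp: Suc)
qed auto

lemma Ck_linear:
  assumes "bounded_linear f"
  shows "Ck k f"
proof (cases k)
  case 0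
  then show ?thesis
    using assms by (simp add: linear_continuous_on)
next
  case (Suc j)
  show ?thesis unfolding Suc
    by (rule Ck_SucI[where f' = "\<lambda>_. f"]) (auto intro: bounded_linear_imp_has_derivative assms Ck_const)
qed

lemma Ck_add:
  assumes "Ck k f" "Ck k g"
  shows "Ck k (\<lambda>x. f x + g x)"
  using assms
proof (induction k arbitrary: f g)
  case (Suc k)
  note d = Ck_Suc_has_derivative[OF Suc.prems(1)] Ck_Suc_has_derivative[OF Suc.prems(2)]
  show ?case
    by (rule Ck_SucI[where f' = "\<lambda>x h. FD f x h + FD g x h"])
      (auto intro!: has_derivative_add d Suc.IH Ck_Suc_FD Suc.prems)
qed (auto intro: continuous_intros)

lemma Ck_sum:
  assumes "\<And>i. i \<in> I \<Longrightarrow> Ck k (f i)"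
  shows "Ck k (\<lambda>x. \<Sum>i\<in>I. f i x)"
  using assms by (induction I rule: infinite_finite_induct) (auto intro: Ck_const Ck_add)

lemma Ck_bilinear:
  fixes pr :: "'b::euclidean_space \<Rightarrow> 'c::euclidean_space \<Rightarrow> 'd::euclidean_space"
  assumes pr: "bounded_bilinear pr" and "Ck k f" "Ck k g"
  shows "Ck k (\<lambda>x. pr (f x) (g x))"
  using assms(2-)
proof (induction k arbitrary: f g)
  case (0 f g)
  then show ?case
    using bounded_bilinear.continuous_on[OF pr] by auto
next
  case (Suc k)
  note d = Ck_Suc_has_derivative[OF Suc.prems(1)] Ck_Suc_has_derivative[OF Suc.prems(2)]
  show ?case
  proof (rule Ck_SucI)
    show "((\<lambda>x. pr (f x) (g x)) has_derivative (\<lambda>h. pr (f x) (FD g x h) + pr (FD f x h) (g x))) (at x)" for x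
      by (rule bounded_bilinear.FDERIV[OF pr d])
    show "Ck k (\<lambda>x. pr (f x) (FD g x h) + pr (FD f x h) (g x))" for h
      using Suc.prems by (intro Ck_add Suc.IH) (blast intro: Ck_Suc_FD Ck_SucD)+
  qed
qed

lemmas Ck_scaleR = Ck_bilinear[OF bounded_bilinear_scaleR]
lemmas Ck_inner = Ck_bilinear[OF bounded_bilinear_inner]
lemmas Ck_mult = Ck_bilinear[OF bounded_bilinear_mult[where 'a=real]]

lemma Ck_bounded_linear:
  fixes f :: "'a::euclidean_space \<Rightarrow> 'b::euclidean_space" and L :: "'b \<Rightarrow> 'c::euclidean_space"
  assumes "bounded_linear L" "Ck k f"
  shows "Ck k (\<lambda>x. L (f x))"
  using assms(2)
proof (induction k arbitrary: f)
  case 0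
  then show ?case
    using assms(1) by (auto intro: bounded_linear.continuous_on)
next
  case (Suc k)
  show ?case
    by (rule Ck_SucI[where f' = "\<lambda>x h. L (FD f x h)"])
      (auto intro!: bounded_linear.has_derivative[OF assms(1)] Ck_Suc_has_derivative Suc Ck_Suc_FD
         simp del: Ck.simps(2))
qed

lemma Ck_minus: "Ck k f \<Longrightarrow> Ck k (\<lambda>x. - f x)"
  by (rule Ck_bounded_linear[OF bounded_linear_minus[OF bounded_linear_ident]])

lemma Ck_diff: "Ck k f \<Longrightarrow> Ck k g \<Longrightarrow> Ck k (\<lambda>x. f x - g x)"
  using Ck_add[of k f "\<lambda>x. - g x"] Ck_minus[of k g] by simp

lemma Ck_Pair:
  assumes "Ck k f" "Ck k g"
  shows "Ck k (\<lambda>x. (f x, g x))"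
proof -
  have *: "bounded_linear (\<lambda>a. (a, 0::'c))" "bounded_linear (\<lambda>b. (0::'b, b))"
    by (intro bounded_linear_intros)+
  show ?thesis
    using Ck_add[OF Ck_bounded_linear[OF *(1) assms(1)] Ck_bounded_linear[OF *(2) assms(2)]] by simp
qed

lemma linear_euclidean_expand:
  fixes L :: "'a::euclidean_space \<Rightarrow> 'b::real_vector"
  assumes "linear L"
  shows "L h = (\<Sum>b\<in>Basis. (h \<bullet> b) *\<^sub>R L b)"
proof -
  have "L h = L (\<Sum>b\<in>Basis. (h \<bullet> b) *\<^sub>R b)" by (simp add: euclidean_representation)
  also have "\<dots> = (\<Sum>b\<in>Basis. (h \<bullet> b) *\<^sub>R L b)"
    by (simp add: linear_sum[OF assms] linear_cmul[OF assms])
  finally show ?thesis .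
qed

text \<open>The chain rule produces \<open>FD f (g x) (FD g x h)\<close>, where the direction
  depends on \<open>x\<close>. Expanding it in the basis reduces it to fixed directions, the only
  ones that \<open>Ck\<close> controls.\<close>

lemma Ck_compose:
  fixes f :: "'b::euclidean_space \<Rightarrow> 'c::euclidean_space" and g :: "'a::euclidean_space \<Rightarrow> 'b"
  assumes "Ck k f" "Ck k g"
  shows "Ck k (\<lambda>x. f (g x))"
  using assms
proof (induction k arbitrary: f)
  case 0
  then show ?case by (auto intro: continuous_on_compose2)
next
  case (Suc k)
  note d = Ck_Suc_has_derivative[OF Suc.prems(1)] Ck_Suc_has_derivative[OF Suc.prems(2)]
  have expand: "FD f y h = (\<Sum>b\<in>Basis. (h \<bullet> b) *\<^sub>R FD f y b)" for y h
    by (intro linear_euclidean_expand has_derivative_linear[OF d(1)])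
  have "Ck k (\<lambda>x. FD f (g x) b)" for b
    using Suc.IH[OF Ck_Suc_FD[OF Suc.prems(1)] Ck_SucD[OF Suc.prems(2)]] .
  then have "Ck k (\<lambda>x. FD f (g x) (FD g x h))" for h
    by (subst expand) (intro Ck_sum Ck_scaleR Ck_inner Ck_const Ck_Suc_FD Suc.prems)
  then show ?case
    by (intro Ck_SucI[where f' = "\<lambda>x h. FD f (g x) (FD g x h)"] has_derivative_compose[OF d(2) d(1)])
qed

lemma Ck_inverse:
  fixes f :: "'a::euclidean_space \<Rightarrow> real"
  assumes "Ck k f" "\<And>x. f x \<noteq> 0"
  shows "Ck k (\<lambda>x. inverse (f x))"
  using assms
proof (induction k)
  case 0
  then show ?case by (auto intro: continuous_intros)
next
  case (Suc k)
  show ?case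
  proof (rule Ck_SucI)
    show "((\<lambda>x. inverse (f x)) has_derivative (\<lambda>h. - (inverse (f x) * FD f x h * inverse (f x)))) (at x)" for x
      by (rule Deriv.has_derivative_inverse[OF Suc.prems(2) Ck_Suc_has_derivative[OF Suc.prems(1)]])
    show "Ck k (\<lambda>x. - (inverse (f x) * FD f x h * inverse (f x)))" for h
      using Suc.IH[OF Ck_SucD[OF Suc.prems(1)] Suc.prems(2)]
      by (intro Ck_minus Ck_mult Ck_Suc_FD Suc.prems)
  qed
qed

lemma Ck_DERIV:
  assumes "\<And>x::real. (f has_real_derivative f' x) (at x)" "Ck k f'"
  shows "Ck (Suc k) f"
proof (rule Ck_SucI)
  show "(f has_derivative (*) (f' x)) (at x)" for x
    using assms(1) by (simp add: has_field_derivative_def)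
  show "Ck k (\<lambda>x. f' x * h)" for h
    by (intro Ck_mult Ck_const assms)
qed

lemma Ck_exp: "Ck k (exp :: real \<Rightarrow> real)"
proof (induction k)
  case (Suc k)
  then show ?case by (intro Ck_DERIV[where f' = exp]) (auto intro: DERIV_exp)
qed (auto intro: continuous_intros)

lemma Ck_sin_cos: "Ck k (sin :: real \<Rightarrow> real) \<and> Ck k (cos :: real \<Rightarrow> real)"
proof (induction k)
  case (Suc k)
  have "Ck (Suc k) (sin :: real \<Rightarrow> real)"
    using Suc by (intro Ck_DERIV[where f' = cos]) (auto intro: DERIV_sin)
  moreover have "Ck (Suc k) (cos :: real \<Rightarrow> real)"
    using Suc by (intro Ck_DERIV[where f' = "\<lambda>x. - sin x"]) (auto intro: DERIV_cos Ck_minus)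
  ultimately show ?case by blast
qed (auto intro: continuous_intros)

text \<open>Induction on the coordinates in which \<open>h\<close> may be nonzero. The newest
  coordinate is traversed along a segment, where the mean value inequality and the continuity of its
  partial derivative apply; the other coordinates fall under the induction hypothesis.\<close>

lemma strict_derivative_along_basis_subset:
  fixes f :: "'a::euclidean_space \<Rightarrow> 'b::euclidean_space"
  assumes D: "\<And>b x. b \<in> Basis \<Longrightarrow> ((\<lambda>s. f (x + s *\<^sub>R b)) has_vector_derivative D b x) (at 0)"
    and cont: "\<And>b. b \<in> Basis \<Longrightarrow> continuous_on UNIV (D b)"
    and "S \<subseteq> Basis" "e > 0"
  shows "\<exists>d>0. \<forall>y h. norm (y - x0) < d \<longrightarrow> norm h < d \<longrightarrow> (\<forall>b\<in>Basis - S. h \<bullet> b = 0) \<longrightarrow>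
     norm (f (y + h) - f y - (\<Sum>b\<in>S. (h \<bullet> b) *\<^sub>R D b x0)) \<le> e * norm h"
proof -
  have "finite S" using \<open>S \<subseteq> Basis\<close> finite_Basis by (rule finite_subset)
  then show ?thesis using \<open>S \<subseteq> Basis\<close> \<open>e > 0\<close>
  proof (induction S arbitrary: e)
    case empty
    have "norm (f (y + h) - f y) \<le> e * norm h" if "\<forall>b\<in>Basis. h \<bullet> b = 0" for y h :: 'a
      using that euclidean_all_zero_iff[of h] by simp
    then show ?case by (intro exI[of _ 1]) simp
  next
    case (insert b S)
    from insert have b: "b \<in> Basis" by auto
    have SB: "S \<subseteq> Basis" and e2: "e/2 > 0" using insert.prems by auto
    obtain d1 where "d1 > 0"
      "\<forall>y h. norm (y - x0) < d1 \<longrightarrow> norm h < d1 \<longrightarrow> (\<forall>b\<in>Basis - S. h \<bullet> b = 0) \<longrightarrow>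
        norm (f (y + h) - f y - (\<Sum>b\<in>S. (h \<bullet> b) *\<^sub>R D b x0)) \<le> e/2 * norm h"
      using insert.IH[OF SB e2] by (elim exE conjE)
    note d1 = this(1) this(2)[rule_format]
    from cont[OF b] have "isCont (D b) x0" by (simp add: continuous_on_eq_continuous_at)
    then obtain d2 where d2: "d2 > 0" "\<And>z. norm (z - x0) < d2 \<Longrightarrow> norm (D b z - D b x0) < e/2"
      using insert.prems(2) unfolding continuous_at_eps_delta dist_norm by (meson half_gt_zero)
    \<comment> \<open>A point of the segment differs from \<open>x0\<close> by
      \<open>y - x0\<close>, \<open>h'\<close> and \<open>r *\<^sub>R b\<close>, each shorter than
      \<open>d\<close>; hence the factor 3.\<close>
    define d where "d = min d1 d2 / 3"
    have d: "d > 0" "3 * d \<le> d1" "3 * d \<le> d2" using d1 d2 by (auto simp: d_def)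
    have "norm (f (y + h) - f y - (\<Sum>b\<in>insert b S. (h \<bullet> b) *\<^sub>R D b x0)) \<le> e * norm h"
      if y: "norm (y - x0) < d" and h: "norm h < d" and hS: "\<forall>b\<in>Basis - insert b S. h \<bullet> b = 0" for y h
    proof -
      define s where "s = h \<bullet> b"
      define h' where "h' = h - s *\<^sub>R b"
      have s: "\<bar>s\<bar> \<le> norm h" using b by (simp add: s_def Basis_le_norm)
      have h'b: "h' \<bullet> c = (if c = b then 0 else h \<bullet> c)" if "c \<in> Basis" for c
        using that b by (auto simp: h'_def s_def inner_diff_left inner_Basis)
      have h'n: "norm h' \<le> norm h"
        by (rule norm_le_componentwise) (auto simp: h'b)
      have seg: "norm (z - x0) < d2" if "z = y + h' + r *\<^sub>R b" "\<bar>r\<bar> \<le> \<bar>s\<bar>" for z r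
      proof -
        have "norm (z - x0) = norm ((y - x0) + h' + r *\<^sub>R b)" by (simp add: that algebra_simps)
        also have "\<dots> \<le> norm (y - x0) + norm h' + norm (r *\<^sub>R b)"
          by (meson add_mono norm_triangle_ineq order_trans order_refl)
        also have "\<dots> < 3 * d" using y h h'n s that(2) b by auto
        finally show ?thesis using d by linarith
      qed
      have "norm (f (y + h' + s *\<^sub>R b) - f (y + h' + 0 *\<^sub>R b) - (s - 0) *\<^sub>R D b x0) \<le> norm (s - 0) * (e/2)"
      proof -
        \<comment> \<open>Subtracting the expected linear part leaves a derivative of norm below
          \<open>e/2\<close> on the segment, by continuity of \<open>D b\<close> at
          \<open>x0\<close>.\<close>
        define g where "g = (\<lambda>r. f (y + h' + r *\<^sub>R b) - r *\<^sub>R D b x0)"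
        have g': "(g has_vector_derivative D b (y + h' + r *\<^sub>R b) - D b x0) (at r within T)" for r T
        proof -
          have "((\<lambda>q. f ((y + h' + r *\<^sub>R b) + q *\<^sub>R b)) has_vector_derivative D b (y + h' + r *\<^sub>R b)) (at (r - r))"
            using D[OF b] by simp
          then have "((\<lambda>q. f ((y + h' + r *\<^sub>R b) + q *\<^sub>R b)) \<circ> (\<lambda>q. q - r) has_vector_derivative 1 *\<^sub>R D b (y + h' + r *\<^sub>R b)) (at r)"
            by (intro vector_diff_chain_at) (auto intro!: derivative_eq_intros)
          then have "((\<lambda>q. f (y + h' + q *\<^sub>R b)) has_vector_derivative D b (y + h' + r *\<^sub>R b)) (at r)"
            by (simp add: o_def algebra_simps)
          moreover have "((\<lambda>q. q *\<^sub>R D b x0) has_vector_derivative D b x0) (at r)"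
            unfolding has_vector_derivative_def
            by (rule bounded_linear_imp_has_derivative[OF bounded_linear_scaleR_left])
          ultimately show ?thesis unfolding g_def
            by (rule has_vector_derivative_at_within[OF has_vector_derivative_diff])
        qed
        have "norm (g s - g 0) \<le> (e/2) * norm (s - 0)"
        proof (rule differentiable_bound[where f' = "\<lambda>r q. q *\<^sub>R (D b (y + h' + r *\<^sub>R b) - D b x0)"])
          show "convex (closed_segment 0 s)" by simp
          show "(g has_derivative (\<lambda>q. q *\<^sub>R (D b (y + h' + r *\<^sub>R b) - D b x0))) (at r within closed_segment 0 s)" for r
            using g' by (simp add: has_vector_derivative_def)
          fix r assume "r \<in> closed_segment 0 s"
          then have "\<bar>r\<bar> \<le> \<bar>s\<bar>" by (auto simp: closed_segment_eq_real_ivl split: if_splits)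
          then have "norm (D b (y + h' + r *\<^sub>R b) - D b x0) < e/2"
            by (intro d2 seg[OF refl])
          then show "onorm (\<lambda>q. q *\<^sub>R (D b (y + h' + r *\<^sub>R b) - D b x0)) \<le> e/2"
            by (simp add: onorm_scaleR_left onorm_id)
        qed auto
        then show ?thesis by (simp add: g_def algebra_simps)
      qed
      moreover have "norm (f (y + h') - f y - (\<Sum>c\<in>S. (h' \<bullet> c) *\<^sub>R D c x0)) \<le> e/2 * norm h'"
        using y h h'n d hS by (intro d1) (auto simp: h'b)
      moreover have "(\<Sum>c\<in>S. (h' \<bullet> c) *\<^sub>R D c x0) = (\<Sum>c\<in>S. (h \<bullet> c) *\<^sub>R D c x0)"
        using insert by (intro sum.cong) (auto simp: h'b)
      moreover have "y + h' + s *\<^sub>R b = y + h" by (simp add: h'_def)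
      ultimately have 1: "norm (f (y + h) - f (y + h') - s *\<^sub>R D b x0) \<le> \<bar>s\<bar> * (e/2)"
        and 2: "norm (f (y + h') - f y - (\<Sum>c\<in>S. (h \<bullet> c) *\<^sub>R D c x0)) \<le> e/2 * norm h'"
        by auto
      have "f (y + h) - f y - (\<Sum>b\<in>insert b S. (h \<bullet> b) *\<^sub>R D b x0)
        = (f (y + h) - f (y + h') - s *\<^sub>R D b x0) + (f (y + h') - f y - (\<Sum>c\<in>S. (h \<bullet> c) *\<^sub>R D c x0))"
        using insert by (simp add: s_def)
      also have "norm \<dots> \<le> \<bar>s\<bar> * (e/2) + e/2 * norm h'"
        using 1 2 by (meson add_mono norm_triangle_ineq order_trans)
      also have "\<dots> \<le> norm h * (e/2) + e/2 * norm h"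
        using s h'n insert.prems by (intro add_mono mult_right_mono mult_left_mono) auto
      finally show ?thesis by (simp add: field_simps)
    qed
    with d show ?case by blast
  qed
qed

lemma continuous_partials_imp_has_derivative:
  fixes f :: "'a::euclidean_space \<Rightarrow> 'b::euclidean_space"
  assumes "\<And>b x. b \<in> Basis \<Longrightarrow> ((\<lambda>s. f (x + s *\<^sub>R b)) has_vector_derivative D b x) (at 0)"
    and "\<And>b. b \<in> Basis \<Longrightarrow> continuous_on UNIV (D b)"
  shows "(f has_derivative (\<lambda>h. \<Sum>b\<in>Basis. (h \<bullet> b) *\<^sub>R D b x)) (at x)"
  unfolding has_derivative_at_alt
proof (intro conjI allI impI)
  show "bounded_linear (\<lambda>h. \<Sum>b\<in>Basis. (h \<bullet> b) *\<^sub>R D b x)"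
    by (intro bounded_linear_sum bounded_linear_compose[OF bounded_linear_scaleR_left] bounded_linear_inner_left)
  fix e :: real assume "e > 0"
  then obtain d where d: "d > 0" "\<And>y h. norm (y - x) < d \<Longrightarrow> norm h < d \<Longrightarrow>
     norm (f (y + h) - f y - (\<Sum>b\<in>Basis. (h \<bullet> b) *\<^sub>R D b x)) \<le> e * norm h"
    using strict_derivative_along_basis_subset[OF assms, of Basis e x] by auto
  from d(2)[of x "y - x" for y] d(1)
  show "\<exists>d>0. \<forall>y. norm (y - x) < d \<longrightarrow>
      norm (f y - f x - (\<Sum>b\<in>Basis. ((y - x) \<bullet> b) *\<^sub>R D b x)) \<le> e * norm (y - x)"
    by auto
qed

text \<open>The criterion for functions known only through their partial derivatives: parameter
  integrals and solutions of differential equations.\<close>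

lemma Ck_partialsI:
  fixes f :: "'a::euclidean_space \<Rightarrow> 'b::euclidean_space"
  assumes "\<And>b x. b \<in> Basis \<Longrightarrow> ((\<lambda>s. f (x + s *\<^sub>R b)) has_vector_derivative D b x) (at 0)"
    and "\<And>b. b \<in> Basis \<Longrightarrow> Ck k (D b)"
  shows "Ck (Suc k) f"
  by (rule Ck_SucI[OF continuous_partials_imp_has_derivative[OF assms(1)]])
    (auto intro!: Ck_sum Ck_scaleR Ck_const assms intro: Ck_imp_continuous)

section \<open>Integrals depending on a parameter\<close>

lemma integral_param_continuous:
  fixes f :: "'c::euclidean_space \<Rightarrow> 'a::topological_space \<Rightarrow> 'b::banach"
  assumes "continuous_on UNIV (\<lambda>(y, x). f y x)"
  shows "continuous_on UNIV (\<lambda>x. integral (cbox a b) (\<lambda>y. f y x))"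
proof (rule integral_continuous_on_param)
  have "continuous_on (UNIV \<times> cbox a b) (\<lambda>z. (\<lambda>(y, x). f y x) (snd z, fst z))"
    by (rule continuous_on_compose2[OF assms]) (auto intro!: continuous_intros)
  then show "continuous_on (UNIV \<times> cbox a b) (\<lambda>(x, y). f y x)"
    by (simp add: split_beta)
qed

lemma continuous_on_Pair_fixed:
  assumes "continuous_on UNIV (\<lambda>(y, x). f y x)" "continuous_on S g" "continuous_on S h"
  shows "continuous_on S (\<lambda>z. f (g z) (h z))"
  using continuous_on_compose2[OF assms(1) continuous_on_Pair[OF assms(2,3)]] by simp

lemma has_vector_derivative_line:
  assumes "Ck (Suc k) f"
  shows "((\<lambda>s. f (x + s *\<^sub>R h)) has_vector_derivative FD f (x + s *\<^sub>R h) h) (at s within T)"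
proof -
  have "((\<lambda>s. x + s *\<^sub>R h) has_derivative (\<lambda>r. r *\<^sub>R h)) (at s within T)"
    by (auto intro!: derivative_eq_intros)
  from has_derivative_compose[OF this Ck_Suc_has_derivative[OF assms]]
  have "((\<lambda>s. f (x + s *\<^sub>R h)) has_derivative (\<lambda>r. FD f (x + s *\<^sub>R h) (r *\<^sub>R h))) (at s within T)" .
  moreover have "FD f (x + s *\<^sub>R h) (r *\<^sub>R h) = r *\<^sub>R FD f (x + s *\<^sub>R h) h" for r
    using has_derivative_linear[OF Ck_Suc_has_derivative[OF assms]] by (rule linear_cmul)
  ultimately show ?thesis by (simp add: has_vector_derivative_def)
qed

lemma integral_param_directional_derivative:
  fixes f :: "'c::euclidean_space \<times> 'a::euclidean_space \<Rightarrow> 'b::euclidean_space"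
  assumes f: "Ck (Suc k) f"
  shows "((\<lambda>s. integral (cbox a b) (\<lambda>y. f (y, x + s *\<^sub>R e))) has_vector_derivative
        integral (cbox a b) (\<lambda>y. FD f (y, x) (0, e))) (at 0)"
proof -
  note cont = Ck_imp_continuous[OF f] Ck_imp_continuous[OF Ck_Suc_FD[OF f]]
  have "((\<lambda>s. integral (cbox a b) (\<lambda>y. f (y, x + s *\<^sub>R e))) has_vector_derivative
      integral (cbox a b) (\<lambda>y. FD f (y, x + 0 *\<^sub>R e) (0, e))) (at 0 within UNIV)"
  proof (rule leibniz_rule_vector_derivative)
    show "((\<lambda>s. f (y, x + s *\<^sub>R e)) has_vector_derivative FD f (y, x + s *\<^sub>R e) (0, e)) (at s within UNIV)" for s y
      using has_vector_derivative_line[OF f, of "(y, x)" "(0, e)" s] by simp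
    show "(\<lambda>y. f (y, x + s *\<^sub>R e)) integrable_on cbox a b" for s
      by (intro integrable_continuous continuous_on_compose2[OF cont(1)] continuous_intros) auto
    show "continuous_on (UNIV \<times> cbox a b) (\<lambda>(s, y). FD f (y, x + s *\<^sub>R e) (0, e))"
      unfolding split_beta
      by (intro continuous_on_compose2[OF cont(2)] continuous_intros) auto
  qed auto
  then show ?thesis by simp
qed

lemma Ck_integral_param:
  fixes f :: "'c::euclidean_space \<times> 'a::euclidean_space \<Rightarrow> 'b::euclidean_space"
  assumes "Ck k f"
  shows "Ck k (\<lambda>x. integral (cbox a b) (\<lambda>y. f (y, x)))"
  using assms
proof (induction k arbitrary: f)
  case 0
  then show ?case
    using integral_param_continuous[of "\<lambda>y x. f (y, x)"] by simp
next
  case (Suc k)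
  show ?case
    by (rule Ck_partialsI[OF integral_param_directional_derivative[OF Suc.prems]])
      (rule Suc.IH[OF Ck_Suc_FD[OF Suc.prems]])
qed

text \<open>The fundamental theorem along the segment from \<open>x\<close> to \<open>x + h\<close>.
  For \<open>h\<close> of the form \<open>r *\<^sub>R e\<close> it shows the increment as
  \<open>r\<close> times a function that is continuous at \<open>r = 0\<close> too, the source of
  the difference quotients below.\<close>

lemma Hadamard:
  assumes "Ck (Suc k) f"
  shows "f (x + h) - f x = integral (cbox 0 1) (\<lambda>s. FD f (x + s *\<^sub>R h) h)"
proof -
  have "((\<lambda>s. FD f (x + s *\<^sub>R h) h) has_integral (f (x + 1 *\<^sub>R h) - f (x + 0 *\<^sub>R h))) {0..1}"
    by (rule fundamental_theorem_of_calculus) (auto intro: has_vector_derivative_line[OF assms])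
  then show ?thesis by (simp add: integral_unique)
qed

text \<open>The scaled integral is the integral of \<open>F\<close> from \<open>0\<close> to
  \<open>t\<close>, moved to a fixed interval, so that negative times and the dependence on
  parameters need no separate treatment.\<close>

lemma integral_scaled_has_vector_derivative:
  fixes F :: "real \<Rightarrow> 'b::banach"
  assumes cont: "continuous_on UNIV F"
  shows "((\<lambda>t. t *\<^sub>R integral (cbox 0 1) (\<lambda>s. F (s * t))) has_vector_derivative F t) (at t)"
proof -
  define T where "T = \<bar>t\<bar> + 1"
  define G where "G u = integral {-T..u} F" for u
  have G: "(G has_vector_derivative F u) (at u)" if "u \<in> {-T<..<T}" for u
  proof -
    have "(G has_vector_derivative F u) (at u within {-T..T})"
      unfolding G_def using that
      by (intro integral_has_vector_derivative continuous_on_subset[OF cont]) auto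
    then show ?thesis
      using that by (simp add: at_within_Icc_at)
  qed
  have eq: "G r - G 0 = r *\<^sub>R integral (cbox 0 1) (\<lambda>s. F (s * r))" if r: "r \<in> {-T<..<T}" for r
  proof -
    have "((\<lambda>s. r *\<^sub>R F (s * r)) has_integral (G (1 * r) - G (0 * r))) {0..1}"
    proof (rule fundamental_theorem_of_calculus)
      fix s :: real assume s: "s \<in> {0..1}"
      have "\<bar>s * r\<bar> \<le> 1 * \<bar>r\<bar>" unfolding abs_mult using s by (intro mult_right_mono) auto
      then have "s * r \<in> {-T<..<T}" using r by auto
      then have "((G \<circ> (\<lambda>s. s * r)) has_vector_derivative r *\<^sub>R F (s * r)) (at s)"
        by (intro vector_diff_chain_at G) (auto intro!: derivative_eq_intros simp: has_real_derivative_iff_has_vector_derivative[symmetric])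
      then show "((\<lambda>s. G (s * r)) has_vector_derivative r *\<^sub>R F (s * r)) (at s within {0..1})"
        by (simp add: o_def has_vector_derivative_at_within)
    qed simp
    from integral_unique[OF this] show ?thesis by simp
  qed
  have t: "t \<in> {-T<..<T}" by (auto simp: T_def)
  have "((\<lambda>r. G r - G 0) has_vector_derivative F t - 0) (at t)"
    by (rule has_vector_derivative_diff[OF G[OF t] has_vector_derivative_const])
  then show ?thesis
    using has_vector_derivative_transform_within_open[OF _ _ t eq] by simp
qed

section \<open>Ordinary differential equations\<close>

text \<open>Gronwall's argument: the weight \<open>exp (- (2 * K) * s)\<close> absorbs the possible
  growth of \<open>w s \<bullet> w s\<close>, so the product cannot increase from its initial value
  \<open>0\<close>.\<close>

lemma ode_zero_unique_forward:
  fixes w :: "real \<Rightarrow> 'e::real_inner"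
  assumes w: "\<And>t. (w has_vector_derivative w' t) (at t)" and "w 0 = 0" "t \<ge> 0"
    and K: "\<And>s. 0 \<le> s \<Longrightarrow> s \<le> t \<Longrightarrow> norm (w' s) \<le> K * norm (w s)"
  shows "w t = 0"
proof -
  define \<phi> where "\<phi> s = exp (- (2 * K) * s) * (w s \<bullet> w s)" for s
  have "\<exists>y. (\<phi> has_real_derivative y) (at s) \<and> y \<le> 0" if "0 \<le> s" "s \<le> t" for s
  proof -
    have "((\<lambda>s. w s \<bullet> w s) has_vector_derivative (w s \<bullet> w' s + w' s \<bullet> w s)) (at s)"
      by (rule bounded_bilinear.has_vector_derivative[OF bounded_bilinear_inner w w])
    then have "((\<lambda>s. w s \<bullet> w s) has_real_derivative (2 * (w s \<bullet> w' s))) (at s)"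
      by (simp add: has_real_derivative_iff_has_vector_derivative inner_commute)
    then have "(\<phi> has_real_derivative exp (- (2 * K) * s) * (2 * (w s \<bullet> w' s) - 2 * K * (w s \<bullet> w s))) (at s)"
      unfolding \<phi>_def by (auto intro!: derivative_eq_intros simp: algebra_simps)
    moreover have "w s \<bullet> w' s \<le> K * (w s \<bullet> w s)"
    proof -
      have "w s \<bullet> w' s \<le> norm (w s) * norm (w' s)" by (rule norm_cauchy_schwarz)
      also have "\<dots> \<le> norm (w s) * (K * norm (w s))"
        using K[OF that] by (rule mult_left_mono) simp
      finally show ?thesis by (simp add: dot_square_norm power2_eq_square algebra_simps)
    qed
    then have "exp (- (2 * K) * s) * (2 * (w s \<bullet> w' s) - 2 * K * (w s \<bullet> w s)) \<le> 0"
      by (intro mult_nonneg_nonpos) auto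
    ultimately show ?thesis by blast
  qed
  from DERIV_nonpos_imp_nonincreasing[OF \<open>t \<ge> 0\<close> this] have "\<phi> t \<le> \<phi> 0" by blast
  then have "w t \<bullet> w t \<le> 0"
    using \<open>w 0 = 0\<close> by (simp add: \<phi>_def mult_le_0_iff)
  then show ?thesis by (metis inner_gt_zero_iff not_le)
qed

text \<open>Negative times are reduced to positive ones by reversing time.\<close>

lemma ode_zero_unique:
  fixes w :: "real \<Rightarrow> 'e::real_inner"
  assumes w: "\<And>t. (w has_vector_derivative w' t) (at t)" and "w 0 = 0"
    and K: "\<And>T. \<exists>K. \<forall>s. \<bar>s\<bar> \<le> T \<longrightarrow> norm (w' s) \<le> K * norm (w s)"
  shows "w t = 0"
proof -
  from K obtain K where K: "\<And>s. \<bar>s\<bar> \<le> \<bar>t\<bar> \<Longrightarrow> norm (w' s) \<le> K * norm (w s)" by blast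
  show ?thesis
  proof (cases "t \<ge> 0")
    case True
    then show ?thesis using K by (intro ode_zero_unique_forward[OF w \<open>w 0 = 0\<close>, where K = K]) auto
  next
    case False
    have "((w \<circ> uminus) has_vector_derivative (-1) *\<^sub>R w' (- s)) (at s)" for s
      by (intro vector_diff_chain_at w)
        (auto intro!: derivative_eq_intros simp: has_real_derivative_iff_has_vector_derivative[symmetric])
    then have "((\<lambda>s. w (- s)) has_vector_derivative - w' (- s)) (at s)" for s
      by (simp add: o_def)
    from ode_zero_unique_forward[OF this, of "- t" K] False K \<open>w 0 = 0\<close> show ?thesis by auto
  qed
qed

text \<open>Picard iteration on time and parameter at once, so that the locally uniform limit is
  continuous in both. The Lipschitz bound is global in \<open>y\<close>, which makes the iteration
  converge for all times.\<close>

lemma ode_param_exists: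
  fixes g :: "real \<times> 'p::euclidean_space \<Rightarrow> 'e::euclidean_space \<Rightarrow> 'e" and y0 :: "'p \<Rightarrow> 'e"
  assumes g: "continuous_on UNIV (\<lambda>(z, y). g z y)" and y0: "continuous_on UNIV y0"
    and lip: "\<And>R. \<exists>K. \<forall>z\<in>cball 0 R. \<forall>y y'. norm (g z y - g z y') \<le> K * norm (y - y')"
  obtains Y where "continuous_on UNIV Y" "\<And>p. Y (0, p) = y0 p"
    "\<And>t p. ((\<lambda>t. Y (t, p)) has_vector_derivative g (t, p) (Y (t, p))) (at t)"
proof -
  \<comment> \<open>\<open>P\<close> is the Picard operator with the time integral rescaled to the
    unit interval by \<open>S\<close>. Since \<open>S s\<close> maps each ball around
    \<open>0\<close> into itself, one Lipschitz constant per ball serves all iterates.\<close>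
  define S where "S s z = (s * fst z, snd z)" for s and z :: "real \<times> 'p"
  define P where "P W z = y0 (snd z) + fst z *\<^sub>R integral (cbox 0 1) (\<lambda>s. g (S s z) (W (S s z)))" for W z
  define Y where "Y n = (P ^^ n) (\<lambda>z. y0 (snd z))" for n
  have Y0: "Y 0 z = y0 (snd z)" and YSuc: "Y (Suc n) = P (Y n)" for n z
    by (simp_all add: Y_def)
  have contS: "continuous_on T (\<lambda>x. S (a x) (b x))" if "continuous_on T a" "continuous_on T b"
    for T and a :: "'z::topological_space \<Rightarrow> real" and b
    unfolding S_def by (intro continuous_intros that)
  have contgW: "continuous_on T (\<lambda>x. g (h x) (W (h x)))"
    if "continuous_on UNIV W" "continuous_on T h" for T and h :: "'z::topological_space \<Rightarrow> _" and W
    by (intro continuous_on_Pair_fixed[OF g] that(2) continuous_on_compose2[OF that(1,2)]) auto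
  have contP: "continuous_on UNIV (P W)" if "continuous_on UNIV W" for W
    unfolding P_def split_beta
    by (intro continuous_intros continuous_on_compose2[OF y0] integral_param_continuous)
      (auto simp: split_beta intro!: contgW[OF that] contS continuous_intros)
  have contY: "continuous_on UNIV (Y n)" for n
  proof (induction n)
    case 0
    then show ?case unfolding Y0[abs_def] by (intro continuous_on_compose2[OF y0] continuous_intros) auto
  qed (simp add: YSuc contP)
  have Sball: "S s z \<in> cball 0 R" if "z \<in> cball 0 R" "s \<in> cbox 0 1" for s z R
  proof -
    have "\<bar>s * fst z\<bar> \<le> 1 * \<bar>fst z\<bar>" unfolding abs_mult using that by (intro mult_right_mono) auto
    then have "norm (S s z) \<le> norm z"
      by (simp add: S_def norm_Pair norm_prod_def power_mono abs_le_square_iff)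
    then show ?thesis using that by simp
  qed
  \<comment> \<open>The limit is written as a telescoping series, the form to which the Weierstrass
    test applies.\<close>
  define L where "L z = Y 0 z + suminf (\<lambda>n. Y (Suc n) z - Y n z)" for z
  have unif: "uniform_limit (cball 0 R) Y L sequentially" for R
  proof -
    from lip[of R] obtain K0 where K0: "\<forall>z\<in>cball 0 R. \<forall>y y'. norm (g z y - g z y') \<le> K0 * norm (y - y')" by blast
    define K where "K = max K0 0"
    have K: "norm (g z y - g z y') \<le> K * norm (y - y')" if "z \<in> cball 0 R" for z y y'
    proof -
      have "norm (g z y - g z y') \<le> K0 * norm (y - y')" using K0 that by blast
      also have "\<dots> \<le> K * norm (y - y')" by (intro mult_right_mono) (auto simp: K_def)
      finally show ?thesis .
    qed
    have "K \<ge> 0" by (simp add: K_def)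
    have "compact ((\<lambda>z. Y 1 z - Y 0 z) ` cball 0 R)"
      by (intro compact_continuous_image continuous_intros continuous_on_subset[OF contY]) auto
    then obtain C where C: "\<And>z. z \<in> cball 0 R \<Longrightarrow> norm (Y 1 z - Y 0 z) \<le> C"
      by (metis (no_types, lifting) compact_imp_bounded bounded_iff imageI)
    define C' where "C' = max C 0"
    \<comment> \<open>\<open>C'\<close> bounds the first increment. Each further iteration
      integrates \<open>s ^ n\<close> over the unit interval and supplies the next factor
      \<open>1 / (n + 1)\<close> of the inverse factorial.\<close>
    have bound: "norm (Y (Suc n) z - Y n z) \<le> C' * (K * \<bar>fst z\<bar>) ^ n / fact n" if "z \<in> cball 0 R" for n z
      using that
    proof (induction n arbitrary: z)
      case 0
      then show ?case using C[OF 0] by (simp add: C'_def)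
    next
      case (Suc n)
      define d where "d s = g (S s z) (Y (Suc n) (S s z)) - g (S s z) (Y n (S s z))" for s
      have cgs: "continuous_on (cbox 0 1) (\<lambda>s. g (S s z) (Y m (S s z)))" for m
        by (intro contgW contY contS continuous_intros)
      note ig = integrable_continuous[OF cgs]
      have YP: "Y (Suc m) z = y0 (snd z) + fst z *\<^sub>R integral (cbox 0 1) (\<lambda>s. g (S s z) (Y m (S s z)))" for m
        by (simp only: YSuc P_def)
      have "Y (Suc (Suc n)) z - Y (Suc n) z = fst z *\<^sub>R integral (cbox 0 1) d"
        unfolding YP d_def integral_diff[OF ig ig] by (simp add: scaleR_diff_right)
      also have "norm \<dots> = \<bar>fst z\<bar> * norm (integral (cbox 0 1) d)" by simp
      also have "norm (integral (cbox 0 1) d) \<le> integral (cbox 0 1) (\<lambda>s. K * (C' * (K * \<bar>fst z\<bar>) ^ n / fact n) * s ^ n)"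
      proof (rule integral_norm_bound_integral)
        show "d integrable_on cbox 0 1" unfolding d_def by (intro integrable_continuous continuous_intros cgs)
        show "(\<lambda>s. K * (C' * (K * \<bar>fst z\<bar>) ^ n / fact n) * s ^ n) integrable_on cbox 0 1"
          by (intro integrable_continuous continuous_intros)
        fix s :: real assume s: "s \<in> cbox 0 1"
        have "norm (d s) \<le> K * norm (Y (Suc n) (S s z) - Y n (S s z))"
          unfolding d_def by (rule K[OF Sball[OF Suc.prems s]])
        also have "\<dots> \<le> K * (C' * (K * \<bar>fst (S s z)\<bar>) ^ n / fact n)"
          using Suc.IH[OF Sball[OF Suc.prems s]] \<open>K \<ge> 0\<close> by (rule mult_left_mono)
        also have "\<dots> = K * (C' * (K * \<bar>fst z\<bar>) ^ n / fact n) * s ^ n"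
          using s by (simp add: S_def abs_mult power_mult_distrib)
        finally show "norm (d s) \<le> K * (C' * (K * \<bar>fst z\<bar>) ^ n / fact n) * s ^ n" .
      qed
      also have "integral (cbox 0 1) (\<lambda>s. K * (C' * (K * \<bar>fst z\<bar>) ^ n / fact n) * s ^ n)
          = K * (C' * (K * \<bar>fst z\<bar>) ^ n / fact n) * (1 / (n + 1))"
      proof -
        have "((\<lambda>s::real. s ^ n) has_integral (1 ^ Suc n / real (Suc n) - 0 ^ Suc n / real (Suc n))) {0..1}"
          by (rule fundamental_theorem_of_calculus)
            (auto intro!: derivative_eq_intros simp: has_real_derivative_iff_has_vector_derivative[symmetric] simp del: power_Suc)
        then have "integral (cbox 0 1) (\<lambda>s::real. s ^ n) = 1 / (n + 1)"
          by (simp add: integral_unique add.commute)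
        then show ?thesis by (simp only: integral_mult_right)
      qed
      also have "\<bar>fst z\<bar> * (K * (C' * (K * \<bar>fst z\<bar>) ^ n / fact n) * (1 / (n + 1)))
          = C' * (K * \<bar>fst z\<bar>) ^ Suc n / fact (Suc n)"
        by (simp add: field_simps)
      finally show ?case by (simp add: mult_left_mono)
    qed
    have "uniform_limit (cball 0 R) (\<lambda>n z. \<Sum>i<n. Y (Suc i) z - Y i z) (\<lambda>z. suminf (\<lambda>n. Y (Suc n) z - Y n z)) sequentially"
    proof (rule Weierstrass_m_test)
      show "summable (\<lambda>n. C' * ((K * R) ^ n /\<^sub>R fact n))"
        by (intro summable_mult summable_exp_generic)
      fix n z assume z: "z \<in> cball (0 :: real \<times> 'p) R"
      have "\<bar>fst z\<bar> \<le> R" using z norm_fst_le[of "fst z" "snd z"] by auto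
      then have "C' * (K * \<bar>fst z\<bar>) ^ n / fact n \<le> C' * (K * R) ^ n / fact n"
        using \<open>K \<ge> 0\<close> by (intro divide_right_mono mult_left_mono power_mono) (auto simp: C'_def)
      then show "norm (Y (Suc n) z - Y n z) \<le> C' * ((K * R) ^ n /\<^sub>R fact n)"
        using bound[OF z, of n] by (simp add: divide_inverse mult_ac)
    qed
    then have "uniform_limit (cball 0 R) (\<lambda>n z. Y 0 z + (\<Sum>i<n. Y (Suc i) z - Y i z)) L sequentially"
      unfolding L_def by (intro uniform_limit_add uniform_limit_const)
    moreover have "Y 0 z + (\<Sum>i<n. Y (Suc i) z - Y i z) = Y n z" for n z
      by (subst sum_lessThan_telescope) simp
    ultimately show ?thesis by simp
  qed
  have contL: "continuous_on UNIV L"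
  proof -
    have "isCont L z" for z
    proof -
      have "continuous_on (cball 0 (norm z + 1)) L"
        by (rule uniform_limit_theorem[OF _ unif])
          (auto intro!: always_eventually continuous_on_subset[OF contY])
      then have "continuous_on (ball 0 (norm z + 1)) L"
        by (rule continuous_on_subset) auto
      then show ?thesis by (simp add: continuous_on_eq_continuous_at)
    qed
    then show ?thesis by (simp add: continuous_on_eq_continuous_at)
  qed
  have fixpt: "L z = P L z" for z
  proof -
    define R where "R = norm z"
    have z: "z \<in> cball 0 R" by (simp add: R_def)
    from lip[of R] obtain K where K: "\<And>z y y'. z \<in> cball 0 R \<Longrightarrow> norm (g z y - g z y') \<le> K * norm (y - y')" by blast
    have ul: "uniform_limit (cbox 0 1) (\<lambda>n s. g (S s z) (Y n (S s z))) (\<lambda>s. g (S s z) (L (S s z))) sequentially"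
    proof (rule uniform_limitI)
      fix e :: real assume "e > 0"
      \<comment> \<open>The constant \<open>K\<close> may be zero or negative; the denominator is
        positive in every case.\<close>
      define e' where "e' = e / (\<bar>K\<bar> + 1)"
      have "e' > 0" using \<open>e > 0\<close> by (simp add: e'_def)
      from uniform_limitD[OF unif this]
      have "\<forall>\<^sub>F n in sequentially. \<forall>w\<in>cball 0 R. dist (Y n w) (L w) < e'" .
      then show "\<forall>\<^sub>F n in sequentially. \<forall>s\<in>cbox 0 1. dist (g (S s z) (Y n (S s z))) (g (S s z) (L (S s z))) < e"
      proof (rule eventually_mono, intro ballI)
        fix n and s :: real assume *: "\<forall>w\<in>cball 0 R. dist (Y n w) (L w) < e'" and s: "s \<in> cbox 0 1"
        note SR = Sball[OF z s]
        have "dist (g (S s z) (Y n (S s z))) (g (S s z) (L (S s z))) \<le> K * dist (Y n (S s z)) (L (S s z))"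
          unfolding dist_norm by (rule K[OF SR])
        also have "\<dots> \<le> \<bar>K\<bar> * dist (Y n (S s z)) (L (S s z))"
          by (intro mult_right_mono) auto
        also have "\<dots> \<le> \<bar>K\<bar> * e'"
          using * SR by (intro mult_left_mono) (auto simp: less_imp_le)
        also have "\<dots> < (\<bar>K\<bar> + 1) * e'" using \<open>e' > 0\<close> by simp
        also have "\<dots> = e" by (simp add: e'_def)
        finally show "dist (g (S s z) (Y n (S s z))) (g (S s z) (L (S s z))) < e" .
      qed
    qed
    have cgs: "continuous_on (cbox 0 1) (\<lambda>s. g (S s z) (Y n (S s z)))" for n
      by (intro contgW contY contS continuous_intros)
    obtain I J where IJ: "\<And>n. ((\<lambda>s. g (S s z) (Y n (S s z))) has_integral I n) (cbox 0 1)"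
       "((\<lambda>s. g (S s z) (L (S s z))) has_integral J) (cbox 0 1)" "I \<longlonglongrightarrow> J"
      using uniform_limit_integral_cbox[OF ul cgs] by auto
    have "(\<lambda>n. Y (Suc n) z) \<longlonglongrightarrow> P L z"
      unfolding YSuc P_def integral_unique[OF IJ(1)] integral_unique[OF IJ(2)]
      by (intro tendsto_intros IJ)
    moreover have "(\<lambda>n. Y (Suc n) z) \<longlonglongrightarrow> L z"
      using tendsto_uniform_limitI[OF unif z] by (rule LIMSEQ_Suc)
    ultimately show ?thesis using LIMSEQ_unique by blast
  qed
  show ?thesis
  proof (rule that[OF contL])
    show "L (0, p) = y0 p" for p by (subst fixpt) (simp add: P_def)
    show "((\<lambda>t. L (t, p)) has_vector_derivative g (t, p) (L (t, p))) (at t)" for t p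
    proof -
      have "continuous_on UNIV (\<lambda>t. g (t, p) (L (t, p)))"
        by (intro contgW[OF contL] continuous_intros)
      from integral_scaled_has_vector_derivative[OF this]
      have "((\<lambda>t. y0 p + t *\<^sub>R integral (cbox 0 1) (\<lambda>s. g (s * t, p) (L (s * t, p)))) has_vector_derivative
          0 + g (t, p) (L (t, p))) (at t)"
        by (intro has_vector_derivative_add has_vector_derivative_const)
      then show ?thesis
        by (subst fixpt[abs_def]) (simp add: P_def S_def)
    qed
  qed
qed

section \<open>Linear equations and the regularity of their solutions in the parameters\<close>

lemma norm_linear_combination_le:
  fixes y :: "'e::euclidean_space"
  shows "norm (\<Sum>b\<in>Basis. (y \<bullet> b) *\<^sub>R a b) \<le> (\<Sum>b\<in>Basis. norm (a b)) * norm y"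
proof -
  have "norm (\<Sum>b\<in>Basis. (y \<bullet> b) *\<^sub>R a b) \<le> (\<Sum>b\<in>Basis. norm ((y \<bullet> b) *\<^sub>R a b))"
    by (rule norm_sum)
  also have "\<dots> \<le> (\<Sum>b\<in>Basis. norm (a b) * norm y)"
    by (intro sum_mono) (simp add: Basis_le_norm mult.commute[of "norm (a _)"] mult_right_mono)
  finally show ?thesis by (simp add: sum_distrib_right)
qed

lemma linear_coefficients_bounded:
  fixes A :: "'e::euclidean_space \<Rightarrow> 'z::t2_space \<Rightarrow> 'e"
  assumes "\<And>b. b \<in> Basis \<Longrightarrow> continuous_on S (A b)" "compact S"
  obtains K where "\<And>z y. z \<in> S \<Longrightarrow> norm (\<Sum>b\<in>Basis. (y \<bullet> b) *\<^sub>R A b z) \<le> K * norm y"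
proof -
  have "continuous_on S (\<lambda>z. \<Sum>b\<in>Basis. norm (A b z))"
    by (intro continuous_intros assms)
  then have "bounded ((\<lambda>z. \<Sum>b\<in>Basis. norm (A b z)) ` S)"
    by (intro compact_imp_bounded compact_continuous_image[OF _ assms(2)])
  then obtain K where K: "\<And>z. z \<in> S \<Longrightarrow> norm (\<Sum>b\<in>Basis. norm (A b z)) \<le> K"
    unfolding bounded_iff by blast
  show ?thesis
  proof (rule that)
    fix z and y :: 'e assume "z \<in> S"
    have "norm (\<Sum>b\<in>Basis. (y \<bullet> b) *\<^sub>R A b z) \<le> (\<Sum>b\<in>Basis. norm (A b z)) * norm y"
      by (rule norm_linear_combination_le)
    also have "\<dots> \<le> K * norm y" using K[OF \<open>z \<in> S\<close>] by (intro mult_right_mono) auto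
    finally show "norm (\<Sum>b\<in>Basis. (y \<bullet> b) *\<^sub>R A b z) \<le> K * norm y" .
  qed
qed

text \<open>\<open>A b\<close> is the image of the basis vector \<open>b\<close> under the
  coefficient matrix, so the sum is that matrix applied to \<open>Y (t, p)\<close>; each column is
  an ordinary function to which \<open>Ck\<close> applies.\<close>

definition solves_linear_ode ::
  "('e::euclidean_space \<Rightarrow> real \<times> 'p \<Rightarrow> 'e) \<Rightarrow> (real \<times> 'p \<Rightarrow> 'e) \<Rightarrow> ('p \<Rightarrow> 'e) \<Rightarrow> (real \<times> 'p \<Rightarrow> 'e) \<Rightarrow> bool"
  where "solves_linear_ode A c y0 Y \<longleftrightarrow> (\<forall>p. Y (0, p) = y0 p) \<and> (\<forall>t p. ((\<lambda>t. Y (t, p)) has_vector_derivative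
       (\<Sum>b\<in>Basis. (Y (t, p) \<bullet> b) *\<^sub>R A b (t, p)) + c (t, p)) (at t))"

lemma solves_linear_odeD:
  assumes "solves_linear_ode A c y0 Y"
  shows "Y (0, p) = y0 p" and
    "((\<lambda>t. Y (t, p)) has_vector_derivative
       (\<Sum>b\<in>Basis. (Y (t, p) \<bullet> b) *\<^sub>R A b (t, p)) + c (t, p)) (at t)"
  using assms unfolding solves_linear_ode_def by blast+

lemma linear_ode_exists:
  fixes A :: "'e::euclidean_space \<Rightarrow> real \<times> 'p::euclidean_space \<Rightarrow> 'e"
  assumes A: "\<And>b. b \<in> Basis \<Longrightarrow> continuous_on UNIV (A b)"
    and c: "continuous_on UNIV c" and y0: "continuous_on UNIV y0"
  shows "\<exists>Y. continuous_on UNIV Y \<and> solves_linear_ode A c y0 Y"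
proof (rule ode_param_exists[where g = "\<lambda>z y. (\<Sum>b\<in>Basis. (y \<bullet> b) *\<^sub>R A b z) + c z" and ?y0.0 = y0])
  show "continuous_on UNIV (\<lambda>(z, y). (\<Sum>b\<in>Basis. (y \<bullet> b) *\<^sub>R A b z) + c z)"
    unfolding split_beta
    by (intro continuous_intros continuous_on_compose2[OF A] continuous_on_compose2[OF c]) auto
  show "continuous_on UNIV y0" by fact
  fix R :: real
  obtain K where K: "\<And>z y. z \<in> cball 0 R \<Longrightarrow> norm (\<Sum>b\<in>Basis. (y \<bullet> b) *\<^sub>R A b z) \<le> K * norm y"
    by (rule linear_coefficients_bounded[of "cball 0 R" A]) (auto intro: continuous_on_subset[OF A])
  have "norm ((\<Sum>b\<in>Basis. (y \<bullet> b) *\<^sub>R A b z) + c z - ((\<Sum>b\<in>Basis. (y' \<bullet> b) *\<^sub>R A b z) + c z)) \<le> K * norm (y - y')"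
    if "z \<in> cball 0 R" for z y y'
    using K[OF that, of "y - y'"] by (simp add: inner_diff_left scaleR_diff_left sum_subtractf)
  then show "\<exists>K. \<forall>z\<in>cball 0 R. \<forall>y y'. norm ((\<Sum>b\<in>Basis. (y \<bullet> b) *\<^sub>R A b z) + c z -
      ((\<Sum>b\<in>Basis. (y' \<bullet> b) *\<^sub>R A b z) + c z)) \<le> K * norm (y - y')"
    by blast
qed (auto simp: solves_linear_ode_def)

lemma linear_ode_zero_unique:
  fixes A :: "'e::euclidean_space \<Rightarrow> real \<Rightarrow> 'e"
  assumes A: "\<And>b. b \<in> Basis \<Longrightarrow> continuous_on UNIV (A b)"
    and w: "\<And>t. (w has_vector_derivative (\<Sum>b\<in>Basis. (w t \<bullet> b) *\<^sub>R A b t)) (at t)" and "w 0 = 0"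
  shows "w t = 0"
proof (rule ode_zero_unique[OF w \<open>w 0 = 0\<close>])
  fix T :: real
  obtain K where "\<And>s y. s \<in> {-T..T} \<Longrightarrow> norm (\<Sum>b\<in>Basis. (y \<bullet> b) *\<^sub>R A b s) \<le> K * norm y"
    by (rule linear_coefficients_bounded[of "{-T..T}" A]) (auto intro: continuous_on_subset[OF A])
  then show "\<exists>K. \<forall>s. \<bar>s\<bar> \<le> T \<longrightarrow> norm (\<Sum>b\<in>Basis. (w s \<bullet> b) *\<^sub>R A b s) \<le> K * norm (w s)"
    by (intro exI[of _ K]) (simp add: abs_le_iff)
qed

text \<open>In all uses \<open>Q\<close> is continuous for a reason of its own, as the solution of
  an equation or through a parameter integral, so no remainder has to be estimated.\<close>

lemma directional_derivative_of_quotient: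
  fixes F :: "real \<Rightarrow> 'b::real_normed_vector"
  assumes "\<And>e. F e - F 0 = e *\<^sub>R Q e" "continuous_on UNIV Q"
  shows "(F has_vector_derivative Q 0) (at 0)"
proof -
  have "isCont Q 0" using assms(2) by (simp add: continuous_on_eq_continuous_at)
  then have "Q \<midarrow>0\<rightarrow> Q 0" by (simp add: isCont_def)
  then have "((\<lambda>e. norm (Q e - Q 0)) \<longlongrightarrow> 0) (at 0)"
    by (intro tendsto_norm_zero LIM_zero)
  moreover have "norm (Q e - Q 0) = norm ((F e - F 0) - (e - 0) *\<^sub>R Q 0) / norm (e - 0)" if "e \<noteq> 0" for e
    using that by (simp add: assms(1) scaleR_diff_right[symmetric])
  then have "\<forall>\<^sub>F e in at 0. norm (Q e - Q 0) = norm ((F e - F 0) - (e - 0) *\<^sub>R Q 0) / norm (e - 0)"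
    by (auto simp: eventually_at intro: exI[of _ 1])
  ultimately have "((\<lambda>e. norm ((F e - F 0) - (e - 0) *\<^sub>R Q 0) / norm (e - 0)) \<longlongrightarrow> 0) (at 0)"
    by (rule Lim_transform_eventually)
  then show ?thesis
    unfolding has_vector_derivative_def has_derivative_iff_norm
    by (simp add: bounded_linear_scaleR_left)
qed

text \<open>A basis vector of the product points either in the time or in a space direction. For a
  solution of an equation \<open>Y'\<close> is the right-hand side, so only the space derivatives
  have to be found in order to gain one degree of regularity.\<close>

lemma Ck_time_spaceI:
  fixes Y :: "real \<times> 'p::euclidean_space \<Rightarrow> 'e::euclidean_space"
  assumes time: "\<And>t p. ((\<lambda>t. Y (t, p)) has_vector_derivative Y' (t, p)) (at t)" "Ck k Y'"
    and space: "\<And>e t x. ((\<lambda>s. Y (t, x + s *\<^sub>R e)) has_vector_derivative Z e (t, x)) (at 0)" "\<And>e. Ck k (Z e)"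
  shows "Ck (Suc k) Y"
proof (rule Ck_partialsI)
  fix b z :: "real \<times> 'p" assume b: "b \<in> Basis"
  obtain t x where z: "z = (t, x)" by (cases z)
  have 1: "((\<lambda>s. Y (t + s, x)) has_vector_derivative Y' (t, x)) (at 0)"
  proof -
    have "((\<lambda>t. Y (t, x)) has_vector_derivative Y' (t, x)) (at (t + 0))" using time by simp
    then have "((\<lambda>t. Y (t, x)) \<circ> (\<lambda>s. t + s) has_vector_derivative 1 *\<^sub>R Y' (t, x)) (at 0)"
      by (intro vector_diff_chain_at)
        (auto intro!: derivative_eq_intros simp: has_real_derivative_iff_has_vector_derivative[symmetric])
    then show ?thesis by (simp add: o_def)
  qed
  show "((\<lambda>s. Y (z + s *\<^sub>R b)) has_vector_derivative
      (if fst b = 0 then Z (snd b) z else Y' z)) (at 0)"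
  proof (cases "fst b = 0")
    case True
    then have "(\<lambda>s. Y (z + s *\<^sub>R b)) = (\<lambda>s. Y (t, x + s *\<^sub>R snd b))"
      by (simp add: z plus_prod_def scaleR_prod_def)
    then show ?thesis using space(1)[of t x "snd b"] True by (simp add: z)
  next
    case False
    then have "b = (1, 0)" using b by (auto simp: Basis_prod_def)
    then show ?thesis using 1 by (simp add: z)
  qed
next
  fix b :: "real \<times> 'p"
  show "Ck k (\<lambda>z. if fst b = 0 then Z (snd b) z else Y' z)"
    using time(2) space(2) by (cases "fst b = 0") simp_all
qed

text \<open>The difference quotient of a solution in a space direction solves a linear equation that
  depends continuously on the increment, down to increment \<open>0\<close>.\<close>

lemma linear_ode_Ck:
  fixes A :: "'e::euclidean_space \<Rightarrow> real \<times> 'p::euclidean_space \<Rightarrow> 'e"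
  assumes "\<And>b. b \<in> Basis \<Longrightarrow> Ck k (A b)" "Ck k c" "Ck k y0" "solves_linear_ode A c y0 Y"
  shows "Ck k Y"
  using assms
proof (induction k arbitrary: c y0 Y)
  case (0 c y0 Y)
  note A = Ck_imp_continuous[OF "0.prems"(1)]
  \<comment> \<open>A solution is assumed only to be differentiable in time. Its joint continuity
    follows because, by uniqueness, it coincides with the continuous solution built by
    iteration.\<close>
  have "\<exists>Z. continuous_on UNIV Z \<and> solves_linear_ode A c y0 Z"
    using "0.prems" by (intro linear_ode_exists) (auto intro: Ck_imp_continuous)
  then obtain Z where "continuous_on UNIV Z" "solves_linear_ode A c y0 Z" by blast
  note Z = this(1) solves_linear_odeD[OF this(2)]
  have "Y (t, p) - Z (t, p) = 0" for t p
  proof (rule linear_ode_zero_unique[where A = "\<lambda>b t. A b (t, p)"])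
    show "continuous_on UNIV (\<lambda>t. A b (t, p))" if "b \<in> Basis" for b
      by (intro continuous_on_compose2[OF A[OF that]] continuous_intros) auto
    show "((\<lambda>t. Y (t, p) - Z (t, p)) has_vector_derivative
        (\<Sum>b\<in>Basis. ((Y (t, p) - Z (t, p)) \<bullet> b) *\<^sub>R A b (t, p))) (at t)" for t
      using has_vector_derivative_diff[OF solves_linear_odeD(2)[OF "0.prems"(4), of p t] Z(3)[of p t]]
      by (simp add: inner_diff_left scaleR_diff_left sum_subtractf)
    show "Y (0, p) - Z (0, p) = 0" by (simp add: Z(2) solves_linear_odeD(1)[OF "0.prems"(4)])
  qed
  then have "Y = Z" by auto
  then show ?case using Z(1) by simp
next
  case (Suc k c y0 Y)
  note AS = Suc.prems(1) and cS = Suc.prems(2) and yS = Suc.prems(3)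
    and Y0 = solves_linear_odeD(1)[OF Suc.prems(4)] and Y' = solves_linear_odeD(2)[OF Suc.prems(4)]
  have Yk: "Ck k Y"
    using Suc.IH[OF Ck_SucD[OF AS] Ck_SucD[OF cS] Ck_SucD[OF yS] Suc.prems(4)] .
  have RHS: "Ck k (\<lambda>z. (\<Sum>b\<in>Basis. (Y z \<bullet> b) *\<^sub>R A b z) + c z)"
    using Ck_SucD[OF AS] by (intro Ck_add Ck_sum Ck_scaleR Ck_inner Yk Ck_const Ck_SucD[OF cS])
  have space: "\<exists>Z. Ck k Z \<and> (\<forall>t x. ((\<lambda>s. Y (t, x + s *\<^sub>R e)) has_vector_derivative Z (t, x)) (at 0))"
    for e :: 'p
  proof -
    \<comment> \<open>\<open>H F (t, x, r)\<close> is the difference quotient of \<open>F\<close> in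
      the space direction \<open>e\<close> with increment \<open>r\<close>, extended to
      \<open>r = 0\<close> by the derivative; \<open>H0\<close> is the same for the initial
      values.\<close>
    define H where "H F z = integral (cbox 0 1) (\<lambda>s. FD F ((fst z, fst (snd z)) + s *\<^sub>R (0, snd (snd z) *\<^sub>R e)) (0, e))"
      for F :: "real \<times> 'p \<Rightarrow> 'e" and z :: "real \<times> 'p \<times> real"
    define H0 where "H0 z = integral (cbox 0 1) (\<lambda>s. FD y0 (fst z + s *\<^sub>R snd z *\<^sub>R e) e)" for z :: "'p \<times> real"
    have contH: "continuous_on UNIV (H F)" if "Ck (Suc k) F" for F
      unfolding H_def
      by (intro integral_param_continuous, unfold split_beta)
        (intro continuous_on_compose2[OF Ck_imp_continuous[OF Ck_Suc_FD[OF that]]] continuous_intros subset_UNIV)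
    have contH0: "continuous_on UNIV H0"
      unfolding H0_def
      by (intro integral_param_continuous, unfold split_beta)
        (intro continuous_on_compose2[OF Ck_imp_continuous[OF Ck_Suc_FD[OF yS]]] continuous_intros subset_UNIV)
    have H: "F (t, x + r *\<^sub>R e) - F (t, x) = r *\<^sub>R H F (t, x, r)" if "Ck (Suc k) F" for F t x r
      using Hadamard[OF that, of "(t, x)" "(0, r *\<^sub>R e)"]
        linear_cmul[OF has_derivative_linear[OF Ck_Suc_has_derivative[OF that]], of _ r "(0, e)"]
      by (simp add: H_def)
    have H0: "y0 (x + r *\<^sub>R e) - y0 x = r *\<^sub>R H0 (x, r)" for x r
      using Hadamard[OF yS, of x "r *\<^sub>R e"]
        linear_cmul[OF has_derivative_linear[OF Ck_Suc_has_derivative[OF yS]], of _ r e]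
      by (simp add: H0_def)
    \<comment> \<open>The product rule for differences: the quotient of \<open>Y\<close> meets the
      coefficients at the shifted point, which are \<open>A'\<close>, while the unshifted
      \<open>Y\<close> meets the quotients of the coefficients, which enter the source term
      \<open>c'\<close>.\<close>
    define A' where "A' b z = A b (fst z, fst (snd z) + snd (snd z) *\<^sub>R e)" for b and z :: "real \<times> 'p \<times> real"
    define c' where "c' z = (\<Sum>b\<in>Basis. (Y (fst z, fst (snd z)) \<bullet> b) *\<^sub>R H (A b) z) + H c z" for z
    have A': "continuous_on UNIV (A' b)" if "b \<in> Basis" for b
      unfolding A'_def
      by (intro continuous_on_compose2[OF Ck_imp_continuous[OF AS[OF that]]] continuous_intros) auto
    have c': "continuous_on UNIV c'"
      unfolding c'_def
      by (intro continuous_intros continuous_on_compose2[OF Ck_imp_continuous[OF Yk]] contH AS cS) auto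
    have "\<exists>Q. continuous_on UNIV Q \<and> solves_linear_ode A' c' H0 Q"
      using A' c' contH0 by (rule linear_ode_exists)
    then obtain Q where "continuous_on UNIV Q" "solves_linear_ode A' c' H0 Q" by blast
    note Q = this(1) solves_linear_odeD[OF this(2)]
    have quot: "Y (t, x + r *\<^sub>R e) - Y (t, x) = r *\<^sub>R Q (t, x, r)" for t x r
    proof -
      define w where "w t = Y (t, x + r *\<^sub>R e) - Y (t, x) - r *\<^sub>R Q (t, x, r)" for t
      have "w t = 0"
      proof (rule linear_ode_zero_unique[where A = "\<lambda>b t. A' b (t, x, r)"])
        show "continuous_on UNIV (\<lambda>t. A' b (t, x, r))" if "b \<in> Basis" for b
          by (intro continuous_on_compose2[OF A'[OF that]] continuous_intros) auto
        show "w 0 = 0" by (simp add: w_def Y0 Q(2) H0)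
        show "(w has_vector_derivative (\<Sum>b\<in>Basis. (w t \<bullet> b) *\<^sub>R A' b (t, x, r))) (at t)" for t
        proof -
          have Adiff: "A b (t, x) = A' b (t, x, r) - r *\<^sub>R H (A b) (t, x, r)" if "b \<in> Basis" for b
            using H[OF AS[OF that], of t x r] by (simp add: A'_def algebra_simps)
          have cdiff: "c (t, x) = c (t, x + r *\<^sub>R e) - r *\<^sub>R H c (t, x, r)"
            using H[OF cS, of t x r] by (simp add: algebra_simps)
          have "(w has_vector_derivative
            ((\<Sum>b\<in>Basis. (Y (t, x + r *\<^sub>R e) \<bullet> b) *\<^sub>R A b (t, x + r *\<^sub>R e)) + c (t, x + r *\<^sub>R e))
             - ((\<Sum>b\<in>Basis. (Y (t, x) \<bullet> b) *\<^sub>R A b (t, x)) + c (t, x))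
             - r *\<^sub>R ((\<Sum>b\<in>Basis. (Q (t, x, r) \<bullet> b) *\<^sub>R A' b (t, x, r)) + c' (t, x, r))) (at t)"
            unfolding w_def
            by (intro has_vector_derivative_diff Y' Q(3)
                bounded_linear.has_vector_derivative[OF bounded_linear_scaleR_right])
          moreover have "(\<Sum>b\<in>Basis. (Y (t, x) \<bullet> b) *\<^sub>R A b (t, x))
             = (\<Sum>b\<in>Basis. (Y (t, x) \<bullet> b) *\<^sub>R A' b (t, x, r)) - r *\<^sub>R (\<Sum>b\<in>Basis. (Y (t, x) \<bullet> b) *\<^sub>R H (A b) (t, x, r))"
            by (simp add: Adiff scaleR_diff_right sum_subtractf scaleR_sum_right mult.commute)
          ultimately show ?thesis
            by (simp add: cdiff c'_def A'_def w_def inner_diff_left scaleR_diff_left sum_subtractf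
                scaleR_add_right scaleR_sum_right scaleR_diff_right)
        qed
      qed
      then show ?thesis by (simp add: w_def)
    qed
    define Z where "Z z = Q (fst z, snd z, 0)" for z
    have HF0: "H F (t, x, 0) = FD F (t, x) (0, e)" for F t x
      by (simp add: H_def zero_prod_def[symmetric])
    \<comment> \<open>At increment \<open>0\<close> the quotient solves an equation with the same
      coefficients and with source and initial values of class \<open>Ck k\<close>; the induction
      hypothesis applies since source, initial values and solution are arbitrary in it.\<close>
    have "Ck k Z"
    proof (rule Suc.IH)
      show "Ck k (A b)" if "b \<in> Basis" for b using Ck_SucD[OF AS[OF that]] .
      show "Ck k (\<lambda>z. (\<Sum>b\<in>Basis. (Y z \<bullet> b) *\<^sub>R FD (A b) z (0, e)) + FD c z (0, e))"
        using AS cS by (intro Ck_add Ck_sum Ck_scaleR Ck_inner Yk Ck_const Ck_Suc_FD)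
      show "Ck k (\<lambda>x. FD y0 x e)" by (rule Ck_Suc_FD[OF yS])
      have "Z (0, p) = FD y0 p e" for p by (simp add: Z_def Q(2) H0_def)
      moreover have "((\<lambda>t. Z (t, p)) has_vector_derivative (\<Sum>b\<in>Basis. (Z (t, p) \<bullet> b) *\<^sub>R A b (t, p)) +
          ((\<Sum>b\<in>Basis. (Y (t, p) \<bullet> b) *\<^sub>R FD (A b) (t, p) (0, e)) + FD c (t, p) (0, e))) (at t)" for t p
        using Q(3)[of "(p, 0)" t] by (simp add: Z_def A'_def c'_def HF0)
      ultimately show "solves_linear_ode A
          (\<lambda>z. (\<Sum>b\<in>Basis. (Y z \<bullet> b) *\<^sub>R FD (A b) z (0, e)) + FD c z (0, e)) (\<lambda>x. FD y0 x e) Z"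
        by (simp add: solves_linear_ode_def)
    qed
    moreover have "((\<lambda>s. Y (t, x + s *\<^sub>R e)) has_vector_derivative Z (t, x)) (at 0)" for t x
    proof -
      have "continuous_on UNIV (\<lambda>s. Q (t, x, s))"
        by (intro continuous_on_compose2[OF Q(1)] continuous_intros) auto
      then show ?thesis
        using directional_derivative_of_quotient[of "\<lambda>s. Y (t, x + s *\<^sub>R e)" "\<lambda>s. Q (t, x, s)"] quot
        by (simp add: Z_def)
    qed
    ultimately show ?thesis by blast
  qed
  then obtain Z where Z: "\<And>e. Ck k (Z e)"
    "\<And>e t x. ((\<lambda>s. Y (t, x + s *\<^sub>R e)) has_vector_derivative Z e (t, x)) (at 0)"
    by metis
  show ?case
    by (rule Ck_time_spaceI[OF Y' RHS Z(2) Z(1)])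
qed

section \<open>Flows of autonomous equations\<close>

definition flow_of :: "('e::euclidean_space \<Rightarrow> 'e) \<Rightarrow> (real \<times> 'e \<Rightarrow> 'e) \<Rightarrow> bool" where
  "flow_of f \<Phi> \<longleftrightarrow> (\<forall>x. \<Phi> (0, x) = x) \<and>
     (\<forall>t x. ((\<lambda>t. \<Phi> (t, x)) has_vector_derivative f (\<Phi> (t, x))) (at t))"

lemma flow_ofD:
  assumes "flow_of f \<Phi>"
  shows "\<Phi> (0, x) = x" "((\<lambda>t. \<Phi> (t, x)) has_vector_derivative f (\<Phi> (t, x))) (at t)"
  using assms by (auto simp: flow_of_def)

lemma autonomous_unique:
  fixes f :: "'e::euclidean_space \<Rightarrow> 'e"
  assumes lip: "\<And>x y. norm (f x - f y) \<le> K * norm (x - y)"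
    and "\<And>t. (y has_vector_derivative f (y t)) (at t)" "\<And>t. (z has_vector_derivative f (z t)) (at t)"
    and "y 0 = z 0"
  shows "y t = z t"
proof -
  have "y t - z t = 0"
    by (rule ode_zero_unique[where w' = "\<lambda>t. f (y t) - f (z t)"])
      (use assms in \<open>auto intro: has_vector_derivative_diff\<close>)
  then show ?thesis by simp
qed

lemma flow_exists:
  fixes f :: "'e::euclidean_space \<Rightarrow> 'e"
  assumes lip: "\<And>x y. norm (f x - f y) \<le> K * norm (x - y)" and f: "continuous_on UNIV f"
  shows "\<exists>\<Phi>. continuous_on UNIV \<Phi> \<and> flow_of f \<Phi>"
proof (rule ode_param_exists[where g = "\<lambda>z. f" and ?y0.0 = "\<lambda>x. x"])
  show "continuous_on UNIV (\<lambda>(z :: real \<times> 'e, y). f y)"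
    unfolding split_beta by (intro continuous_on_compose2[OF f] continuous_intros) auto
  show "\<exists>K. \<forall>z\<in>cball (0 :: real \<times> 'e) R. \<forall>y y'. norm (f y - f y') \<le> K * norm (y - y')" for R
    using lip by blast
qed (auto simp: flow_of_def intro: continuous_intros)

lemma flow_shift:
  assumes "flow_of f \<Phi>"
  shows "((\<lambda>s. \<Phi> (s + r, x)) has_vector_derivative f (\<Phi> (s + r, x))) (at s)"
proof -
  have "((\<lambda>t. \<Phi> (t, x)) \<circ> (\<lambda>s. s + r) has_vector_derivative 1 *\<^sub>R f (\<Phi> (s + r, x))) (at s)"
    by (intro vector_diff_chain_at flow_ofD(2)[OF assms])
      (auto intro!: derivative_eq_intros simp: has_real_derivative_iff_has_vector_derivative[symmetric])
  then show ?thesis by (simp add: o_def)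
qed

lemma flow_add:
  fixes f :: "'e::euclidean_space \<Rightarrow> 'e"
  assumes lip: "\<And>x y. norm (f x - f y) \<le> K * norm (x - y)" and \<Phi>: "flow_of f \<Phi>"
  shows "\<Phi> (t + r, x) = \<Phi> (t, \<Phi> (r, x))"
  by (rule autonomous_unique[OF lip flow_shift[OF \<Phi>] flow_ofD(2)[OF \<Phi>]])
    (simp add: flow_ofD(1)[OF \<Phi>])

text \<open>The space derivative of a flow solves the linearised equation, whose coefficients
  \<open>FD f (\<Phi> z) b\<close> are as regular as \<open>\<Phi>\<close> itself. Hence
  \<open>linear_ode_Ck\<close> makes it \<open>Ck k\<close> once \<open>\<Phi>\<close> is, and the
  time derivative is \<open>f\<close> applied to \<open>\<Phi>\<close>; together they gain one
  degree.\<close>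

lemma flow_Ck:
  fixes f :: "'e::euclidean_space \<Rightarrow> 'e"
  assumes lip: "\<And>x y. norm (f x - f y) \<le> K * norm (x - y)" and f: "smooth f" and \<Phi>: "flow_of f \<Phi>"
  shows "Ck k \<Phi>"
proof (induction k)
  case 0
  have "continuous_on UNIV f" using f by (auto simp: smooth_def intro: Ck_imp_continuous)
  then obtain \<Psi> where "continuous_on UNIV \<Psi>" and \<Psi>: "flow_of f \<Psi>"
    using flow_exists[OF lip] by blast
  have "\<Phi> (t, x) = \<Psi> (t, x)" for t x
    by (rule autonomous_unique[OF lip flow_ofD(2)[OF \<Phi>] flow_ofD(2)[OF \<Psi>]])
      (simp add: flow_ofD(1)[OF \<Phi>] flow_ofD(1)[OF \<Psi>])
  then have "\<Phi> = \<Psi>" by auto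
  with \<open>continuous_on UNIV \<Psi>\<close> show ?case by simp
next
  case (Suc k)
  have fk: "Ck j f" for j using f by (simp add: smooth_def)
  note cont = Ck_imp_continuous[OF Suc]
  have lin: "FD f y h = (\<Sum>b\<in>Basis. (h \<bullet> b) *\<^sub>R FD f y b)" for y h
    by (intro linear_euclidean_expand has_derivative_linear[OF Ck_Suc_has_derivative[OF fk]])
  have space: "\<exists>Z. Ck k Z \<and> (\<forall>t x. ((\<lambda>s. \<Phi> (t, x + s *\<^sub>R e)) has_vector_derivative Z (t, x)) (at 0))"
    for e :: 'e
  proof -
    define D where "D z = \<Phi> (fst z, fst (snd z) + snd (snd z) *\<^sub>R e) - \<Phi> (fst z, fst (snd z))"
      for z :: "real \<times> 'e \<times> real"
    \<comment> \<open>Averaging \<open>FD f\<close> over the segment between two trajectories makes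
      the equation for their difference exactly linear; at increment \<open>0\<close> the average is
      \<open>FD f\<close> along the trajectory.\<close>
    define A where "A b z = integral (cbox 0 1) (\<lambda>s. FD f (\<Phi> (fst z, fst (snd z)) + s *\<^sub>R D z) b)"
      for b and z :: "real \<times> 'e \<times> real"
    have contD: "continuous_on UNIV D"
      unfolding D_def by (intro continuous_intros continuous_on_compose2[OF cont]) auto
    have A: "continuous_on UNIV (A b)" for b
      unfolding A_def
      by (intro integral_param_continuous, unfold split_beta)
        (intro continuous_on_compose2[OF Ck_imp_continuous[OF Ck_Suc_FD[OF fk]]] continuous_intros
          continuous_on_compose2[OF cont] continuous_on_compose2[OF contD] subset_UNIV)
    have "\<exists>Q. continuous_on UNIV Q \<and> solves_linear_ode A (\<lambda>_. 0) (\<lambda>_. e) Q"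
      using A by (intro linear_ode_exists continuous_intros)
    then obtain Q where "continuous_on UNIV Q" "solves_linear_ode A (\<lambda>_. 0) (\<lambda>_. e) Q" by blast
    note Q = this(1) solves_linear_odeD[OF this(2)]
    have quot: "\<Phi> (t, x + r *\<^sub>R e) - \<Phi> (t, x) = r *\<^sub>R Q (t, x, r)" for t x r
    proof -
      define w where "w t = D (t, x, r) - r *\<^sub>R Q (t, x, r)" for t
      have "w t = 0"
      proof (rule linear_ode_zero_unique[where A = "\<lambda>b t. A b (t, x, r)"])
        show "continuous_on UNIV (\<lambda>t. A b (t, x, r))" for b
          by (intro continuous_on_compose2[OF A] continuous_intros) auto
        show "w 0 = 0" by (simp add: w_def D_def Q(2) flow_ofD(1)[OF \<Phi>])
        show "(w has_vector_derivative (\<Sum>b\<in>Basis. (w t \<bullet> b) *\<^sub>R A b (t, x, r))) (at t)" for t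
        proof -
          have "f (\<Phi> (t, x + r *\<^sub>R e)) - f (\<Phi> (t, x))
              = integral (cbox 0 1) (\<lambda>s. FD f (\<Phi> (t, x) + s *\<^sub>R D (t, x, r)) (D (t, x, r)))"
            using Hadamard[OF fk, of "\<Phi> (t, x)" "D (t, x, r)"] by (simp add: D_def)
          also have "\<dots> = integral (cbox 0 1) (\<lambda>s. \<Sum>b\<in>Basis. (D (t, x, r) \<bullet> b) *\<^sub>R
              FD f (\<Phi> (t, x) + s *\<^sub>R D (t, x, r)) b)"
            by (subst lin) (rule refl)
          also have "\<dots> = (\<Sum>b\<in>Basis. integral (cbox 0 1) (\<lambda>s. (D (t, x, r) \<bullet> b) *\<^sub>R
              FD f (\<Phi> (t, x) + s *\<^sub>R D (t, x, r)) b))"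
            by (intro integral_sum integrable_continuous continuous_intros
                continuous_on_compose2[OF Ck_imp_continuous[OF Ck_Suc_FD[OF fk]]]) auto
          also have "\<dots> = (\<Sum>b\<in>Basis. (D (t, x, r) \<bullet> b) *\<^sub>R A b (t, x, r))"
            unfolding A_def by (simp only: integral_cmul fst_conv snd_conv)
          finally have fdiff: "f (\<Phi> (t, x + r *\<^sub>R e)) - f (\<Phi> (t, x)) = \<dots>" .
          have "(w has_vector_derivative f (\<Phi> (t, x + r *\<^sub>R e)) - f (\<Phi> (t, x))
             - r *\<^sub>R ((\<Sum>b\<in>Basis. (Q (t, x, r) \<bullet> b) *\<^sub>R A b (t, x, r)) + 0)) (at t)"
            unfolding w_def D_def fst_conv snd_conv
            by (intro has_vector_derivative_diff flow_ofD(2)[OF \<Phi>] Q(3)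
                bounded_linear.has_vector_derivative[OF bounded_linear_scaleR_right])
          then show ?thesis
            unfolding fdiff
            by (simp add: w_def inner_diff_left scaleR_diff_left sum_subtractf scaleR_sum_right)
        qed
      qed
      then show ?thesis by (simp add: w_def D_def)
    qed
    define Z where "Z z = Q (fst z, snd z, 0)" for z
    have "Ck k Z"
    proof (rule linear_ode_Ck[where A = "\<lambda>b z. FD f (\<Phi> z) b" and c = "\<lambda>_. 0" and ?y0.0 = "\<lambda>_. e"])
      show "Ck k (\<lambda>z. FD f (\<Phi> z) b)" for b
        by (rule Ck_compose[OF Ck_Suc_FD[OF fk] Suc])
      show "Ck k (\<lambda>_. e)" "Ck k (\<lambda>_. 0)" by (rule Ck_const)+
      have "Z (0, p) = e" for p by (simp add: Z_def Q(2))
      moreover have "((\<lambda>t. Z (t, p)) has_vector_derivative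
          (\<Sum>b\<in>Basis. (Z (t, p) \<bullet> b) *\<^sub>R FD f (\<Phi> (t, p)) b) + 0) (at t)" for t p
        using Q(3)[of "(p, 0)" t] by (simp add: Z_def A_def D_def)
      ultimately show "solves_linear_ode (\<lambda>b z. FD f (\<Phi> z) b) (\<lambda>_. 0) (\<lambda>_. e) Z"
        by (simp add: solves_linear_ode_def)
    qed
    moreover have "((\<lambda>s. \<Phi> (t, x + s *\<^sub>R e)) has_vector_derivative Z (t, x)) (at 0)" for t x
    proof -
      have "continuous_on UNIV (\<lambda>s. Q (t, x, s))"
        by (intro continuous_on_compose2[OF Q(1)] continuous_intros) auto
      then show ?thesis
        using directional_derivative_of_quotient[of "\<lambda>s. \<Phi> (t, x + s *\<^sub>R e)" "\<lambda>s. Q (t, x, s)"] quot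
        by (simp add: Z_def)
    qed
    ultimately show ?thesis by blast
  qed
  then obtain Z where Z: "\<And>e. Ck k (Z e)"
    "\<And>e t x. ((\<lambda>s. \<Phi> (t, x + s *\<^sub>R e)) has_vector_derivative Z e (t, x)) (at 0)"
    by metis
  show ?case
    by (rule Ck_time_spaceI[OF flow_ofD(2)[OF \<Phi>] Ck_compose[OF fk Suc] Z(2) Z(1)])
qed

section \<open>Smooth functions on the torus\<close>

lemma smooth_Ck: "smooth f \<Longrightarrow> Ck k f"
  by (simp add: smooth_def)

lemma smooth_imp_continuous: "smooth f \<Longrightarrow> continuous_on UNIV f"
  by (rule Ck_imp_continuous[of 0]) (rule smooth_Ck)

lemma smooth_has_derivative: "smooth f \<Longrightarrow> (f has_derivative FD f x) (at x)"
  by (rule Ck_Suc_has_derivative[of 0]) (rule smooth_Ck)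

lemma smooth_linear_FD: "smooth f \<Longrightarrow> linear (FD f x)"
  by (rule has_derivative_linear[OF smooth_has_derivative])

lemma FD_eqI: "(f has_derivative f') (at x) \<Longrightarrow> FD f x h = f' h"
  using frechet_derivative_at by metis

lemma smooth_const: "smooth (\<lambda>x. c)"
  by (simp add: smooth_def Ck_const)

lemma smooth_bounded_linear: "bounded_linear L \<Longrightarrow> smooth f \<Longrightarrow> smooth (\<lambda>x. L (f x))"
  by (simp add: smooth_def Ck_bounded_linear)

lemma smooth_linear: "bounded_linear L \<Longrightarrow> smooth L"
  by (simp add: smooth_def Ck_linear)

lemma smooth_add: "smooth f \<Longrightarrow> smooth g \<Longrightarrow> smooth (\<lambda>x. f x + g x)"
  by (simp add: smooth_def Ck_add)

lemma smooth_diff: "smooth f \<Longrightarrow> smooth g \<Longrightarrow> smooth (\<lambda>x. f x - g x)"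
  by (simp add: smooth_def Ck_diff)

lemma smooth_sum: "(\<And>i. i \<in> I \<Longrightarrow> smooth (f i)) \<Longrightarrow> smooth (\<lambda>x. \<Sum>i\<in>I. f i x)"
  by (simp add: smooth_def Ck_sum)

lemma smooth_scaleR: "smooth f \<Longrightarrow> smooth g \<Longrightarrow> smooth (\<lambda>x. f x *\<^sub>R g x)"
  by (simp add: smooth_def Ck_scaleR)

lemma smooth_inner: "smooth f \<Longrightarrow> smooth g \<Longrightarrow> smooth (\<lambda>x. f x \<bullet> g x)"
  by (simp add: smooth_def Ck_inner)

lemma smooth_mult: "smooth f \<Longrightarrow> smooth g \<Longrightarrow> smooth (\<lambda>x. f x * g x :: real)"
  by (simp add: smooth_def Ck_mult)

lemma smooth_inverse: "smooth f \<Longrightarrow> (\<And>x. f x \<noteq> 0) \<Longrightarrow> smooth (\<lambda>x. inverse (f x) :: real)"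
  by (simp add: smooth_def Ck_inverse)

lemma smooth_Pair: "smooth f \<Longrightarrow> smooth g \<Longrightarrow> smooth (\<lambda>x. (f x, g x))"
  by (simp add: smooth_def Ck_Pair)

lemma smooth_compose: "smooth f \<Longrightarrow> smooth g \<Longrightarrow> smooth (\<lambda>x. f (g x))"
  by (simp add: smooth_def Ck_compose)

lemma smooth_id: "smooth (\<lambda>x. x)"
  by (rule smooth_linear) (rule bounded_linear_ident)

lemma smooth_fst: "smooth f \<Longrightarrow> smooth (\<lambda>x. fst (f x))"
  by (rule smooth_bounded_linear[OF bounded_linear_fst])

lemma smooth_snd: "smooth f \<Longrightarrow> smooth (\<lambda>x. snd (f x))"
  by (rule smooth_bounded_linear[OF bounded_linear_snd])

lemma smooth_nth: "smooth f \<Longrightarrow> smooth (\<lambda>x. f x $ i)"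
  for f :: "'a::euclidean_space \<Rightarrow> real^'d::finite"
  by (rule smooth_bounded_linear[OF bounded_linear_vec_nth])

lemma vec_lambda_sum_axis: "(\<chi> i. f i) = (\<Sum>i\<in>UNIV. f i *\<^sub>R axis i (1::real))"
  by (simp add: vec_eq_iff axis_def if_distrib cong: if_cong)

lemma smooth_vec_lambda:
  "(\<And>i. smooth (f i)) \<Longrightarrow> smooth (\<lambda>x. (\<chi> i. f i x) :: real^'d::finite)"
  unfolding vec_lambda_sum_axis by (intro smooth_sum smooth_scaleR smooth_const)

lemma smooth_FD: "smooth f \<Longrightarrow> smooth (\<lambda>x. FD f x h)"
  by (simp add: smooth_def Ck_Suc_FD del: Ck.simps)

lemma smooth_FD_app:
  assumes "smooth f" "smooth g" "smooth h"
  shows "smooth (\<lambda>x. FD f (g x) (h x))"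
proof -
  have "(\<lambda>x. FD f (g x) (h x)) = (\<lambda>x. \<Sum>b\<in>Basis. (h x \<bullet> b) *\<^sub>R FD f (g x) b)"
    by (intro ext linear_euclidean_expand smooth_linear_FD assms)
  then show ?thesis
    by (simp only:) (intro smooth_sum smooth_scaleR smooth_inner smooth_const assms
        smooth_compose[OF smooth_FD[OF assms(1)]])
qed

section \<open>Functions on the torus and their differential operators through lifts\<close>

lemma to_torus_rep [simp]: "to_torus (rep_torus p) = p"
  by (rule Quotient3_abs_rep[OF Quotient3_torus])

lemma to_torus_eq_iff: "to_torus x = to_torus y \<longleftrightarrow> lattice_equiv x y"
  by (rule torus.abs_eq_iff)

lemma torus_cases [cases type: torus]: obtains x where "p = to_torus x"
  by (metis to_torus_rep)

lemma smooth_funD: "smooth_fun f \<Longrightarrow> smooth (\<lambda>x. f (to_torus x))"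
  by (simp add: smooth_fun_def)

lemma smooth_fun_const: "smooth_fun (\<lambda>p. c)"
  by (simp add: smooth_fun_def smooth_const)

lemma smooth_fun_add: "smooth_fun f \<Longrightarrow> smooth_fun g \<Longrightarrow> smooth_fun (\<lambda>x. f x + g x)"
  by (simp add: smooth_fun_def smooth_add)

lemma smooth_fun_diff: "smooth_fun f \<Longrightarrow> smooth_fun g \<Longrightarrow> smooth_fun (\<lambda>x. f x - g x)"
  by (simp add: smooth_fun_def smooth_diff)

lemma smooth_fun_scaleR: "smooth_fun f \<Longrightarrow> smooth_fun g \<Longrightarrow> smooth_fun (\<lambda>x. f x *\<^sub>R g x)"
  by (simp add: smooth_fun_def smooth_scaleR)

lemma smooth_fun_inner: "smooth_fun f \<Longrightarrow> smooth_fun g \<Longrightarrow> smooth_fun (\<lambda>x. f x \<bullet> g x)"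
  by (simp add: smooth_fun_def smooth_inner)

lemma smooth_fun_mult: "smooth_fun f \<Longrightarrow> smooth_fun g \<Longrightarrow> smooth_fun (\<lambda>x. f x * g x :: real)"
  by (simp add: smooth_fun_def smooth_mult)

lemma smooth_fun_inverse: "smooth_fun f \<Longrightarrow> (\<And>x. f x \<noteq> 0) \<Longrightarrow> smooth_fun (\<lambda>x. inverse (f x) :: real)"
  by (simp add: smooth_fun_def smooth_inverse)

lemma smooth_fun_compose_map:
  assumes "smooth_fun f" "smooth_map X"
  shows "smooth_fun (\<lambda>p. f (X p))"
proof -
  from assms(2) obtain L where "smooth L" "\<And>x. X (to_torus x) = to_torus (L x)"
    by (auto simp: smooth_map_def)
  then show ?thesis
    using smooth_compose[OF smooth_funD[OF assms(1)]] by (simp add: smooth_fun_def)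
qed

text \<open>The bridge from \<open>D_at\<close>, which is defined by translations of the torus, to
  calculus on the lift; the rules for \<open>D_at\<close> are transferred along it.\<close>

lemma D_at_to_torus:
  assumes "smooth_fun f"
  shows "D_at f (to_torus x) h = FD (\<lambda>x. f (to_torus x)) x h"
proof -
  have "((\<lambda>y. f (to_torus y)) has_derivative FD (\<lambda>x. f (to_torus x)) x) (at (x + 0))"
    using smooth_has_derivative[OF smooth_funD[OF assms]] by simp
  then have "((\<lambda>h. f (to_torus (x + h))) has_derivative FD (\<lambda>x. f (to_torus x)) x) (at 0)"
    by (intro has_derivative_compose[of "\<lambda>h. x + h" "\<lambda>h. h" 0 UNIV "\<lambda>y. f (to_torus y)"])
      (auto intro!: derivative_eq_intros)
  then show ?thesis
    unfolding D_at_def translate_to_torus by (rule FD_eqI)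
qed

lemma smooth_fun_D_at: "smooth_fun f \<Longrightarrow> smooth_fun (\<lambda>p. D_at f p h)"
  by (simp add: smooth_fun_def D_at_to_torus smooth_FD)

lemma smooth_fun_D_at_app: "smooth_fun f \<Longrightarrow> smooth_fun u \<Longrightarrow> smooth_fun (\<lambda>p. D_at f p (u p))"
  by (simp add: smooth_fun_def D_at_to_torus smooth_FD_app smooth_id)

lemma smooth_fun_nth: "smooth_fun f \<Longrightarrow> smooth_fun (\<lambda>x. f x $ i)"
  for f :: "'d::finite torus \<Rightarrow> real^'n::finite"
  unfolding smooth_fun_def by (rule smooth_nth)

lemma smooth_fun_grad: "smooth_fun f \<Longrightarrow> smooth_fun (grad f)"
  unfolding grad_def[abs_def] using smooth_fun_D_at[of f]
  by (simp add: smooth_fun_def smooth_vec_lambda)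

lemma smooth_fun_dvg: "smooth_fun f \<Longrightarrow> smooth_fun (dvg f)"
  unfolding dvg_def[abs_def] using smooth_fun_nth[OF smooth_fun_D_at[of f]]
  by (simp add: smooth_fun_def smooth_sum)

lemma smooth_fun_advect: "smooth_fun u \<Longrightarrow> smooth_fun v \<Longrightarrow> smooth_fun (advect u v)"
  unfolding advect_def[abs_def] by (rule smooth_fun_D_at_app)

lemma D_at_linear: "smooth_fun f \<Longrightarrow> linear (D_at f p)"
  by (cases p) (metis D_at_to_torus ext smooth_linear_FD smooth_funD)

lemma D_at_has_derivative:
  "smooth_fun f \<Longrightarrow> ((\<lambda>y. f (to_torus y)) has_derivative D_at f (to_torus x)) (at x)"
  using smooth_has_derivative[OF smooth_funD] by (metis D_at_to_torus ext)

lemma D_at_eqI: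
  assumes "smooth_fun f" "((\<lambda>y. f (to_torus y)) has_derivative f') (at x)"
  shows "D_at f (to_torus x) h = f' h"
  using assms by (simp add: D_at_to_torus FD_eqI)

lemma D_at_bilinear:
  assumes pr: "bounded_bilinear pr" and "smooth_fun f" "smooth_fun g"
  shows "D_at (\<lambda>p. pr (f p) (g p)) p h = pr (f p) (D_at g p h) + pr (D_at f p h) (g p)"
proof (cases p)
  case (1 x)
  have "smooth_fun (\<lambda>p. pr (f p) (g p))"
    using assms unfolding smooth_fun_def smooth_def by (intro allI Ck_bilinear[OF pr]) simp_all
  then show ?thesis unfolding 1
    by (rule D_at_eqI) (intro bounded_bilinear.FDERIV[OF pr] D_at_has_derivative assms)
qed

lemma D_at_bounded_linear:
  assumes L: "bounded_linear L" and "smooth_fun f"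
  shows "D_at (\<lambda>p. L (f p)) p h = L (D_at f p h)"
proof (cases p)
  case (1 x)
  have "smooth_fun (\<lambda>p. L (f p))"
    using assms unfolding smooth_fun_def by (rule smooth_bounded_linear)
  then show ?thesis unfolding 1
    by (rule D_at_eqI) (rule bounded_linear.has_derivative[OF L D_at_has_derivative[OF assms(2)]])
qed

lemma D_at_diff:
  assumes "smooth_fun f" "smooth_fun g"
  shows "D_at (\<lambda>p. f p - g p) p h = D_at f p h - D_at g p h"
proof (cases p)
  case (1 x)
  show ?thesis unfolding 1
    by (rule D_at_eqI[OF smooth_fun_diff]) (intro assms has_derivative_diff D_at_has_derivative)+
qed

lemma D_at_const: "D_at (\<lambda>p. c) p h = 0"
  by (cases p) (auto intro!: D_at_eqI[of "\<lambda>p. c", OF smooth_fun_const])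

lemma D_at_eq_grad:
  assumes "smooth_fun f"
  shows "D_at f p h = h \<bullet> grad f p"
proof -
  have "D_at f p h = (\<Sum>b\<in>Basis. (h \<bullet> b) *\<^sub>R D_at f p b)"
    by (rule linear_euclidean_expand[OF D_at_linear[OF assms]])
  also have "\<dots> = (\<Sum>i\<in>UNIV. h $ i * D_at f p (axis i 1))"
    by (simp add: Basis_vec_def UNION_singleton_eq_range sum.reindex inj_on_def axis_eq_axis inner_axis)
  finally show ?thesis by (simp add: grad_def inner_vec_def)
qed

lemma dvg_diff: "smooth_fun f \<Longrightarrow> smooth_fun g \<Longrightarrow> dvg (\<lambda>p. f p - g p) p = dvg f p - dvg g p"
  by (simp add: dvg_def D_at_diff sum_subtractf)

lemma grad_diff: "smooth_fun f \<Longrightarrow> smooth_fun g \<Longrightarrow> grad (\<lambda>p. f p - g p) p = grad f p - grad g p"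
  by (simp add: grad_def D_at_diff vec_eq_iff)

lemma grad_const: "grad (\<lambda>p. c) p = 0"
  by (simp add: grad_def D_at_const vec_eq_iff)

lemma dvg_scaleR:
  assumes "smooth_fun f" "smooth_fun g"
  shows "dvg (\<lambda>p. f p *\<^sub>R g p) p = f p * dvg g p + g p \<bullet> grad f p"
  using assms
  by (simp add: dvg_def D_at_bilinear[OF bounded_bilinear_scaleR] sum.distrib sum_distrib_left
      grad_def inner_vec_def mult.commute)

lemma dvg_nth:
  assumes "smooth_fun w"
  shows "dvg w p = (\<Sum>i\<in>UNIV. D_at (\<lambda>p. w p $ i) p (axis i 1))"
  by (simp add: dvg_def D_at_bounded_linear[OF bounded_linear_vec_nth assms])

section \<open>Integration on the torus\<close>

abbreviation cube :: "(real^'d::finite) set" where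
  "cube \<equiv> cbox 0 (\<chi> i. 1)"

lemma sets_vol: "sets (vol :: 'd::finite torus measure) = {A. to_torus -` A \<in> sets borel}"
proof -
  have "sigma_algebra UNIV {A. to_torus -` A \<in> sets (borel :: (real^'d) measure)}"
    unfolding sigma_algebra_iff2
    by (auto simp: vimage_Diff vimage_UN Compl_eq_Diff_UNIV[symmetric] vimage_Compl simp del: vimage_Compl[symmetric])
  from sigma_algebra.sigma_sets_eq[OF this] show ?thesis
    by (simp add: vol_def sets_measure_of_conv)
qed

lemma space_vol [simp]: "space vol = UNIV"
  by (simp add: vol_def space_measure_of_conv)

lemma measurable_to_torus: "to_torus \<in> borel \<rightarrow>\<^sub>M (vol :: 'd::finite torus measure)"
  by (rule measurableI) (auto simp: sets_vol)

lemma borel_measurable_vol: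
  "f \<in> borel_measurable (vol :: 'd::finite torus measure) \<longleftrightarrow> (\<lambda>x. f (to_torus x)) \<in> borel_measurable borel"
proof
  assume "f \<in> borel_measurable (vol :: 'd torus measure)"
  then show "(\<lambda>x. f (to_torus x)) \<in> borel_measurable borel"
    by (rule measurable_compose[OF measurable_to_torus])
next
  assume *: "(\<lambda>x. f (to_torus x)) \<in> borel_measurable borel"
  show "f \<in> borel_measurable vol"
  proof (rule measurableI)
    fix A :: "'a set" assume "A \<in> sets borel"
    from measurable_sets[OF * this] show "f -` A \<inter> space vol \<in> sets vol"
      by (simp add: sets_vol vimage_def)
  qed simp
qed

text \<open>A push-forward depends on its target only through the measurable sets, so
  \<open>vol\<close> itself may serve as the target. In this form the measurability of
  \<open>to_torus\<close> into \<open>vol\<close> can be used directly.\<close>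

lemma vol_eq_distr: "vol = distr (restrict_space lborel cube) (vol :: 'd::finite torus measure) to_torus"
proof -
  have "sets (sigma UNIV {A. to_torus -` A \<in> sets (borel :: (real^'d) measure)}) = sets vol"
    by (simp add: vol_def)
  from distr_cong[OF refl this refl] show ?thesis by (simp add: vol_def)
qed

lemma measurable_to_torus_cube: "to_torus \<in> restrict_space lborel cube \<rightarrow>\<^sub>M (vol :: 'd::finite torus measure)"
  using measurable_restrict_space1[of to_torus lborel vol cube] measurable_to_torus by simp

lemma emeasure_vol:
  assumes "A \<in> sets (vol :: 'd::finite torus measure)"
  shows "emeasure vol A = emeasure lborel (to_torus -` A \<inter> cube)"
proof -
  have A: "to_torus -` A \<in> sets borel" using assms by (simp add: sets_vol)
  have "emeasure vol A = emeasure (restrict_space lborel cube) (to_torus -` A \<inter> space (restrict_space lborel cube))"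
    by (subst vol_eq_distr, rule emeasure_distr) (use assms measurable_to_torus_cube in auto)
  also have "\<dots> = emeasure lborel (to_torus -` A \<inter> cube)"
    using A by (subst emeasure_restrict_space) (auto simp: space_restrict_space)
  finally show ?thesis .
qed

lemma finite_measure_vol: "finite_measure (vol :: 'd::finite torus measure)"
proof
  have "emeasure lborel (cube :: (real^'d) set) \<noteq> \<infinity>"
    using emeasure_lborel_cbox_finite[of 0 "(\<chi> i. 1) :: real^'d"] by auto
  then show "emeasure (vol :: 'd torus measure) (space vol) \<noteq> \<infinity>"
    by (subst emeasure_vol) (auto simp: sets_vol)
qed

lemma cube_representative: "\<exists>x\<in>cube. p = to_torus x"
proof -
  obtain y where y: "p = to_torus y" by (cases p)
  define x :: "real^'a" where "x = (\<chi> i. frac (y $ i))"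
  have "lattice_equiv y x" by (auto simp: lattice_equiv_def x_def frac_def)
  moreover have "x \<in> cube"
    by (auto simp: mem_box_cart x_def frac_ge_0 less_imp_le[OF frac_lt_1])
  ultimately show ?thesis using y by (auto simp: to_torus_eq_iff)
qed

text \<open>Stands for the compactness of the torus, which carries no topology in this development:
  every point has a representative in the compact cube.\<close>

lemma continuous_bounded_torus:
  fixes f :: "'d::finite torus \<Rightarrow> 'b::real_normed_vector"
  assumes "continuous_on UNIV (\<lambda>x. f (to_torus x))"
  obtains B where "\<And>p. norm (f p) \<le> B"
proof -
  have "compact ((\<lambda>x. f (to_torus x)) ` cube)"
    by (intro compact_continuous_image continuous_on_subset[OF assms]) auto
  then have "bounded ((\<lambda>x. f (to_torus x)) ` cube)" by (rule compact_imp_bounded)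
  then obtain B where "\<forall>x\<in>cube. norm (f (to_torus x)) \<le> B" unfolding bounded_iff by blast
  then show ?thesis using that cube_representative by metis
qed

lemma integrable_vol_continuous:
  fixes f :: "'d::finite torus \<Rightarrow> 'b::euclidean_space"
  assumes "continuous_on UNIV (\<lambda>x. f (to_torus x))"
  shows "integrable vol f"
proof -
  obtain B where "\<And>p. norm (f p) \<le> B" using continuous_bounded_torus[OF assms] by blast
  moreover have "f \<in> borel_measurable vol"
    unfolding borel_measurable_vol by (rule borel_measurable_continuous_onI[OF assms])
  ultimately show ?thesis
    by (intro finite_measure.integrable_const_bound[OF finite_measure_vol]) auto
qed

lemma integral_vol:
  fixes f :: "'d::finite torus \<Rightarrow> 'b::euclidean_space"
  assumes "continuous_on UNIV (\<lambda>x. f (to_torus x))"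
  shows "(\<integral>p. f p \<partial>vol) = integral cube (\<lambda>x. f (to_torus x))"
proof -
  have "(\<integral>p. f p \<partial>vol) = (\<integral>x. f (to_torus x) \<partial>restrict_space lborel cube)"
    by (subst vol_eq_distr, rule integral_distr)
      (auto simp: measurable_to_torus_cube borel_measurable_vol borel_measurable_continuous_onI[OF assms])
  also have "\<dots> = (LINT x:cube|lborel. f (to_torus x))"
    by (subst integral_restrict_space) (auto simp: set_lebesgue_integral_def)
  also have "\<dots> = integral cube (\<lambda>x. f (to_torus x))"
    by (rule set_borel_integral_eq_integral)
      (unfold set_integrable_def, rule borel_integrable_compact, auto intro: continuous_on_subset[OF assms])
  finally show ?thesis .
qed

lemma smooth_fun_continuous: "smooth_fun f \<Longrightarrow> continuous_on UNIV (\<lambda>x. f (to_torus x))"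
  by (intro smooth_imp_continuous smooth_funD)

lemma integrable_vol: "smooth_fun f \<Longrightarrow> integrable vol f"
  by (rule integrable_vol_continuous[OF smooth_fun_continuous])

lemma integral_vol_nonneg_eq_0:
  fixes f :: "'d::finite torus \<Rightarrow> real"
  assumes f: "smooth_fun f" "\<And>p. f p \<ge> 0" and "(\<integral>p. f p \<partial>vol) = 0"
  shows "f p = 0"
proof -
  note cont = smooth_fun_continuous[OF f(1)]
  have "integral cube (\<lambda>x. f (to_torus x)) = 0"
    using integral_vol[OF cont] assms(3) by simp
  moreover have "box 0 ((\<chi> i. 1) :: real^'d) \<noteq> {}"
    by (auto simp: interval_ne_empty_cart)
  ultimately have "\<forall>x\<in>cube. f (to_torus x) = 0"
    using integral_cbox_eq_0_iff[of 0 "(\<chi> i. 1) :: real^'d" "\<lambda>x. f (to_torus x)"]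
      continuous_on_subset[OF cont] f(2) by auto
  then show ?thesis using cube_representative[of p] by auto
qed

section \<open>Translation invariance and integration by parts\<close>

lemma to_torus_shift_axis: "to_torus (x + axis i 1) = to_torus x"
  by (auto simp: to_torus_eq_iff lattice_equiv_def axis_def)

text \<open>The part of the shifted cube beyond the face \<open>x $ i = 1\<close> is moved back by
  one period and fills exactly the slab that the shift has vacated.\<close>

lemma integral_cube_translate_nonneg:
  fixes f :: "real^'d::finite \<Rightarrow> real"
  assumes cont: "continuous_on UNIV f" and per: "\<And>x. f (x + axis i 1) = f x" and t: "0 \<le> t" "t \<le> 1"
  shows "integral cube (\<lambda>x. f (x + t *\<^sub>R axis i 1)) = integral cube f"
proof -
  define e :: "real^'d" where "e = axis i 1"
  define o1 :: "real^'d" where "o1 = (\<chi> i. 1)"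
  have e: "e \<in> Basis" "\<And>x. x \<bullet> e = x $ i" "\<And>j. e $ j = (if j = i then 1 else 0)"
    by (simp_all add: e_def axis_in_Basis_iff inner_axis) (simp add: axis_def)
  have int: "g integrable_on cbox a b" if "continuous_on UNIV g" for g :: "real^'d \<Rightarrow> real" and a b
    by (intro integrable_continuous continuous_on_subset[OF that]) auto
  have "integral cube (\<lambda>x. f (x + t *\<^sub>R e)) = integral (cbox (t *\<^sub>R e) (o1 + t *\<^sub>R e)) f"
    using integral_shift_cbox[of "t *\<^sub>R e" "t *\<^sub>R e" "o1 + t *\<^sub>R e" f] by (simp add: o1_def)
  also have "\<dots> = integral (cbox (t *\<^sub>R e) (o1 + t *\<^sub>R e) \<inter> {x. x \<bullet> e \<le> 1}) f
      + integral (cbox (t *\<^sub>R e) (o1 + t *\<^sub>R e) \<inter> {x. x \<bullet> e \<ge> 1}) f"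
    by (rule integral_split[OF int[OF cont] e(1)])
  also have "cbox (t *\<^sub>R e) (o1 + t *\<^sub>R e) \<inter> {x. x \<bullet> e \<le> 1} = cbox (t *\<^sub>R e) o1"
    using t by (intro set_eqI) (simp add: mem_box_cart e o1_def, smt (verit))
  also have "cbox (t *\<^sub>R e) (o1 + t *\<^sub>R e) \<inter> {x. x \<bullet> e \<ge> 1} = cbox e (o1 + t *\<^sub>R e)"
    using t by (intro set_eqI) (simp add: mem_box_cart e o1_def, smt (verit))
  also have "integral (cbox e (o1 + t *\<^sub>R e)) f = integral (cbox 0 (o1 + (t - 1) *\<^sub>R e)) f"
    using integral_shift_cbox[of e e "o1 + t *\<^sub>R e" f] per by (simp add: e_def algebra_simps)
  also have "cbox 0 (o1 + (t - 1) *\<^sub>R e) = cube \<inter> {x. x \<bullet> e \<le> t}"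
    using t by (intro set_eqI) (simp add: mem_box_cart e o1_def, smt (verit))
  also have "cbox (t *\<^sub>R e) o1 = cube \<inter> {x. x \<bullet> e \<ge> t}"
    using t by (intro set_eqI) (simp add: mem_box_cart e o1_def, smt (verit))
  also have "integral (cube \<inter> {x. x \<bullet> e \<ge> t}) f + integral (cube \<inter> {x. x \<bullet> e \<le> t}) f = integral cube f"
    using integral_split[OF int[OF cont] e(1), of 0 "\<chi> i. 1" t] by simp
  finally show ?thesis by (simp add: e_def)
qed

lemma integral_cube_translate:
  fixes f :: "real^'d::finite \<Rightarrow> real"
  assumes cont: "continuous_on UNIV f" and per: "\<And>x. f (x + axis i 1) = f x" and t: "\<bar>t\<bar> \<le> 1"
  shows "integral cube (\<lambda>x. f (x + t *\<^sub>R axis i 1)) = integral cube f"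
proof (cases "t \<ge> 0")
  case True
  then show ?thesis using t by (intro integral_cube_translate_nonneg[OF cont per]) auto
next
  case False
  \<comment> \<open>A negative shift is inverted by a positive one: \<open>f\<close> is the
    translate of \<open>g\<close> by \<open>- t\<close>.\<close>
  define g where "g x = f (x + t *\<^sub>R axis i 1)" for x
  have "continuous_on UNIV g"
    unfolding g_def by (intro continuous_on_compose2[OF cont] continuous_intros) auto
  moreover have "g (x + axis i 1) = g x" for x
    using per[of "x + t *\<^sub>R axis i 1"] by (simp add: g_def add_ac)
  ultimately have "integral cube (\<lambda>x. g (x + (- t) *\<^sub>R axis i 1)) = integral cube g"
    using False t by (intro integral_cube_translate_nonneg) auto
  moreover have "(\<lambda>x. g (x + (- t) *\<^sub>R axis i 1)) = f" by (simp add: g_def)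
  ultimately show ?thesis by (simp add: g_def[abs_def])
qed

lemma has_derivative_integral_cube:
  fixes H :: "real \<times> (real^'d::finite) \<Rightarrow> 'b::euclidean_space"
  assumes H: "smooth H"
  shows "((\<lambda>t. integral cube (\<lambda>x. H (t, x))) has_vector_derivative
    integral cube (\<lambda>x. FD H (t, x) (1, 0))) (at t)"
proof -
  note cont = smooth_imp_continuous[OF H] smooth_imp_continuous[OF smooth_FD[OF H]]
  have "((\<lambda>t. integral cube (\<lambda>x. H (t, x))) has_vector_derivative
    integral cube (\<lambda>x. FD H (t, x) (1, 0))) (at t within UNIV)"
  proof (rule leibniz_rule_vector_derivative)
    show "((\<lambda>t. H (t, x)) has_vector_derivative FD H (t, x) (1, 0)) (at t within UNIV)" for t x
      using has_vector_derivative_line[OF smooth_Ck[OF H], of "(0, x)" "(1, 0)" t UNIV] by simp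
    show "(\<lambda>x. H (t, x)) integrable_on cube" for t
      by (intro integrable_continuous continuous_on_compose2[OF cont(1)] continuous_intros) auto
    show "continuous_on (UNIV \<times> cube) (\<lambda>(t, x). FD H (t, x) (1, 0))"
      unfolding split_beta by (intro continuous_on_compose2[OF cont(2)] continuous_intros) auto
  qed auto
  then show ?thesis by simp
qed

text \<open>The integral of a translate of \<open>f\<close> is constant in the amount of
  translation, and the integral in question is its derivative at amount \<open>0\<close>.\<close>

lemma integral_D_at_axis:
  fixes f :: "'d::finite torus \<Rightarrow> real"
  assumes f: "smooth_fun f"
  shows "(\<integral>p. D_at f p (axis i 1) \<partial>vol) = 0"
proof -
  define F where "F x = f (to_torus x)" for x
  have F: "smooth F" unfolding F_def[abs_def] by (rule smooth_funD[OF f])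
  define H where "H z = F (snd z + fst z *\<^sub>R axis i 1)" for z :: "real \<times> (real^'d)"
  have H: "smooth H" unfolding H_def[abs_def]
    by (intro smooth_compose[OF F] smooth_add smooth_scaleR smooth_const smooth_fst smooth_snd smooth_id)
  have "((\<lambda>t. integral cube (\<lambda>x. H (t, x))) has_vector_derivative
      integral cube (\<lambda>x. FD H (0, x) (1, 0))) (at 0)"
    by (rule has_derivative_integral_cube[OF H])
  moreover have "integral cube (\<lambda>x. H (t, x)) = integral cube F" if "t \<in> {-1<..<1}" for t
    unfolding H_def fst_conv snd_conv using that
    by (intro integral_cube_translate smooth_imp_continuous[OF F])
      (auto simp: F_def to_torus_shift_axis)
  ultimately have "((\<lambda>t. integral cube F) has_vector_derivative
      integral cube (\<lambda>x. FD H (0, x) (1, 0))) (at 0)"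
    using has_vector_derivative_transform_within_open[of _ _ 0 "{-1<..<1}" "\<lambda>t. integral cube F"] by simp
  then have 0: "integral cube (\<lambda>x. FD H (0, x) (1, 0)) = 0"
    using vector_derivative_unique_at has_vector_derivative_const by blast
  have "FD H (0, x) (1, 0) = FD F x (axis i 1)" for x
  proof -
    have "((\<lambda>z. snd z + fst z *\<^sub>R axis i 1) has_derivative (\<lambda>h. snd h + fst h *\<^sub>R axis i 1)) (at (0, x))"
      by (auto intro!: derivative_eq_intros)
    moreover have "(F has_derivative FD F x) (at (snd (0::real, x) + fst (0::real, x) *\<^sub>R axis i 1))"
      using smooth_has_derivative[OF F] by simp
    ultimately have "(H has_derivative (\<lambda>h. FD F x (snd h + fst h *\<^sub>R axis i 1))) (at (0, x))"
      unfolding H_def[abs_def] by (rule has_derivative_compose)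
    from FD_eqI[OF this] show ?thesis by simp
  qed
  then have "integral cube (\<lambda>x. D_at f (to_torus x) (axis i 1)) = 0"
    using 0 by (simp add: D_at_to_torus[OF f] F_def[abs_def])
  then show ?thesis
    by (simp add: integral_vol[OF smooth_fun_continuous[OF smooth_fun_D_at[OF f]]])
qed

lemma integral_dvg:
  assumes "smooth_fun w"
  shows "(\<integral>p. dvg w p \<partial>vol) = 0"
  unfolding dvg_nth[OF assms]
  by (subst Bochner_Integration.integral_sum)
    (auto intro!: integrable_vol smooth_fun_D_at smooth_fun_nth assms sum.neutral integral_D_at_axis)

lemma integral_by_parts:
  assumes "smooth_fun v" "smooth_fun \<phi>"
  shows "(\<integral>p. v p \<bullet> grad \<phi> p \<partial>vol) = - (\<integral>p. \<phi> p * dvg v p \<partial>vol)"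
proof -
  have "(\<integral>p. \<phi> p * dvg v p + v p \<bullet> grad \<phi> p \<partial>vol) = 0"
    using integral_dvg[OF smooth_fun_scaleR[OF assms(2,1)]]
    by (simp add: dvg_scaleR[OF assms(2,1)])
  moreover have "(\<integral>p. \<phi> p * dvg v p + v p \<bullet> grad \<phi> p \<partial>vol)
      = (\<integral>p. \<phi> p * dvg v p \<partial>vol) + (\<integral>p. v p \<bullet> grad \<phi> p \<partial>vol)"
    by (intro Bochner_Integration.integral_add integrable_vol smooth_fun_mult smooth_fun_inner
        smooth_fun_grad smooth_fun_dvg assms)
  ultimately show ?thesis by simp
qed

lemma integral_grad_div_free:
  assumes "smooth_fun v" "\<And>p. dvg v p = 0" "smooth_fun \<phi>"
  shows "(\<integral>p. v p \<bullet> grad \<phi> p \<partial>vol) = 0"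
  using integral_by_parts[OF assms(1,3)] assms(2) by simp

text \<open>The test function \<open>dvg w\<close> itself yields a vanishing integral of the square
  of the divergence.\<close>

lemma weakly_div_free:
  assumes w: "smooth_fun w" and "\<And>\<phi>. smooth_fun \<phi> \<Longrightarrow> (\<integral>p. w p \<bullet> grad \<phi> p \<partial>vol) = 0"
  shows "dvg w p = 0"
proof -
  have "(\<integral>p. dvg w p * dvg w p \<partial>vol) = 0"
    using integral_by_parts[OF w smooth_fun_dvg[OF w]] assms(2)[OF smooth_fun_dvg[OF w]] by simp
  from integral_vol_nonneg_eq_0[OF _ _ this, of p] show ?thesis
    by (auto intro: smooth_fun_mult smooth_fun_dvg w)
qed

section \<open>Volume preserving maps\<close>

text \<open>\<open>rep_torus\<close> picks an unspecified representative, which a lattice invariant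
  function does not notice. Periodic functions and the flow are brought down to the torus this
  way.\<close>

lemma descend_to_torus:
  assumes "\<And>x y. lattice_equiv x y \<Longrightarrow> g x = g y"
  shows "g (rep_torus (to_torus x)) = g x"
  by (rule assms) (simp add: to_torus_eq_iff[symmetric])

lemma smooth_map_measurable:
  assumes "smooth_map (X :: 'd::finite torus \<Rightarrow> 'd torus)"
  shows "X \<in> vol \<rightarrow>\<^sub>M vol"
proof (rule measurableI)
  obtain L where L: "smooth L" "\<And>x. X (to_torus x) = to_torus (L x)"
    using assms by (auto simp: smooth_map_def)
  have "L \<in> borel \<rightarrow>\<^sub>M borel"
    by (intro borel_measurable_continuous_onI smooth_imp_continuous L)
  fix A :: "'d torus set" assume "A \<in> sets vol"
  then have "to_torus -` A \<in> sets borel" by (simp add: sets_vol)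
  from measurable_sets[OF \<open>L \<in> _\<close> this] show "X -` A \<inter> space vol \<in> sets vol"
    by (simp add: sets_vol vimage_def L(2))
qed simp

section \<open>Measures on the torus determined by integrals of smooth functions\<close>

lemma cos_sin_2pi_periodic:
  assumes "x - y \<in> \<int>"
  shows "cos (2 * pi * x) = cos (2 * pi * y)" "sin (2 * pi * x) = sin (2 * pi * y)"
proof -
  obtain n where "x - y = of_int n" using assms by (auto elim: Ints_cases)
  then have "x = y + of_int n" by simp
  then have "2 * pi * x = 2 * pi * y + 2 * pi * of_int n" by (simp only: distrib_left)
  then show "cos (2 * pi * x) = cos (2 * pi * y)" "sin (2 * pi * x) = sin (2 * pi * y)"
    by (simp_all add: cos_add sin_add)
qed

lemma smooth_cos_sin:
  "smooth (\<lambda>x::real^'d::finite. cos (2 * pi * x $ i))" "smooth (\<lambda>x::real^'d::finite. sin (2 * pi * x $ i))"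
proof -
  have l: "smooth (\<lambda>x::real^'d. 2 * pi * x $ i)"
    by (intro smooth_mult smooth_const smooth_nth smooth_id)
  have "smooth (cos :: real \<Rightarrow> real)" "smooth (sin :: real \<Rightarrow> real)"
    using Ck_sin_cos by (auto simp: smooth_def)
  from this[THEN smooth_compose, OF l]
  show "smooth (\<lambda>x::real^'d::finite. cos (2 * pi * x $ i))" "smooth (\<lambda>x::real^'d::finite. sin (2 * pi * x $ i))" .
qed

text \<open>\<open>arccos\<close> recovers an angle in the upper half circle only; for a negative
  sine the angle is \<open>2 * pi\<close> minus that value. As sine and cosine are periodic, the
  fractional part becomes a function of smooth functions on the torus.\<close>

lemma frac_eq_arccos:
  "frac r = (if sin (2 * pi * r) \<ge> 0 then arccos (cos (2 * pi * r)) / (2 * pi)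
     else 1 - arccos (cos (2 * pi * r)) / (2 * pi))"
proof -
  define t where "t = 2 * pi * frac r"
  have "r - frac r \<in> \<int>" by (simp add: frac_def)
  note eq = cos_sin_2pi_periodic[OF this, folded t_def]
  have t: "0 \<le> t" "t < 2 * pi" using frac_lt_1[of r] by (auto simp: t_def frac_ge_0)
  have fr: "frac r = t / (2 * pi)" by (simp add: t_def)
  show ?thesis
  proof (cases "t \<le> pi")
    case True
    then have "sin t \<ge> 0" "arccos (cos t) = t" using t by (auto intro: sin_ge_zero arccos_cos)
    then show ?thesis unfolding eq fr by simp
  next
    case False
    then have "sin t < 0" using t by (intro sin_lt_zero) auto
    moreover have "arccos (cos t) = 2 * pi - t"
    proof -
      have "arccos (cos (2 * pi - t)) = 2 * pi - t" using t False by (intro arccos_cos) auto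
      then show ?thesis by (simp add: cos_diff)
    qed
    ultimately show ?thesis unfolding eq fr by (simp add: field_simps)
  qed
qed

text \<open>Finite sets \<open>S\<close> make the family stable under intersection, and the empty
  one contributes the whole torus, as the uniqueness theorem for measures requires. Indicators of
  these sets are limits of smooth functions.\<close>

definition smooth_positivity_sets :: "'d::finite torus set set" where
  "smooth_positivity_sets = {{p. \<forall>f\<in>S. 0 < f p} | S. finite S \<and> (\<forall>f\<in>S. smooth_fun (f :: 'd torus \<Rightarrow> real))}"

lemma smooth_positivity_sets_measurable: "smooth_positivity_sets \<subseteq> sets (vol :: 'd::finite torus measure)"
proof
  fix A :: "'d torus set" assume "A \<in> smooth_positivity_sets"
  then obtain S where S: "A = {p. \<forall>f\<in>S. 0 < f p}" "finite S" "\<forall>f\<in>S. smooth_fun (f :: 'd torus \<Rightarrow> real)"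
    by (auto simp: smooth_positivity_sets_def)
  have "to_torus -` A = (\<Inter>f\<in>S. {x. 0 < f (to_torus x)})" using S(1) by auto
  moreover have "open \<dots>"
    using S by (intro open_INT ballI open_Collect_less continuous_on_const smooth_fun_continuous) auto
  ultimately show "A \<in> sets vol" by (simp add: sets_vol)
qed

text \<open>The coordinates in \<open>[0,1)\<close> are measurable functions of the sines and cosines.\<close>

lemma sets_vol_generated: "sets (vol :: 'd::finite torus measure) = sigma_sets UNIV smooth_positivity_sets"
proof
  show "sigma_sets UNIV smooth_positivity_sets \<subseteq> sets (vol :: 'd torus measure)"
    using sets.sigma_sets_subset[OF smooth_positivity_sets_measurable] by simp
next
  define N :: "'d torus measure" where "N = sigma UNIV smooth_positivity_sets"
  have sets_N: "sets N = sigma_sets UNIV smooth_positivity_sets" and space_N: "space N = UNIV"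
    by (auto simp: N_def sets_measure_of_conv space_measure_of_conv)
  have meas: "f \<in> borel_measurable N" if "smooth_fun f" for f :: "'d torus \<Rightarrow> real"
  proof (subst borel_measurable_iff_greater, rule allI)
    fix a
    have "{p. a < f p} = {p. \<forall>g\<in>{\<lambda>p. f p - a}. 0 < g p}" by simp
    moreover have "smooth_fun (\<lambda>p. f p - a)" by (intro smooth_fun_diff that smooth_fun_const)
    ultimately have "{p. a < f p} \<in> smooth_positivity_sets"
      unfolding smooth_positivity_sets_def by blast
    then show "{w \<in> space N. a < f w} \<in> sets N" by (simp add: sets_N space_N)
  qed
  define c :: "'d torus \<Rightarrow> real^'d" where "c p = (\<chi> i. frac (rep_torus p $ i))" for p
  have "(\<lambda>p. c p $ i) \<in> borel_measurable N" for i
  proof -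
    define C where "C p = cos (2 * pi * rep_torus p $ i)" for p :: "'d torus"
    define S where "S p = sin (2 * pi * rep_torus p $ i)" for p :: "'d torus"
    have "C (to_torus x) = cos (2 * pi * x $ i)" "S (to_torus x) = sin (2 * pi * x $ i)" for x
      unfolding C_def S_def
      by (rule descend_to_torus[where g = "\<lambda>x. cos (2 * pi * x $ i)"],
          simp add: cos_sin_2pi_periodic lattice_equiv_def)
        (rule descend_to_torus[where g = "\<lambda>x. sin (2 * pi * x $ i)"],
          simp add: cos_sin_2pi_periodic lattice_equiv_def)
    then have "smooth_fun C" "smooth_fun S" by (simp_all add: smooth_fun_def smooth_cos_sin)
    note [measurable] = this[THEN meas]
    \<comment> \<open>Clipping to \<open>[-1, 1]\<close> makes \<open>arccos\<close> continuous on
      the whole line, hence measurable, and changes nothing at the value of a cosine.\<close>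
    define ac where "ac y = arccos (max (-1) (min 1 y))" for y :: real
    have "continuous_on UNIV ac"
      unfolding ac_def by (intro continuous_on_arccos continuous_intros) auto
    then have [measurable]: "ac \<in> borel_measurable borel" by (rule borel_measurable_continuous_onI)
    have "(\<lambda>p. if S p \<ge> 0 then ac (C p) / (2 * pi) else 1 - ac (C p) / (2 * pi)) \<in> borel_measurable N"
      by measurable
    also have "(\<lambda>p. if S p \<ge> 0 then ac (C p) / (2 * pi) else 1 - ac (C p) / (2 * pi)) = (\<lambda>p. c p $ i)"
    proof
      fix p
      have "ac (C p) = arccos (C p)" by (simp add: ac_def C_def)
      then show "(if S p \<ge> 0 then ac (C p) / (2 * pi) else 1 - ac (C p) / (2 * pi)) = c p $ i"
        by (simp add: c_def C_def S_def frac_eq_arccos[of "rep_torus p $ i"])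
    qed
    finally show ?thesis .
  qed
  then have c: "c \<in> borel_measurable N"
    by (subst borel_measurable_euclidean_space) (auto simp: Basis_vec_def inner_axis)
  \<comment> \<open>As \<open>c\<close> is a section of \<open>to_torus\<close>, each set
    \<open>A\<close> is the preimage under \<open>c\<close> of its own preimage under
    \<open>to_torus\<close>, so measurability of \<open>c\<close> on \<open>N\<close> puts
    \<open>A\<close> into \<open>N\<close>.\<close>
  have to_torus_c: "to_torus (c p) = p" for p
  proof -
    have "to_torus (c p) = to_torus (rep_torus p)"
      unfolding to_torus_eq_iff by (auto simp: lattice_equiv_def c_def frac_def)
    then show ?thesis by simp
  qed
  show "sets (vol :: 'd torus measure) \<subseteq> sigma_sets UNIV smooth_positivity_sets"
  proof
    fix A :: "'d torus set" assume "A \<in> sets vol"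
    then have "to_torus -` A \<in> sets borel" by (simp add: sets_vol)
    from measurable_sets[OF c this] have "c -` to_torus -` A \<in> sets N" by (simp add: space_N)
    moreover have "c -` to_torus -` A = A" by (auto simp: to_torus_c)
    ultimately show "A \<in> sigma_sets UNIV smooth_positivity_sets" by (simp add: sets_N)
  qed
qed

text \<open>A logistic function of slope parameter \<open>n\<close>. The shift \<open>sqrt n\<close>
  forces the limit \<open>0\<close> at \<open>y = 0\<close>, while \<open>n * y\<close> outgrows it
  for every \<open>y > 0\<close>; the limit is thus the indicator of the open half-line.\<close>

definition step_approx :: "nat \<Rightarrow> real \<Rightarrow> real" where
  "step_approx n y = inverse (1 + exp (sqrt n - n * y))"

lemma step_approx_bounds: "0 \<le> step_approx n y" "step_approx n y \<le> 1"
  by (auto simp: step_approx_def inverse_le_1_iff add_pos_nonneg intro!: less_imp_le add_pos_pos)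

lemma step_approx_tendsto: "(\<lambda>n. step_approx n y) \<longlonglongrightarrow> (if 0 < y then 1 else 0)"
proof -
  have sq: "filterlim (\<lambda>n. sqrt (real n)) at_top sequentially"
    by (rule filterlim_compose[OF sqrt_at_top filterlim_real_sequentially])
  show ?thesis
  proof (cases "0 < y")
    case True
    have "filterlim (\<lambda>n. sqrt (real n) * y) at_top sequentially"
      using filterlim_at_top_mult_tendsto_pos[OF tendsto_const True sq] by simp
    then have "filterlim (\<lambda>n. - 1 + sqrt (real n) * y) at_top sequentially"
      by (rule filterlim_tendsto_add_at_top[OF tendsto_const])
    then have "filterlim (\<lambda>n. sqrt (real n) * (- 1 + sqrt (real n) * y)) at_top sequentially"
      by (rule filterlim_at_top_mult_at_top[OF sq])
    then have "filterlim (\<lambda>n. - (sqrt (real n) * (- 1 + sqrt (real n) * y))) at_bot sequentially"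
      by (simp add: filterlim_uminus_at_bot)
    moreover have "- (sqrt (real n) * (- 1 + sqrt (real n) * y)) = sqrt n - n * y" for n
    proof -
      have "sqrt (real n) * (sqrt (real n) * y) = real n * y"
        by (simp add: mult.assoc[symmetric])
      then show ?thesis by (simp add: algebra_simps)
    qed
    ultimately have "filterlim (\<lambda>n. sqrt (real n) - real n * y) at_bot sequentially" by simp
    then have "(\<lambda>n. exp (sqrt (real n) - real n * y)) \<longlonglongrightarrow> 0"
      by (rule filterlim_compose[OF exp_at_bot])
    then have "(\<lambda>n. inverse (1 + exp (sqrt (real n) - real n * y))) \<longlonglongrightarrow> inverse (1 + 0)"
      by (intro tendsto_intros) auto
    then show ?thesis using True by (simp add: step_approx_def)
  next
    case False
    have "filterlim (\<lambda>n. sqrt (real n) - real n * y) at_top sequentially"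
    proof (rule filterlim_at_top_mono[OF sq], rule always_eventually, rule allI)
      fix n
      have "real n * y \<le> 0" using False by (intro mult_nonneg_nonpos) auto
      then show "sqrt (real n) \<le> sqrt (real n) - real n * y" by simp
    qed
    then have "filterlim (\<lambda>n. exp (sqrt (real n) - real n * y)) at_top sequentially"
      by (rule filterlim_compose[OF exp_at_top])
    then have "filterlim (\<lambda>n. 1 + exp (sqrt (real n) - real n * y)) at_top sequentially"
      by (rule filterlim_tendsto_add_at_top[OF tendsto_const])
    then show ?thesis using False by (simp add: step_approx_def tendsto_inverse_0_at_top)
  qed
qed

lemma smooth_fun_step_approx:
  assumes "smooth_fun f"
  shows "smooth_fun (\<lambda>p. step_approx n (f p))"
proof -
  have "smooth (exp :: real \<Rightarrow> real)" by (simp add: smooth_def Ck_exp)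
  then have "smooth (\<lambda>x. exp (sqrt n - n * f (to_torus x)))"
    by (rule smooth_compose) (intro smooth_diff smooth_mult smooth_const smooth_funD assms)
  then show ?thesis
    unfolding smooth_fun_def step_approx_def
    by (intro smooth_inverse smooth_add smooth_const) (auto simp: add_pos_pos less_imp_neq[symmetric])
qed

lemma smooth_fun_prod:
  fixes f :: "'i \<Rightarrow> 'd::finite torus \<Rightarrow> real"
  assumes "\<And>i. i \<in> I \<Longrightarrow> smooth_fun (f i)"
  shows "smooth_fun (\<lambda>p. \<Prod>i\<in>I. f i p)"
  using assms by (induction I rule: infinite_finite_induct) (auto intro: smooth_fun_const smooth_fun_mult)

text \<open>The indicator of a generating set is a bounded pointwise limit of products of smooth
  steps, so dominated convergence carries the equality of integrals over to it. Agreement on a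
  generator stable under intersection then gives equality of the measures.\<close>

lemma volume_preservingI:
  fixes X :: "'d::finite torus \<Rightarrow> 'd torus"
  assumes X: "smooth_map X"
    and int: "\<And>f :: 'd torus \<Rightarrow> real. smooth_fun f \<Longrightarrow> (\<integral>p. f (X p) \<partial>vol) = (\<integral>p. f p \<partial>vol)"
    and A: "A \<in> sets vol"
  shows "emeasure vol (X -` A) = emeasure vol A"
proof -
  interpret finite_measure "vol :: 'd torus measure" by (rule finite_measure_vol)
  note Xm [measurable] = smooth_map_measurable[OF X]
  have eq: "emeasure vol B = emeasure (distr vol vol X) B" if B: "B \<in> smooth_positivity_sets" for B
  proof -
    obtain S where S: "B = {p. \<forall>f\<in>S. 0 < f p}" "finite S" "\<And>f. f \<in> S \<Longrightarrow> smooth_fun (f :: 'd torus \<Rightarrow> real)"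
      using B by (auto simp: smooth_positivity_sets_def)
    have Bm [measurable]: "B \<in> sets vol" using B smooth_positivity_sets_measurable by blast
    define P where "P n p = (\<Prod>f\<in>S. step_approx n (f p))" for n p
    have P: "smooth_fun (P n)" for n
      unfolding P_def[abs_def] by (intro smooth_fun_prod smooth_fun_step_approx S)
    have P_lim: "(\<lambda>n. P n p) \<longlonglongrightarrow> indicator B p" for p
    proof -
      have "(\<lambda>n. P n p) \<longlonglongrightarrow> (\<Prod>f\<in>S. if 0 < f p then 1 else 0)"
        unfolding P_def by (intro tendsto_prod step_approx_tendsto)
      moreover have "(\<Prod>f\<in>S. if 0 < f p then 1 else 0 :: real) = indicator B p"
        using S(2) by (auto simp: S(1) indicator_def intro: prod_zero)
      ultimately show ?thesis by simp
    qed
    have P_bound: "\<bar>P n p\<bar> \<le> 1" for n p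
      by (auto simp: P_def abs_prod step_approx_bounds intro!: prod_le_1)
    have [measurable]: "P n \<in> borel_measurable vol" for n
      using integrable_vol[OF P] by auto
    have "(\<lambda>n. \<integral>p. P n p \<partial>vol) \<longlonglongrightarrow> (\<integral>p. indicator B p \<partial>vol)"
      by (rule integral_dominated_convergence[where w = "\<lambda>_. 1"]) (auto simp: P_lim P_bound)
    moreover have "(\<lambda>n. \<integral>p. P n (X p) \<partial>vol) \<longlonglongrightarrow> (\<integral>p. indicator B (X p) \<partial>vol)"
      by (rule integral_dominated_convergence[where w = "\<lambda>_. 1"]) (auto simp: P_lim P_bound)
    ultimately have "(\<integral>p. indicator B p \<partial>vol) = (\<integral>p. indicator B (X p) \<partial>(vol :: 'd torus measure) :: real)"
      unfolding int[OF P] by (rule LIMSEQ_unique)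
    moreover have "(\<lambda>p. indicator B (X p) :: real) = indicator (X -` B)"
      by (auto simp: indicator_def)
    ultimately have "measure vol B = measure vol (X -` B)" by simp
    moreover have "emeasure (distr vol vol X) B = emeasure vol (X -` B)"
      by (subst emeasure_distr) auto
    ultimately show ?thesis by (simp add: emeasure_eq_measure)
  qed
  have "vol = distr vol vol X"
  proof (rule measure_eqI_generator_eq[where E = smooth_positivity_sets and \<Omega> = UNIV and A = "\<lambda>_. UNIV"])
    show "Int_stable (smooth_positivity_sets :: 'd torus set set)"
    proof (rule Int_stableI)
      fix A B :: "'d torus set" assume "A \<in> smooth_positivity_sets" "B \<in> smooth_positivity_sets"
      then obtain S T where "A = {p. \<forall>f\<in>S. 0 < f p}" "finite S" "\<forall>f\<in>S. smooth_fun (f :: 'd torus \<Rightarrow> real)"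
        "B = {p. \<forall>f\<in>T. 0 < f p}" "finite T" "\<forall>f\<in>T. smooth_fun (f :: 'd torus \<Rightarrow> real)"
        by (auto simp: smooth_positivity_sets_def)
      then show "A \<inter> B \<in> smooth_positivity_sets"
        unfolding smooth_positivity_sets_def by (intro CollectI exI[of _ "S \<union> T"]) auto
    qed
    show "range (\<lambda>_::nat. UNIV) \<subseteq> (smooth_positivity_sets :: 'd torus set set)"
      unfolding smooth_positivity_sets_def by (auto intro!: exI[of _ "{}"])
  qed (auto simp: eq sets_vol_generated)
  then have "emeasure vol A = emeasure (distr vol vol X) A" by simp
  then show ?thesis using A by (simp add: emeasure_distr)
qed

section \<open>Basic properties of \<open>SDiff\<close>\<close>

lemma SDiffD:
  assumes "X \<in> SDiff"
  shows "bij X" "smooth_map X" "smooth_map (inv X)"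
    "A \<in> sets vol \<Longrightarrow> emeasure vol (X -` A) = emeasure vol A"
  using assms by (auto simp: SDiff_def Diff_def)

lemma SDiff_inv: "X \<in> SDiff \<Longrightarrow> X (inv X p) = p" "X \<in> SDiff \<Longrightarrow> inv X (X p) = p"
  using SDiffD(1)[of X] by (auto simp: bij_def surj_f_inv_f)

lemma SDiff_integral:
  fixes f :: "'d::finite torus \<Rightarrow> 'b::euclidean_space"
  assumes X: "X \<in> SDiff" and f: "smooth_fun f"
  shows "(\<integral>p. f (X p) \<partial>vol) = (\<integral>p. f p \<partial>vol)"
proof -
  note Xm = smooth_map_measurable[OF SDiffD(2)[OF X]]
  have "distr vol vol X = vol"
    by (rule measure_eqI) (auto simp: emeasure_distr Xm SDiffD(4)[OF X])
  moreover have "f \<in> borel_measurable vol" using integrable_vol[OF f] by auto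
  ultimately show ?thesis using integral_distr[OF Xm, of f] by simp
qed

lemma smooth_map_comp: "smooth_map X \<Longrightarrow> smooth_map Y \<Longrightarrow> smooth_map (X \<circ> Y)"
  unfolding smooth_map_def by (metis comp_apply smooth_compose)

lemma SDiff_comp:
  fixes X Y :: "'d::finite torus \<Rightarrow> 'd torus"
  assumes X: "X \<in> SDiff" and Y: "Y \<in> SDiff"
  shows "X \<circ> Y \<in> SDiff"
proof -
  have "emeasure vol ((X \<circ> Y) -` A) = emeasure vol A" if "A \<in> sets vol" for A
    using measurable_sets[OF smooth_map_measurable[OF SDiffD(2)[OF X]] that] that
    by (simp add: vimage_comp[symmetric] SDiffD(4)[OF X] SDiffD(4)[OF Y])
  then show ?thesis
    using X Y by (auto simp: SDiff_def Diff_def bij_comp smooth_map_comp o_inv_distrib)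
qed

section \<open>The flow of a divergence free field\<close>

text \<open>The derivative is bounded by compactness of the torus. The resulting global Lipschitz
  bound for the lifted field makes its flow exist for all times.\<close>

lemma smooth_fun_lipschitz:
  fixes u :: "'d::finite torus \<Rightarrow> real^'d"
  assumes u: "smooth_fun u"
  obtains K where "\<And>x y. norm (u (to_torus x) - u (to_torus y)) \<le> K * norm (x - y)"
proof -
  have "\<exists>B. \<forall>p. norm (D_at u p b) \<le> B" for b
    using continuous_bounded_torus[OF smooth_fun_continuous[OF smooth_fun_D_at[OF u]]] by metis
  then obtain B where B: "\<And>b p. norm (D_at u p b) \<le> B b" by metis
  have bound: "norm (D_at u p h) \<le> (\<Sum>b\<in>Basis. B b) * norm h" for p h
  proof -
    have "D_at u p h = (\<Sum>b\<in>Basis. (h \<bullet> b) *\<^sub>R D_at u p b)"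
      by (rule linear_euclidean_expand[OF D_at_linear[OF u]])
    then have "norm (D_at u p h) \<le> (\<Sum>b\<in>Basis. norm (D_at u p b)) * norm h"
      using norm_linear_combination_le[of h "D_at u p"] by simp
    also have "\<dots> \<le> (\<Sum>b\<in>Basis. B b) * norm h"
      by (intro mult_right_mono sum_mono B) auto
    finally show ?thesis .
  qed
  show ?thesis
  proof (rule that)
    fix x y
    show "norm (u (to_torus x) - u (to_torus y)) \<le> (\<Sum>b\<in>Basis. B b) * norm (x - y)"
      by (rule differentiable_bound[where S = UNIV and f' = "\<lambda>x. D_at u (to_torus x)"])
        (auto intro: D_at_has_derivative u onorm_le bound)
  qed
qed

text \<open>By the group property it suffices to differentiate \<open>\<integral> \<phi>(fl t (fl s p))\<close> at \<open>s = 0\<close>, where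
  the derivative is the integral of \<open>u \<cdot> \<nabla>(\<phi> \<circ> fl t)\<close>.\<close>

lemma div_free_flow:
  fixes u :: "'d::finite torus \<Rightarrow> real^'d"
  assumes u: "smooth_fun u" and div: "\<And>p. dvg u p = 0"
  obtains fl \<Phi> where "\<And>t. fl t \<in> SDiff" "\<And>p. fl 0 p = p" "curve_lift fl \<Phi>"
    "\<And>x. ((\<lambda>t. \<Phi> (t, x)) has_vector_derivative u (to_torus x)) (at 0)"
proof -
  define f where "f x = u (to_torus x)" for x
  have f: "smooth f" unfolding f_def[abs_def] by (rule smooth_funD[OF u])
  obtain K where lip: "\<And>x y. norm (f x - f y) \<le> K * norm (x - y)"
    unfolding f_def using smooth_fun_lipschitz[OF u] by blast
  obtain \<Phi> where \<Phi>: "flow_of f \<Phi>"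
    using flow_exists[OF lip smooth_imp_continuous[OF f]] by blast
  have smooth_\<Phi>: "smooth \<Phi>" unfolding smooth_def using flow_Ck[OF lip f \<Phi>] by blast
  \<comment> \<open>The lifted field is periodic, so a lattice translate of a trajectory is again a
    trajectory. By uniqueness the flow commutes with lattice translations and therefore descends to
    the torus.\<close>
  have equiv: "lattice_equiv (\<Phi> (t, x)) (\<Phi> (t, y))" if "lattice_equiv x y" for t x y
  proof -
    define k where "k = x - y"
    have k: "k $ i \<in> \<int>" for i using that by (simp add: lattice_equiv_def k_def)
    have "f (z + k) = f z" for z
      unfolding f_def by (rule arg_cong[of _ _ u]) (simp add: to_torus_eq_iff lattice_equiv_def k)
    then have "((\<lambda>t. \<Phi> (t, y) + k) has_vector_derivative f (\<Phi> (t, y) + k)) (at t)" for t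
      using has_vector_derivative_add[OF flow_ofD(2)[OF \<Phi>] has_vector_derivative_const] by simp
    from autonomous_unique[OF lip flow_ofD(2)[OF \<Phi>] this]
    have "\<Phi> (t, x) = \<Phi> (t, y) + k"
      by (auto simp: flow_ofD(1)[OF \<Phi>] k_def)
    then show ?thesis by (simp add: lattice_equiv_def k)
  qed
  define fl where "fl t p = to_torus (\<Phi> (t, rep_torus p))" for t p
  have fl: "fl t (to_torus x) = to_torus (\<Phi> (t, x))" for t x
    unfolding fl_def by (rule descend_to_torus) (simp add: to_torus_eq_iff equiv)
  have fl0: "fl 0 p = p" for p
    by (cases p) (simp add: fl flow_ofD(1)[OF \<Phi>])
  have fl_add: "fl (t + s) p = fl t (fl s p)" for t s p
    by (cases p) (simp add: fl flow_add[OF lip \<Phi>])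
  have smooth_\<Phi>t: "smooth (\<lambda>x. \<Phi> (t, x))" for t
    by (intro smooth_compose[OF smooth_\<Phi>] smooth_Pair smooth_const smooth_id)
  have sm: "smooth_map (fl t)" for t
    unfolding smooth_map_def using smooth_\<Phi>t fl by blast
  have inv1: "fl t (fl (- t) p) = p" "fl (- t) (fl t p) = p" for t p
    by (simp_all add: fl_add[symmetric] fl0)
  have bij: "bij (fl t)" for t
    by (rule o_bij[of "fl (- t)"]) (auto simp: inv1)
  have inv: "inv (fl t) = fl (- t)" for t
    by (rule inv_equality) (auto simp: inv1)
  have int: "(\<integral>p. \<phi> (fl t p) \<partial>vol) = (\<integral>p. \<phi> p \<partial>vol)"
    if \<phi>: "smooth_fun \<phi>" for \<phi> :: "'d torus \<Rightarrow> real" and t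
  proof -
    define m where "m t = (\<integral>p. \<phi> (fl t p) \<partial>vol)" for t
    have "(m has_vector_derivative 0) (at t)" for t
    proof -
      define \<psi> where "\<psi> p = \<phi> (fl t p)" for p
      have \<psi>: "smooth_fun \<psi>" unfolding \<psi>_def[abs_def] by (rule smooth_fun_compose_map[OF \<phi> sm])
      define H where "H z = \<psi> (to_torus (\<Phi> z))" for z
      have H: "smooth H" unfolding H_def[abs_def]
        by (rule smooth_compose[OF smooth_funD[OF \<psi>] smooth_\<Phi>])
      have mH: "m (t + s) = integral cube (\<lambda>x. H (s, x))" for s
      proof -
        have "m (t + s) = (\<integral>p. \<psi> (fl s p) \<partial>vol)" by (simp add: m_def \<psi>_def fl_add)
        also have "\<dots> = integral cube (\<lambda>x. \<psi> (fl s (to_torus x)))"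
          by (intro integral_vol smooth_fun_continuous smooth_fun_compose_map[OF \<psi> sm])
        finally show ?thesis by (simp add: H_def fl)
      qed
      have "FD H (0, x) (1, 0) = u (to_torus x) \<bullet> grad \<psi> (to_torus x)" for x
      proof -
        have "((\<lambda>s. H (s, x)) has_vector_derivative FD H (0, x) (1, 0)) (at 0)"
          using has_vector_derivative_line[OF smooth_Ck[OF H], of "(0, x)" "(1, 0)" 0] by simp
        moreover have "((\<lambda>s. H (s, x)) has_vector_derivative D_at \<psi> (to_torus x) (u (to_torus x))) (at 0)"
        proof -
          have "((\<lambda>s. \<Phi> (s, x)) has_derivative (\<lambda>r. r *\<^sub>R f x)) (at 0)"
            using flow_ofD(2)[OF \<Phi>, of x 0] by (simp add: has_vector_derivative_def flow_ofD(1)[OF \<Phi>])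
          moreover have "((\<lambda>y. \<psi> (to_torus y)) has_derivative D_at \<psi> (to_torus x)) (at (\<Phi> (0, x)))"
            using D_at_has_derivative[OF \<psi>] by (simp add: flow_ofD(1)[OF \<Phi>])
          ultimately have "((\<lambda>s. H (s, x)) has_derivative (\<lambda>r. D_at \<psi> (to_torus x) (r *\<^sub>R f x))) (at 0)"
            unfolding H_def by (rule has_derivative_compose)
          then show ?thesis
            by (simp add: has_vector_derivative_def linear_cmul[OF D_at_linear[OF \<psi>]] f_def)
        qed
        ultimately show ?thesis
          by (simp add: vector_derivative_unique_at D_at_eq_grad[OF \<psi>])
      qed
      then have "integral cube (\<lambda>x. FD H (0, x) (1, 0)) = (\<integral>p. u p \<bullet> grad \<psi> p \<partial>vol)"
        using integral_vol[OF smooth_fun_continuous[OF smooth_fun_inner[OF u smooth_fun_grad[OF \<psi>]]]] by simp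
      also have "\<dots> = 0" by (rule integral_grad_div_free[OF u div \<psi>])
      finally have "((\<lambda>s. m (t + s)) has_vector_derivative 0) (at (t - t))"
        using has_derivative_integral_cube[OF H, of 0] by (simp add: mH)
      then have "((\<lambda>s. m (t + s)) \<circ> (\<lambda>r. r - t) has_vector_derivative 1 *\<^sub>R 0) (at t)"
        by (intro vector_diff_chain_at)
          (auto intro!: derivative_eq_intros simp: has_real_derivative_iff_has_vector_derivative[symmetric])
      then show ?thesis by (simp add: o_def)
    qed
    then have "m t = m 0"
      by (intro DERIV_isconst_all) (auto simp: has_real_derivative_iff_has_vector_derivative)
    then show ?thesis by (simp add: m_def fl0)
  qed
  have "fl t \<in> SDiff" for t
    unfolding SDiff_def Diff_def
    by (auto simp: bij inv sm intro: volume_preservingI[OF sm int])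
  moreover have "curve_lift fl \<Phi>" by (simp add: curve_lift_def smooth_\<Phi> fl)
  moreover have "((\<lambda>t. \<Phi> (t, x)) has_vector_derivative u (to_torus x)) (at 0)" for x
    using flow_ofD(2)[OF \<Phi>, of x 0] by (simp add: flow_ofD(1)[OF \<Phi>] f_def)
  ultimately show ?thesis using that fl0 by blast
qed

lemma SDiff_curve_exists:
  fixes u :: "'d::finite torus \<Rightarrow> real^'d"
  assumes u: "smooth_fun u" "\<And>p. dvg u p = 0" and X: "X \<in> SDiff"
  obtains \<gamma> where "smooth_curve_SDiff \<gamma>" "\<gamma> 0 = X" "velocity_at_0 \<gamma> (u \<circ> X)"
proof -
  obtain fl \<Phi> where fl: "\<And>t. fl t \<in> SDiff" "\<And>p. fl 0 p = p" "curve_lift fl \<Phi>"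
    "\<And>x. ((\<lambda>t. \<Phi> (t, x)) has_vector_derivative u (to_torus x)) (at 0)"
    using div_free_flow[OF u] by metis
  obtain L where L: "smooth L" "\<And>x. X (to_torus x) = to_torus (L x)"
    using SDiffD(2)[OF X] by (auto simp: smooth_map_def)
  define \<gamma> where "\<gamma> t = fl t \<circ> X" for t
  have lift: "curve_lift \<gamma> (\<lambda>z. \<Phi> (fst z, L (snd z)))"
    using fl(3) unfolding curve_lift_def
    by (auto simp: \<gamma>_def L(2) intro!: smooth_compose[of \<Phi>] smooth_Pair smooth_fst smooth_id
        smooth_compose[OF L(1)] smooth_snd)
  have "smooth_curve_SDiff \<gamma>"
    unfolding smooth_curve_SDiff_def using lift by (auto simp: \<gamma>_def intro: SDiff_comp fl X)
  moreover have "\<gamma> 0 = X" by (auto simp: \<gamma>_def fl)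
  moreover have "velocity_at_0 \<gamma> (u \<circ> X)"
    unfolding velocity_at_0_def using lift fl(4) by (intro exI[of _ "\<lambda>z. \<Phi> (fst z, L (snd z))"]) (auto simp: L(2))
  ultimately show ?thesis by (rule that)
qed

lemma right_translated_field:
  fixes v :: "'d::finite torus \<Rightarrow> real^'d"
  assumes v: "smooth_fun v" "\<And>p. dvg v p = 0"
  shows "smooth_tangent_field (\<lambda>Y. v \<circ> Y)"
  unfolding smooth_tangent_field_def
proof (intro conjI ballI allI impI)
  show "v \<circ> Y \<in> tangent_SDiff Y" for Y using v by (auto simp: tangent_SDiff_def)
  fix \<gamma> :: "real \<Rightarrow> 'd torus \<Rightarrow> 'd torus" assume "smooth_curve_SDiff \<gamma>"
  then obtain \<Gamma> where "smooth \<Gamma>" "\<And>t x. \<gamma> t (to_torus x) = to_torus (\<Gamma> (t, x))"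
    by (auto simp: smooth_curve_SDiff_def curve_lift_def)
  then show "smooth (\<lambda>(t, x). (v \<circ> \<gamma> t) (to_torus x))"
    using smooth_compose[OF smooth_funD[OF v(1)], of \<Gamma>] by (simp add: case_prod_unfold)
qed

section \<open>Fields orthogonal to all divergence free fields\<close>

text \<open>\<open>I (s, y)\<close> is the difference quotient of \<open>f\<close> in direction
  \<open>a\<close> with increment \<open>s\<close>, smooth even at \<open>s = 0\<close>.
  Differentiating \<open>f (y + s *\<^sub>R a) - f y = s *\<^sub>R I (s, y)\<close> in direction
  \<open>b\<close> and letting \<open>s\<close> tend to \<open>0\<close> shows both mixed
  derivatives to equal the derivative of \<open>I\<close> in direction \<open>b\<close> at
  \<open>s = 0\<close>.\<close>

lemma FD_symmetric:
  assumes f: "smooth f"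
  shows "FD (\<lambda>x. FD f x a) x b = FD (\<lambda>x. FD f x b) x a"
proof -
  define I where "I z = integral (cbox 0 1) (\<lambda>t. FD f (snd z + (t * fst z) *\<^sub>R a) a)" for z :: "real \<times> 'a"
  have I: "smooth I"
  proof -
    have "smooth (\<lambda>y::real \<times> real \<times> 'a. FD f (snd (snd y) + (fst y * fst (snd y)) *\<^sub>R a) a)"
      by (intro smooth_FD_app[OF f] smooth_add smooth_scaleR smooth_mult smooth_const smooth_fst smooth_snd smooth_id)
    from Ck_integral_param[OF smooth_Ck[OF this], of _ 0 1] show ?thesis
      by (simp add: smooth_def I_def[abs_def])
  qed
  have I0: "I (0, y) = FD f y a" for y by (simp add: I_def)
  have dI: "((\<lambda>y. I (s, y)) has_derivative (\<lambda>h. FD I (s, y) (0, h))) (at y)" for s y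
    by (rule has_derivative_compose[OF _ smooth_has_derivative[OF I]]) (auto intro!: derivative_eq_intros)
  have had: "f (y + s *\<^sub>R a) - f y = s *\<^sub>R I (s, y)" for s y
    using Hadamard[OF smooth_Ck[OF f], of y "s *\<^sub>R a"]
    by (simp add: I_def linear_cmul[OF smooth_linear_FD[OF f]])
  have quot: "FD f (x + s *\<^sub>R a) b - FD f (x + 0 *\<^sub>R a) b = s *\<^sub>R FD I (s, x) (0, b)" for s
  proof -
    have "((\<lambda>y. f (y + s *\<^sub>R a)) has_derivative FD f (x + s *\<^sub>R a)) (at x)"
      by (rule has_derivative_compose[OF _ smooth_has_derivative[OF f], of "\<lambda>y. y + s *\<^sub>R a" "\<lambda>h. h"])
        (auto intro!: derivative_eq_intros)
    then have "((\<lambda>y. f (y + s *\<^sub>R a) - f y) has_derivative (\<lambda>h. FD f (x + s *\<^sub>R a) h - FD f x h)) (at x)"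
      by (intro has_derivative_diff smooth_has_derivative[OF f])
    moreover have "((\<lambda>y. s *\<^sub>R I (s, y)) has_derivative (\<lambda>h. s *\<^sub>R FD I (s, x) (0, h))) (at x)"
      by (intro has_derivative_scaleR_right dI)
    ultimately have "(\<lambda>h. FD f (x + s *\<^sub>R a) h - FD f x h) = (\<lambda>h. s *\<^sub>R FD I (s, x) (0, h))"
      unfolding had by (rule has_derivative_unique)
    from fun_cong[OF this, of b] show ?thesis by simp
  qed
  have "continuous_on UNIV (\<lambda>s. FD I (s, x) (0, b))"
    by (intro continuous_on_compose2[OF smooth_imp_continuous[OF smooth_FD[OF I]]] continuous_intros) auto
  then have "((\<lambda>s. FD f (x + s *\<^sub>R a) b) has_vector_derivative FD I (0, x) (0, b)) (at 0)"
    by (rule directional_derivative_of_quotient[OF quot])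
  moreover have "((\<lambda>s. FD f (x + s *\<^sub>R a) b) has_vector_derivative FD (\<lambda>x. FD f x b) x a) (at 0)"
    using has_vector_derivative_line[OF smooth_Ck[OF smooth_FD[OF f, of b]], of x a 0 UNIV] by simp
  ultimately have "FD (\<lambda>x. FD f x b) x a = FD I (0, x) (0, b)"
    by (rule vector_derivative_unique_at[rotated])
  also have "\<dots> = FD (\<lambda>x. FD f x a) x b"
    using FD_eqI[OF dI[of 0 x], of b] by (simp add: I0)
  finally show ?thesis by simp
qed

lemma D_at_symmetric:
  assumes "smooth_fun f"
  shows "D_at (\<lambda>p. D_at f p a) p b = D_at (\<lambda>p. D_at f p b) p a"
  by (cases p) (simp add: D_at_to_torus smooth_fun_D_at assms FD_symmetric smooth_funD)

lemma dvg_const: "dvg (\<lambda>p. c) p = 0"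
  by (simp add: dvg_def D_at_const)

lemma dvg_scaleR_const:
  assumes "smooth_fun f"
  shows "dvg (\<lambda>p. f p *\<^sub>R c) p = D_at f p c"
  using dvg_scaleR[OF assms smooth_fun_const, of c p] by (simp add: dvg_const D_at_eq_grad assms)

lemma integral_D_at:
  fixes f :: "'d::finite torus \<Rightarrow> real"
  assumes "smooth_fun f"
  shows "(\<integral>p. D_at f p a \<partial>vol) = 0"
  using integral_grad_div_free[OF smooth_fun_const _ assms, of a] by (simp add: D_at_eq_grad assms dvg_const)

lemma integral_D_at_mult:
  fixes f g :: "'d::finite torus \<Rightarrow> real"
  assumes f: "smooth_fun f" and g: "smooth_fun g"
  shows "(\<integral>p. D_at f p a * g p \<partial>vol) = - (\<integral>p. f p * D_at g p a \<partial>vol)"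
proof -
  have "0 = (\<integral>p. f p * D_at g p a + D_at f p a * g p \<partial>vol)"
    using integral_D_at[OF smooth_fun_mult[OF f g], of a]
    by (simp add: D_at_bilinear[OF bounded_bilinear_mult f g])
  also have "\<dots> = (\<integral>p. f p * D_at g p a \<partial>vol) + (\<integral>p. D_at f p a * g p \<partial>vol)"
    by (intro Bochner_Integration.integral_add integrable_vol smooth_fun_mult smooth_fun_D_at f g)
  finally show ?thesis by simp
qed

text \<open>Test against the divergence free field \<open>(\<partial>\<^sub>a\<psi>) b - (\<partial>\<^sub>b\<psi>) a\<close>, where \<open>\<psi>\<close> is the curl itself.\<close>

lemma orthogonal_imp_curl_free:
  fixes g :: "'d::finite torus \<Rightarrow> real^'d"
  assumes g: "smooth_fun g"
    and orth: "\<And>v. smooth_fun v \<Longrightarrow> (\<And>p. dvg v p = 0) \<Longrightarrow> (\<integral>p. v p \<bullet> g p \<partial>vol) = 0"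
  shows "D_at g p a \<bullet> b = D_at g p b \<bullet> a"
proof -
  define \<psi> where "\<psi> p = D_at g p a \<bullet> b - D_at g p b \<bullet> a" for p
  have \<psi>: "smooth_fun \<psi>"
    unfolding \<psi>_def[abs_def] by (intro smooth_fun_diff smooth_fun_inner smooth_fun_D_at smooth_fun_const g)
  define v where "v p = D_at \<psi> p a *\<^sub>R b - D_at \<psi> p b *\<^sub>R a" for p
  have sm: "smooth_fun (\<lambda>p. D_at \<psi> p c *\<^sub>R d)" for c d :: "real^'d"
    by (intro smooth_fun_scaleR smooth_fun_D_at smooth_fun_const \<psi>)
  have ip: "smooth_fun (\<lambda>p. g p \<bullet> c)" for c
    by (intro smooth_fun_inner smooth_fun_const g)
  have D_ip: "D_at (\<lambda>p. g p \<bullet> c) p d = D_at g p d \<bullet> c" for c d p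
    by (rule D_at_bounded_linear[OF bounded_linear_inner_left g])
  have "dvg v p = 0" for p
    unfolding v_def[abs_def]
    by (simp add: dvg_diff sm dvg_scaleR_const smooth_fun_D_at \<psi> D_at_symmetric[OF \<psi>, of a p b])
  moreover have "smooth_fun v" unfolding v_def[abs_def] by (intro smooth_fun_diff sm)
  ultimately have "0 = (\<integral>p. v p \<bullet> g p \<partial>vol)" using orth by simp
  also have "\<dots> = (\<integral>p. D_at \<psi> p a * (g p \<bullet> b) - D_at \<psi> p b * (g p \<bullet> a) \<partial>vol)"
    by (simp add: v_def inner_diff_left inner_commute[of b] inner_commute[of a])
  also have "\<dots> = (\<integral>p. D_at \<psi> p a * (g p \<bullet> b) \<partial>vol) - (\<integral>p. D_at \<psi> p b * (g p \<bullet> a) \<partial>vol)"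
    by (intro Bochner_Integration.integral_diff integrable_vol smooth_fun_mult smooth_fun_D_at \<psi> ip)
  \<comment> \<open>Integration by parts moves the derivatives from \<open>\<psi>\<close> to
    \<open>g\<close>, where they combine to \<open>\<psi>\<close> again; the total is minus the
    integral of its square.\<close>
  also have "\<dots> = - (\<integral>p. \<psi> p * (D_at g p a \<bullet> b) \<partial>vol) + (\<integral>p. \<psi> p * (D_at g p b \<bullet> a) \<partial>vol)"
    by (simp add: integral_D_at_mult[OF \<psi> ip] D_ip)
  also have "\<dots> = - ((\<integral>p. \<psi> p * (D_at g p a \<bullet> b) \<partial>vol) - (\<integral>p. \<psi> p * (D_at g p b \<bullet> a) \<partial>vol))"
    by simp
  also have "(\<integral>p. \<psi> p * (D_at g p a \<bullet> b) \<partial>vol) - (\<integral>p. \<psi> p * (D_at g p b \<bullet> a) \<partial>vol)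
      = (\<integral>p. \<psi> p * (D_at g p a \<bullet> b) - \<psi> p * (D_at g p b \<bullet> a) \<partial>vol)"
    by (intro Bochner_Integration.integral_diff[symmetric] integrable_vol smooth_fun_mult \<psi> smooth_fun_inner
        smooth_fun_D_at smooth_fun_const g)
  also have "\<dots> = (\<integral>p. \<psi> p * \<psi> p \<partial>vol)" by (simp add: \<psi>_def algebra_simps)
  finally have "(\<integral>p. \<psi> p * \<psi> p \<partial>vol) = 0" by simp
  from integral_vol_nonneg_eq_0[OF smooth_fun_mult[OF \<psi> \<psi>] _ this, of p] have "\<psi> p = 0" by simp
  then show ?thesis by (simp add: \<psi>_def)
qed

text \<open>The Poincare lemma by radial integration: \<open>\<phi> x\<close> integrates
  \<open>G\<close> along the segment from \<open>0\<close> to \<open>x\<close>. The curl condition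
  turns the integrand of its derivative in direction \<open>h\<close> into the derivative of
  \<open>t * (G (t *\<^sub>R x) \<bullet> h)\<close> in \<open>t\<close>.\<close>

lemma potential_exists:
  fixes G :: "'a::euclidean_space \<Rightarrow> 'a"
  assumes G: "smooth G" and curl: "\<And>x a b. FD G x a \<bullet> b = FD G x b \<bullet> a"
  obtains \<phi> where "smooth \<phi>" "\<And>x. (\<phi> has_derivative (\<lambda>h. G x \<bullet> h)) (at x)"
proof -
  define f where "f z = G (fst z *\<^sub>R snd z) \<bullet> snd z" for z :: "real \<times> 'a"
  have f: "smooth f"
    unfolding f_def[abs_def]
    by (intro smooth_inner smooth_compose[OF G] smooth_scaleR smooth_fst smooth_snd smooth_id)
  define \<phi> where "\<phi> x = integral (cbox 0 1) (\<lambda>t. f (t, x))" for x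
  have \<phi>: "smooth \<phi>"
    unfolding smooth_def \<phi>_def[abs_def] by (intro allI Ck_integral_param smooth_Ck f)
  have "FD \<phi> x h = G x \<bullet> h" for x h
  proof -
    have FDf: "FD f (t, x) (0, h) = t * (FD G (t *\<^sub>R x) x \<bullet> h) + G (t *\<^sub>R x) \<bullet> h" for t
    proof -
      have "((\<lambda>y. t *\<^sub>R y) has_derivative (\<lambda>k. t *\<^sub>R k)) (at x)" by (auto intro!: derivative_eq_intros)
      then have "((\<lambda>y. G (t *\<^sub>R y)) has_derivative (\<lambda>k. FD G (t *\<^sub>R x) (t *\<^sub>R k))) (at x)"
        by (rule has_derivative_compose[OF _ smooth_has_derivative[OF G]])
      then have "((\<lambda>y. f (t, y)) has_derivative
          (\<lambda>k. G (t *\<^sub>R x) \<bullet> k + FD G (t *\<^sub>R x) (t *\<^sub>R k) \<bullet> x)) (at x)"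
        unfolding f_def fst_conv snd_conv by (rule has_derivative_inner[OF _ has_derivative_ident])
      moreover have "((\<lambda>y. f (t, y)) has_derivative (\<lambda>k. FD f (t, x) (0, k))) (at x)"
        by (rule has_derivative_compose[OF _ smooth_has_derivative[OF f]]) (auto intro!: derivative_eq_intros)
      ultimately have "(\<lambda>k. FD f (t, x) (0, k)) = (\<lambda>k. G (t *\<^sub>R x) \<bullet> k + FD G (t *\<^sub>R x) (t *\<^sub>R k) \<bullet> x)"
        by (rule has_derivative_unique[rotated])
      from fun_cong[OF this, of h] show ?thesis
        by (simp add: linear_cmul[OF smooth_linear_FD[OF G]] curl[of _ h x])
    qed
    have "((\<lambda>s. \<phi> (x + s *\<^sub>R h)) has_vector_derivative integral (cbox 0 1) (\<lambda>t. FD f (t, x) (0, h))) (at 0)"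
      unfolding \<phi>_def by (rule integral_param_directional_derivative[OF smooth_Ck[OF f]])
    moreover have "((\<lambda>s. \<phi> (x + s *\<^sub>R h)) has_vector_derivative FD \<phi> x h) (at 0)"
      using has_vector_derivative_line[OF smooth_Ck[OF \<phi>], of x h 0 UNIV] by simp
    ultimately have "FD \<phi> x h = integral (cbox 0 1) (\<lambda>t. FD f (t, x) (0, h))"
      by (rule vector_derivative_unique_at[rotated])
    also have "\<dots> = G x \<bullet> h"
    proof -
      have "((\<lambda>t. FD f (t, x) (0, h)) has_integral (1 * (G (1 *\<^sub>R x) \<bullet> h) - 0 * (G (0 *\<^sub>R x) \<bullet> h))) {0..1}"
      proof (rule fundamental_theorem_of_calculus)
        fix t :: real
        have "((\<lambda>t. G (0 + t *\<^sub>R x)) has_vector_derivative FD G (0 + t *\<^sub>R x) x) (at t within {0..1})"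
          by (rule has_vector_derivative_line[OF smooth_Ck[OF G]])
        then have "((\<lambda>t. G (t *\<^sub>R x) \<bullet> h) has_vector_derivative FD G (t *\<^sub>R x) x \<bullet> h) (at t within {0..1})"
          using bounded_linear.has_vector_derivative[OF bounded_linear_inner_left] by fastforce
        then have "((\<lambda>t. G (t *\<^sub>R x) \<bullet> h) has_real_derivative FD G (t *\<^sub>R x) x \<bullet> h) (at t within {0..1})"
          by (simp add: has_real_derivative_iff_has_vector_derivative)
        then have "((\<lambda>t. t * (G (t *\<^sub>R x) \<bullet> h)) has_real_derivative FD f (t, x) (0, h)) (at t within {0..1})"
          unfolding FDf by (auto intro!: derivative_eq_intros)
        then show "((\<lambda>t. t * (G (t *\<^sub>R x) \<bullet> h)) has_vector_derivative FD f (t, x) (0, h)) (at t within {0..1})"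
          by (simp add: has_real_derivative_iff_has_vector_derivative)
      qed simp
      then show ?thesis by (simp add: integral_unique)
    qed
    finally show ?thesis .
  qed
  then have "FD \<phi> x = (\<lambda>h. G x \<bullet> h)" for x by auto
  then have "(\<phi> has_derivative (\<lambda>h. G x \<bullet> h)) (at x)" for x
    using smooth_has_derivative[OF \<phi>, of x] by simp
  with \<phi> show ?thesis by (rule that)
qed

lemma axis_periodic_imp_lattice_periodic:
  fixes f :: "real^'d::finite \<Rightarrow> 'b"
  assumes per: "\<And>i x. f (x + axis i 1) = f x" and "lattice_equiv x y"
  shows "f x = f y"
proof -
  have 1: "f (x + of_int n *\<^sub>R axis i 1) = f x" for n i x
  proof (induction n arbitrary: x rule: int_induct[where k = 0])
    case (step1 n)
    have "f (x + of_int (n + 1) *\<^sub>R axis i 1) = f ((x + of_int n *\<^sub>R axis i 1) + axis i 1)"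
      by (simp add: algebra_simps)
    then show ?case using step1 per by simp
  next
    case (step2 n)
    have "f (x + of_int (n - 1) *\<^sub>R axis i 1) = f ((x + of_int (n - 1) *\<^sub>R axis i 1) + axis i 1)"
      using per by simp
    also have "\<dots> = f (x + of_int n *\<^sub>R axis i 1)" by (simp add: algebra_simps)
    finally show ?case using step2 by simp
  qed simp
  have 2: "f (z + (\<Sum>i\<in>S. of_int (n i) *\<^sub>R axis i 1)) = f z" if "finite S" for S n z
    using that
  proof (induction S arbitrary: z)
    case (insert i S)
    have "f (z + (\<Sum>i\<in>insert i S. of_int (n i) *\<^sub>R axis i 1))
        = f ((z + of_int (n i) *\<^sub>R axis i 1) + (\<Sum>i\<in>S. of_int (n i) *\<^sub>R axis i 1))"
      using insert by (simp add: add.assoc)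
    then show ?case using insert 1 by simp
  qed simp
  have "\<forall>i. \<exists>n. x $ i - y $ i = of_int n"
    using assms(2) by (auto simp: lattice_equiv_def elim: Ints_cases)
  then obtain n where n: "\<And>i. x $ i - y $ i = of_int (n i)" by metis
  have "x = y + (\<Sum>i\<in>UNIV. of_int (n i) *\<^sub>R axis i 1)"
    unfolding vec_lambda_sum_axis[symmetric] by (simp add: vec_eq_iff n[symmetric])
  then show ?thesis using 2[of UNIV y n] by simp
qed

text \<open>In effect this says that the torus has positive volume.\<close>

lemma const_eq_0_of_integral:
  assumes "(\<integral>p. c \<partial>(vol :: 'd::finite torus measure)) = 0" "c \<ge> (0::real)"
  shows "c = 0"
  using integral_vol_nonneg_eq_0[OF smooth_fun_const _ assms(1)] assms(2) by blast

text \<open>A curl free field has a potential on the covering space, but possibly with periods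
  \<open>c\<close>. Subtracting the linear function \<open>c \<bullet> x\<close> makes it periodic,
  so \<open>g\<close> is a gradient plus the constant \<open>c\<close>. Constant fields are
  divergence free, and orthogonality of \<open>g\<close> to \<open>c\<close> itself forces
  \<open>c = 0\<close>.\<close>

lemma orthogonal_imp_gradient:
  fixes g :: "'d::finite torus \<Rightarrow> real^'d"
  assumes g: "smooth_fun g"
    and orth: "\<And>v. smooth_fun v \<Longrightarrow> (\<And>p. dvg v p = 0) \<Longrightarrow> (\<integral>p. v p \<bullet> g p \<partial>vol) = 0"
  obtains \<phi> where "smooth_fun \<phi>" "grad \<phi> = g"
proof -
  define G where "G x = g (to_torus x)" for x
  have G: "smooth G" unfolding G_def[abs_def] by (rule smooth_funD[OF g])
  have "FD G x a \<bullet> b = FD G x b \<bullet> a" for x a b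
    using orthogonal_imp_curl_free[OF g orth, of "to_torus x" a b] by (simp add: D_at_to_torus g G_def[abs_def])
  then obtain \<phi> where \<phi>: "smooth \<phi>" "\<And>x. (\<phi> has_derivative (\<lambda>h. G x \<bullet> h)) (at x)"
    using potential_exists[OF G] by blast
  define c :: "real^'d" where "c = (\<chi> i. \<phi> (0 + axis i 1) - \<phi> 0)"
  \<comment> \<open>\<open>G\<close> is periodic, so \<open>\<phi>\<close> and its translate have
    the same gradient and differ by a constant.\<close>
  have shift: "\<phi> (x + axis i 1) - \<phi> x = c $ i" for x i
  proof -
    have "((\<lambda>x. \<phi> (x + axis i 1) - \<phi> x) has_derivative (\<lambda>h. 0)) (at x)" for x
    proof -
      have "((\<lambda>x. \<phi> (x + axis i 1)) has_derivative (\<lambda>h. G (x + axis i 1) \<bullet> h)) (at x)"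
        by (rule has_derivative_compose[OF _ \<phi>(2), of "\<lambda>x. x + axis i 1" "\<lambda>h. h"])
          (auto intro!: derivative_eq_intros)
      from has_derivative_diff[OF this \<phi>(2)] show ?thesis
        by (simp add: G_def to_torus_shift_axis)
    qed
    then have "\<exists>k. \<forall>x\<in>UNIV. \<phi> (x + axis i 1) - \<phi> x = k"
      by (intro has_derivative_zero_constant) auto
    then obtain k where "\<And>x. \<phi> (x + axis i 1) - \<phi> x = k" by blast
    from this[of x] this[of 0] show ?thesis by (simp add: c_def)
  qed
  define \<psi> where "\<psi> x = \<phi> x - c \<bullet> x" for x
  have \<psi>_per: "\<psi> x = \<psi> y" if "lattice_equiv x y" for x y
    using that
    by (rule axis_periodic_imp_lattice_periodic[rotated])
      (use shift in \<open>simp add: \<psi>_def inner_add_right inner_axis algebra_simps\<close>)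
  define \<Psi> where "\<Psi> p = \<psi> (rep_torus p)" for p
  have \<Psi>_lift: "\<Psi> (to_torus x) = \<psi> x" for x
    unfolding \<Psi>_def by (rule descend_to_torus[OF \<psi>_per])
  have \<Psi>: "smooth_fun \<Psi>"
    unfolding smooth_fun_def \<Psi>_lift \<psi>_def by (intro smooth_diff smooth_inner smooth_const smooth_id \<phi>)
  have grad: "grad \<Psi> p = g p - c" for p
  proof (cases p)
    case (1 x)
    have "D_at \<Psi> p h = (g p - c) \<bullet> h" for h unfolding 1
    proof (rule D_at_eqI[OF \<Psi>])
      show "((\<lambda>y. \<Psi> (to_torus y)) has_derivative (\<lambda>h. (g (to_torus x) - c) \<bullet> h)) (at x)"
        unfolding \<Psi>_lift \<psi>_def inner_diff_left using \<phi>(2)[of x]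
        by (auto intro!: derivative_eq_intros simp: G_def)
    qed
    then show ?thesis by (simp add: grad_def vec_eq_iff inner_axis)
  qed
  have "0 = (\<integral>p. c \<bullet> g p \<partial>vol)"
    using orth[OF smooth_fun_const, of c] by (simp add: dvg_const)
  also have "\<dots> = (\<integral>p. c \<bullet> grad \<Psi> p + c \<bullet> c \<partial>vol)"
    by (simp add: grad inner_diff_right)
  also have "\<dots> = (\<integral>p. c \<bullet> grad \<Psi> p \<partial>vol) + (\<integral>p. c \<bullet> c \<partial>(vol :: 'd torus measure))"
    by (intro Bochner_Integration.integral_add integrable_vol smooth_fun_inner smooth_fun_grad \<Psi> smooth_fun_const)
  also have "(\<integral>p. c \<bullet> grad \<Psi> p \<partial>vol) = 0"
    by (rule integral_grad_div_free[OF smooth_fun_const dvg_const \<Psi>])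
  finally have int0: "(\<integral>p. c \<bullet> c \<partial>(vol :: 'd torus measure)) = 0" by simp
  have "c \<bullet> c = 0"
    by (rule const_eq_0_of_integral[OF int0]) simp
  then have "grad \<Psi> = g" using grad by (simp add: fun_eq_iff)
  with \<Psi> show ?thesis by (rule that)
qed

section \<open>The normal component and the Poisson problem\<close>

locale sdiff_density =
  fixes \<rho>0 :: "'d::finite torus \<Rightarrow> real" and X :: "'d torus \<Rightarrow> 'd torus"
  assumes smooth_density: "smooth_fun \<rho>0" and density_pos: "\<And>p. \<rho>0 p > 0" and X: "X \<in> SDiff"
begin

definition \<rho> :: "'d torus \<Rightarrow> real" where "\<rho> = \<rho>0 \<circ> inv X"

lemma rho_X: "\<rho> (X p) = \<rho>0 p"
  by (simp add: \<rho>_def SDiff_inv[OF X])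

lemma rho_pos: "\<rho> p > 0"
  by (simp add: \<rho>_def density_pos)

lemma smooth_fun_rho: "smooth_fun \<rho>"
  unfolding \<rho>_def comp_def by (rule smooth_fun_compose_map[OF smooth_density SDiffD(3)[OF X]])

text \<open>Composed with \<open>X\<close> these are the normal vectors; the factor cancels the
  weight of the metric and leaves a plain gradient.\<close>

definition weighted_grad :: "('d torus \<Rightarrow> real) \<Rightarrow> 'd torus \<Rightarrow> real^'d" where
  "weighted_grad \<phi> p = inverse (\<rho> p) *\<^sub>R grad \<phi> p"

lemma smooth_fun_weighted_grad: "smooth_fun \<phi> \<Longrightarrow> smooth_fun (weighted_grad \<phi>)"
  unfolding weighted_grad_def[abs_def]
  by (intro smooth_fun_scaleR smooth_fun_inverse smooth_fun_rho smooth_fun_grad)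
    (use rho_pos in \<open>auto simp: less_le\<close>)

lemma weighted_laplacian_eq: "weighted_laplacian \<rho> \<phi> = dvg (weighted_grad \<phi>)"
  by (simp add: weighted_laplacian_def weighted_grad_def[abs_def])

lemma smooth_fun_comp_X: "smooth_fun f \<Longrightarrow> smooth_fun (\<lambda>p. f (X p))"
  by (rule smooth_fun_compose_map[OF _ SDiffD(2)[OF X]])

text \<open>Since \<open>X\<close> preserves volume, the integral may be taken in the variable
  \<open>X p\<close>, in which the weight \<open>\<rho>0 p\<close> reads
  \<open>\<rho> (X p)\<close>.\<close>

lemma G_metric_pullback:
  assumes "smooth_fun a" "smooth_fun b"
  shows "G_metric \<rho>0 (\<lambda>p. a (X p)) (\<lambda>p. b (X p)) = (\<integral>p. a p \<bullet> (\<rho> p *\<^sub>R b p) \<partial>vol)"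
proof -
  have "G_metric \<rho>0 (\<lambda>p. a (X p)) (\<lambda>p. b (X p)) = (\<integral>p. a (X p) \<bullet> (\<rho> (X p) *\<^sub>R b (X p)) \<partial>vol)"
    by (simp add: G_metric_def rho_X mult.commute)
  also have "\<dots> = (\<integral>p. a p \<bullet> (\<rho> p *\<^sub>R b p) \<partial>vol)"
    by (rule SDiff_integral[OF X]) (intro smooth_fun_inner smooth_fun_scaleR smooth_fun_rho assms)
  finally show ?thesis .
qed

lemma rho_weighted_grad: "\<rho> p *\<^sub>R weighted_grad \<phi> p = grad \<phi> p"
  using rho_pos[of p] by (simp add: weighted_grad_def)

lemma G_metric_weighted_grad:
  assumes "smooth_fun a" "smooth_fun \<phi>"
  shows "G_metric \<rho>0 (\<lambda>p. a (X p)) (\<lambda>p. weighted_grad \<phi> (X p)) = (\<integral>p. a p \<bullet> grad \<phi> p \<partial>vol)"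
  using G_metric_pullback[OF assms(1) smooth_fun_weighted_grad[OF assms(2)]]
  by (simp add: rho_weighted_grad)

lemma normal_space_eq:
  "normal_space \<rho>0 X = {\<lambda>p. weighted_grad \<phi> (X p) | \<phi>. smooth_fun \<phi>}"
proof (intro equalityI subsetI)
  fix \<zeta> assume \<zeta>: "\<zeta> \<in> normal_space \<rho>0 X"
  define m where "m p = \<zeta> (inv X p)" for p
  have "smooth_fun \<zeta>" using \<zeta> by (simp add: normal_space_def)
  then have m: "smooth_fun m"
    unfolding m_def by (rule smooth_fun_compose_map[OF _ SDiffD(3)[OF X]])
  have mX: "\<zeta> p = m (X p)" for p by (simp add: m_def SDiff_inv[OF X])
  have sm: "smooth_fun (\<lambda>p. \<rho> p *\<^sub>R m p)" by (intro smooth_fun_scaleR smooth_fun_rho m)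
  have "(\<integral>p. v p \<bullet> (\<rho> p *\<^sub>R m p) \<partial>vol) = 0" if v: "smooth_fun v" "\<And>p. dvg v p = 0" for v
  proof -
    have "v \<circ> X \<in> tangent_SDiff X" using v by (auto simp: tangent_SDiff_def)
    then have "G_metric \<rho>0 (v \<circ> X) \<zeta> = 0" using \<zeta> by (simp add: normal_space_def)
    then show ?thesis using G_metric_pullback[OF v(1) m] by (simp add: comp_def mX[abs_def])
  qed
  then obtain \<phi> where \<phi>: "smooth_fun \<phi>" "grad \<phi> = (\<lambda>p. \<rho> p *\<^sub>R m p)"
    using orthogonal_imp_gradient[OF sm] by blast
  have "weighted_grad \<phi> p = m p" for p
    using rho_pos[of p] by (simp add: weighted_grad_def \<phi>(2))
  then have "\<zeta> = (\<lambda>p. weighted_grad \<phi> (X p))" by (auto simp: mX)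
  then show "\<zeta> \<in> {\<lambda>p. weighted_grad \<phi> (X p) | \<phi>. smooth_fun \<phi>}" using \<phi>(1) by blast
next
  fix \<zeta> assume "\<zeta> \<in> {\<lambda>p. weighted_grad \<phi> (X p) | \<phi>. smooth_fun \<phi>}"
  then obtain \<phi> where \<phi>: "smooth_fun \<phi>" "\<zeta> = (\<lambda>p. weighted_grad \<phi> (X p))" by blast
  have "G_metric \<rho>0 \<xi> \<zeta> = 0" if "\<xi> \<in> tangent_SDiff X" for \<xi>
    using that G_metric_weighted_grad[OF _ \<phi>(1)] integral_grad_div_free[OF _ _ \<phi>(1)]
    by (auto simp: tangent_SDiff_def \<phi>(2) comp_def)
  then show "\<zeta> \<in> normal_space \<rho>0 X"
    unfolding normal_space_def \<phi>(2)
    by (auto intro: smooth_fun_comp_X smooth_fun_weighted_grad \<phi>(1))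
qed

text \<open>A normal component exists exactly when the Poisson problem is solvable, so that the default
  values of both sides of the theorem agree and no elliptic existence theory is needed.\<close>

lemma is_normal_component_iff:
  assumes W: "smooth_fun W"
  shows "is_normal_component \<rho>0 X (\<lambda>p. W (X p)) n \<longleftrightarrow>
    (\<exists>\<phi>. smooth_fun \<phi> \<and> weighted_laplacian \<rho> \<phi> = dvg W \<and> n = (\<lambda>p. weighted_grad \<phi> (X p)))"
proof -
  have key: "(\<forall>\<zeta>\<in>normal_space \<rho>0 X. G_metric \<rho>0 (\<lambda>p. W (X p) - weighted_grad \<phi> (X p)) \<zeta> = 0)
      \<longleftrightarrow> weighted_laplacian \<rho> \<phi> = dvg W" if \<phi>: "smooth_fun \<phi>" for \<phi>
  proof -
    \<comment> \<open>\<open>w\<close> is the candidate for the tangential part. Orthogonality to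
      the normal space means orthogonality to all gradients, that is, weak and hence pointwise
      vanishing of its divergence.\<close>
    define w where "w p = W p - weighted_grad \<phi> p" for p
    have w: "smooth_fun w"
      unfolding w_def[abs_def] by (intro smooth_fun_diff W smooth_fun_weighted_grad \<phi>)
    have "(\<forall>\<zeta>\<in>normal_space \<rho>0 X. G_metric \<rho>0 (\<lambda>p. W (X p) - weighted_grad \<phi> (X p)) \<zeta> = 0)
        \<longleftrightarrow> (\<forall>\<phi>'. smooth_fun \<phi>' \<longrightarrow> (\<integral>p. w p \<bullet> grad \<phi>' p \<partial>vol) = 0)"
      unfolding normal_space_eq using G_metric_weighted_grad[OF w] by (auto simp: w_def)
    also have "\<dots> \<longleftrightarrow> (\<forall>p. dvg w p = 0)"
      using weakly_div_free[OF w] integral_grad_div_free[OF w] by blast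
    also have "\<dots> \<longleftrightarrow> weighted_laplacian \<rho> \<phi> = dvg W"
      unfolding w_def[abs_def] weighted_laplacian_eq
      by (auto simp: dvg_diff[OF W smooth_fun_weighted_grad[OF \<phi>]] fun_eq_iff)
    finally show ?thesis .
  qed
  show ?thesis
    unfolding is_normal_component_def using key by (auto simp: normal_space_eq)
qed

text \<open>The energy argument: testing the equation for the difference \<open>\<delta>\<close>
  with \<open>\<delta>\<close> itself makes the integral of \<open>inverse (\<rho> p)\<close> times
  the squared gradient vanish.\<close>

lemma grad_unique_of_weighted_laplacian:
  assumes \<phi>: "smooth_fun \<phi>" "smooth_fun \<psi>" and eq: "weighted_laplacian \<rho> \<phi> = weighted_laplacian \<rho> \<psi>"
  shows "grad \<phi> = grad \<psi>"
proof
  fix p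
  define \<delta> where "\<delta> p = \<phi> p - \<psi> p" for p
  have \<delta>: "smooth_fun \<delta>" unfolding \<delta>_def[abs_def] by (intro smooth_fun_diff \<phi>)
  have "grad \<delta> p = grad \<phi> p - grad \<psi> p" for p
    unfolding \<delta>_def[abs_def] by (rule grad_diff[OF \<phi>])
  note grad\<delta> = this
  have wg: "weighted_grad \<delta> = (\<lambda>p. weighted_grad \<phi> p - weighted_grad \<psi> p)"
    by (simp add: weighted_grad_def[abs_def] grad\<delta> scaleR_diff_right)
  have "dvg (weighted_grad \<delta>) p = 0" for p
    using fun_cong[OF eq, of p] dvg_diff[OF smooth_fun_weighted_grad smooth_fun_weighted_grad] \<phi>
    by (simp add: wg weighted_laplacian_eq)
  from integral_grad_div_free[OF smooth_fun_weighted_grad[OF \<delta>] this \<delta>]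
  have int0: "(\<integral>p. weighted_grad \<delta> p \<bullet> grad \<delta> p \<partial>vol) = 0" .
  have nonneg: "weighted_grad \<delta> p \<bullet> grad \<delta> p \<ge> 0" for p
    using rho_pos[of p] by (simp add: weighted_grad_def)
  have "weighted_grad \<delta> p \<bullet> grad \<delta> p = 0"
    by (rule integral_vol_nonneg_eq_0[OF smooth_fun_inner[OF smooth_fun_weighted_grad smooth_fun_grad] nonneg int0])
      (rule \<delta>)+
  then have "grad \<delta> p = 0" using rho_pos[of p] by (simp add: weighted_grad_def)
  then show "grad \<phi> p = grad \<psi> p" by (simp add: grad\<delta>)
qed

text \<open>Links the arbitrary potentials of \<open>is_normal_component_iff\<close> to the zero
  mean functions among which \<open>weighted_laplacian_inv\<close> selects. The divisor
  \<open>m\<close> is the total volume, nonzero by \<open>const_eq_0_of_integral\<close>.\<close>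

lemma normalize_mean:
  fixes \<phi> :: "'d torus \<Rightarrow> real"
  assumes \<phi>: "smooth_fun \<phi>"
  obtains \<psi> where "\<psi> \<in> zero_mean_smooth" "grad \<psi> = grad \<phi>"
proof -
  define m where "m = (\<integral>p. 1 \<partial>(vol :: 'd torus measure) :: real)"
  define \<psi> where "\<psi> p = \<phi> p - (\<integral>q. \<phi> q \<partial>vol) / m" for p
  have "m \<noteq> 0" using const_eq_0_of_integral[where c = 1 and 'd = 'd] unfolding m_def by auto
  have "(\<integral>p. \<psi> p \<partial>vol) = (\<integral>p. \<phi> p \<partial>vol) - (\<integral>p. (\<integral>q. \<phi> q \<partial>vol) / m \<partial>(vol :: 'd torus measure))"
    unfolding \<psi>_def
    by (rule Bochner_Integration.integral_diff[OF integrable_vol[OF \<phi>] integrable_vol[OF smooth_fun_const]])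
  also have "(\<integral>p. (\<integral>q. \<phi> q \<partial>vol) / m \<partial>(vol :: 'd torus measure)) = (\<integral>q. \<phi> q \<partial>vol) / m * m"
    unfolding m_def by simp
  finally have "(\<integral>p. \<psi> p \<partial>vol) = 0" using \<open>m \<noteq> 0\<close> by simp
  moreover have "smooth_fun \<psi>"
    unfolding \<psi>_def[abs_def] by (intro smooth_fun_diff \<phi> smooth_fun_const)
  ultimately have "\<psi> \<in> zero_mean_smooth" by (simp add: zero_mean_smooth_def)
  moreover have "grad \<psi> = grad \<phi>"
    unfolding \<psi>_def[abs_def] by (rule ext) (simp add: grad_diff \<phi> smooth_fun_const grad_const)
  ultimately show ?thesis by (rule that)
qed

lemma normal_component_eq_Q_op:
  assumes W: "smooth_fun W"
  shows "normal_component \<rho>0 X (\<lambda>p. W (X p)) = Q_op \<rho> W \<circ> X"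
proof (cases "dvg W \<in> weighted_laplacian \<rho> ` zero_mean_smooth")
  case True
  define \<phi> where "\<phi> = weighted_laplacian_inv \<rho> (dvg W)"
  have \<phi>_eq: "\<phi> = inv_into zero_mean_smooth (weighted_laplacian \<rho>) (dvg W)"
    using True by (simp add: \<phi>_def weighted_laplacian_inv_def)
  have "\<phi> \<in> zero_mean_smooth" unfolding \<phi>_eq by (rule inv_into_into[OF True])
  then have \<phi>: "smooth_fun \<phi>" by (simp add: zero_mean_smooth_def)
  have lap: "weighted_laplacian \<rho> \<phi> = dvg W" unfolding \<phi>_eq by (rule f_inv_into_f[OF True])
  define n where "n p = weighted_grad \<phi> (X p)" for p
  have n: "is_normal_component \<rho>0 X (\<lambda>p. W (X p)) n"
    unfolding is_normal_component_iff[OF W] n_def[abs_def] using \<phi> lap by blast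
  \<comment> \<open>The preimage chosen by \<open>inv_into\<close> is immaterial, because all
    solutions of the Poisson problem share their gradient.\<close>
  moreover have "n' = n" if n': "is_normal_component \<rho>0 X (\<lambda>p. W (X p)) n'" for n'
  proof -
    obtain \<psi> where \<psi>: "smooth_fun \<psi>" "weighted_laplacian \<rho> \<psi> = dvg W" "n' = (\<lambda>p. weighted_grad \<psi> (X p))"
      using n' unfolding is_normal_component_iff[OF W] by blast
    have "grad \<psi> = grad \<phi>" by (rule grad_unique_of_weighted_laplacian[OF \<psi>(1) \<phi>]) (simp add: \<psi> lap)
    then show ?thesis by (simp add: \<psi>(3) n_def[abs_def] weighted_grad_def)
  qed
  ultimately have "(THE n. is_normal_component \<rho>0 X (\<lambda>p. W (X p)) n) = n" by (rule the_equality)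
  then have "normal_component \<rho>0 X (\<lambda>p. W (X p)) = n"
    using n by (auto simp: normal_component_def)
  also have "n = Q_op \<rho> W \<circ> X"
    by (auto simp: n_def weighted_grad_def Q_op_def \<phi>_def)
  finally show ?thesis .
next
  case False
  have "\<not> is_normal_component \<rho>0 X (\<lambda>p. W (X p)) n" for n
  proof
    assume "is_normal_component \<rho>0 X (\<lambda>p. W (X p)) n"
    then obtain \<phi> where \<phi>: "smooth_fun \<phi>" "weighted_laplacian \<rho> \<phi> = dvg W"
      unfolding is_normal_component_iff[OF W] by blast
    \<comment> \<open>After subtracting its mean, the potential would place \<open>dvg W\<close> in
      the range that this case excludes.\<close>
    obtain \<psi> where \<psi>: "\<psi> \<in> zero_mean_smooth" "grad \<psi> = grad \<phi>"
      using normalize_mean[OF \<phi>(1)] by blast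
    then have "weighted_laplacian \<rho> \<psi> = dvg W" using \<phi>(2) by (simp add: weighted_laplacian_def)
    then show False using False \<psi>(1) by (metis imageI)
  qed
  then have "normal_component \<rho>0 X (\<lambda>p. W (X p)) = (\<lambda>p. 0)" by (simp add: normal_component_def)
  \<comment> \<open>The default of \<open>weighted_laplacian_inv\<close> is a constant function, so
    its gradient matches the default of \<open>normal_component\<close>.\<close>
  also have "\<dots> = Q_op \<rho> W \<circ> X"
    using False by (auto simp: Q_op_def weighted_laplacian_inv_def grad_const)
  finally show ?thesis .
qed

end

section \<open>Derivatives of tangent fields along curves\<close>

text \<open>The fields \<open>F (\<gamma> t) \<circ> (\<gamma> t)\<^sup>-\<^sup>1\<close> are divergence free. Differentiating this condition in weak
  form, \<open>\<integral> F (\<gamma> t) \<cdot> (\<nabla>\<phi> \<circ> \<gamma> t) = 0\<close>, avoids differentiating the inverse maps.\<close>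

lemma tangent_field_derivative:
  fixes u v :: "'d::finite torus \<Rightarrow> real^'d"
  assumes X: "X \<in> SDiff" and u: "smooth_fun u" "\<And>p. dvg u p = 0" and v: "smooth_fun v"
    and F: "smooth_tangent_field F" "F X = v \<circ> X"
    and \<gamma>: "smooth_curve_SDiff \<gamma>" "\<gamma> 0 = X" "velocity_at_0 \<gamma> (u \<circ> X)"
  shows "\<exists>a. smooth_fun a \<and> dvg a = dvg (advect u v) \<and>
    (\<lambda>p. vector_derivative (\<lambda>t. F (\<gamma> t) p) (at 0)) = (\<lambda>p. a (X p))"
proof -
  define w where "w p = vector_derivative (\<lambda>t. F (\<gamma> t) p) (at 0)" for p
  define S where "S z = F (\<gamma> (fst z)) (to_torus (snd z))" for z
  have S: "smooth S"
    using F(1) \<gamma>(1) unfolding smooth_tangent_field_def S_def[abs_def] by (simp add: case_prod_unfold)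
  obtain \<Gamma> where \<Gamma>: "smooth \<Gamma>" "\<And>t x. \<gamma> t (to_torus x) = to_torus (\<Gamma> (t, x))"
    "\<And>x. ((\<lambda>t. \<Gamma> (t, x)) has_vector_derivative u (X (to_torus x))) (at 0)"
    using \<gamma>(3) by (auto simp: velocity_at_0_def curve_lift_def)
  have S': "((\<lambda>t. S (t, x)) has_vector_derivative FD S (0, x) (1, 0)) (at 0)" for x
    using has_vector_derivative_line[OF smooth_Ck[OF S], of "(0, x)" "(1, 0)" 0 UNIV] by simp
  have w_lift: "w (to_torus x) = FD S (0, x) (1, 0)" for x
    using vector_derivative_at[OF S'[of x]] by (simp add: w_def S_def)
  have w: "smooth_fun w"
    unfolding smooth_fun_def w_lift
    by (intro smooth_compose[OF smooth_FD[OF S]] smooth_Pair smooth_const smooth_id)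
  \<comment> \<open>The Eulerian form of the derivative along the curve, to which the divergence
    applies.\<close>
  define a where "a p = w (inv X p)" for p
  have a: "smooth_fun a"
    unfolding a_def[abs_def] by (rule smooth_fun_compose_map[OF w SDiffD(3)[OF X]])
  have aX: "a (X p) = w p" for p by (simp add: a_def SDiff_inv[OF X])
  have "dvg (\<lambda>p. a p - advect u v p) q = 0" for q
  proof (rule weakly_div_free)
    show "smooth_fun (\<lambda>p. a p - advect u v p)"
      by (intro smooth_fun_diff a smooth_fun_advect u v)
    fix \<phi> :: "'d torus \<Rightarrow> real" assume \<phi>: "smooth_fun \<phi>"
    note g = smooth_fun_grad[OF \<phi>]
    define H where "H z = S z \<bullet> grad \<phi> (to_torus (\<Gamma> z))" for z
    have H: "smooth H"
      unfolding H_def[abs_def] by (intro smooth_inner S smooth_compose[OF smooth_funD[OF g] \<Gamma>(1)])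
    have "integral cube (\<lambda>x. H (t, x)) = 0" for t
    proof -
      have \<gamma>t: "\<gamma> t \<in> SDiff" using \<gamma>(1) by (simp add: smooth_curve_SDiff_def)
      then have "F (\<gamma> t) \<in> tangent_SDiff (\<gamma> t)" using F(1) by (simp add: smooth_tangent_field_def)
      then obtain f where f: "smooth_fun f" "\<And>p. dvg f p = 0" "F (\<gamma> t) = f \<circ> \<gamma> t"
        by (auto simp: tangent_SDiff_def)
      define h where "h p = f p \<bullet> grad \<phi> p" for p
      have h: "smooth_fun h" unfolding h_def[abs_def] by (intro smooth_fun_inner f g)
      have "integral cube (\<lambda>x. H (t, x)) = integral cube (\<lambda>x. h (\<gamma> t (to_torus x)))"
        by (simp add: H_def S_def h_def f(3) \<Gamma>(2))
      also have "\<dots> = (\<integral>p. h (\<gamma> t p) \<partial>vol)"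
        by (rule integral_vol[symmetric, OF smooth_fun_continuous[OF smooth_fun_compose_map[OF h SDiffD(2)[OF \<gamma>t]]]])
      also have "\<dots> = (\<integral>p. h p \<partial>vol)" by (rule SDiff_integral[OF \<gamma>t h])
      also have "\<dots> = 0" unfolding h_def by (rule integral_grad_div_free[OF f(1,2) \<phi>])
      finally show ?thesis .
    qed
    then have "((\<lambda>t. 0) has_vector_derivative integral cube (\<lambda>x. FD H (0, x) (1, 0))) (at 0)"
      using has_derivative_integral_cube[OF H, of 0] by simp
    then have int0: "integral cube (\<lambda>x. FD H (0, x) (1, 0)) = 0"
      using vector_derivative_unique_at has_vector_derivative_const by blast
    define D where "D p = D_at (grad \<phi>) p (u p)" for p
    have D: "smooth_fun D" unfolding D_def[abs_def] by (rule smooth_fun_D_at_app[OF g u(1)])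
    \<comment> \<open>The time derivative of \<open>H\<close> at \<open>0\<close>, as a function on
      the torus evaluated at \<open>X p\<close>: one term from the change of the field, one from the
      motion of the base point of \<open>\<nabla>\<phi>\<close> with velocity
      \<open>u\<close>.\<close>
    define E where "E p = a p \<bullet> grad \<phi> p + v p \<bullet> D p" for p
    have E: "smooth_fun E" unfolding E_def[abs_def] by (intro smooth_fun_add smooth_fun_inner a g v D)
    have FDH: "FD H (0, x) (1, 0) = E (X (to_torus x))" for x
    proof -
      have X\<Gamma>: "to_torus (\<Gamma> (0, x)) = X (to_torus x)" using \<Gamma>(2)[of 0 x] \<gamma>(2) by simp
      have SX: "S (0, x) = v (X (to_torus x))" by (simp add: S_def \<gamma>(2) F(2))
      have "((\<lambda>t. grad \<phi> (to_torus (\<Gamma> (t, x)))) has_vector_derivative D (X (to_torus x))) (at 0)"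
      proof -
        have "((\<lambda>t. \<Gamma> (t, x)) has_derivative (\<lambda>r. r *\<^sub>R u (X (to_torus x)))) (at 0)"
          using \<Gamma>(3) by (simp add: has_vector_derivative_def)
        from has_derivative_compose[OF this D_at_has_derivative[OF g]]
        show ?thesis
          by (simp add: has_vector_derivative_def linear_cmul[OF D_at_linear[OF g]] X\<Gamma> D_def)
      qed
      from bounded_bilinear.has_vector_derivative[OF bounded_bilinear_inner S'[of x] this]
      have "((\<lambda>t. H (t, x)) has_vector_derivative E (X (to_torus x))) (at 0)"
        by (simp add: H_def E_def aX w_lift SX X\<Gamma> add.commute)
      moreover have "((\<lambda>t. H (t, x)) has_vector_derivative FD H (0, x) (1, 0)) (at 0)"
        using has_vector_derivative_line[OF smooth_Ck[OF H], of "(0, x)" "(1, 0)" 0 UNIV] by simp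
      ultimately show ?thesis by (rule vector_derivative_unique_at[rotated])
    qed
    have "(\<integral>p. E p \<partial>vol) = (\<integral>p. E (X p) \<partial>vol)" by (rule SDiff_integral[OF X E, symmetric])
    also have "\<dots> = integral cube (\<lambda>x. E (X (to_torus x)))"
      by (rule integral_vol[OF smooth_fun_continuous[OF smooth_fun_compose_map[OF E SDiffD(2)[OF X]]]])
    also have "\<dots> = 0" using int0 by (simp add: FDH)
    finally have E0: "(\<integral>p. E p \<partial>vol) = 0" .
    \<comment> \<open>By the product rule \<open>u \<bullet> grad \<theta>\<close> consists of the
      second term of \<open>E\<close> and of \<open>advect u v \<bullet> grad \<phi>\<close>. Its
      integral vanishes since \<open>u\<close> is divergence free, so the two terms may be exchanged
      up to sign under the integral.\<close>
    define \<theta> where "\<theta> p = v p \<bullet> grad \<phi> p" for p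
    have \<theta>: "smooth_fun \<theta>" unfolding \<theta>_def[abs_def] by (intro smooth_fun_inner v g)
    have D\<theta>: "u p \<bullet> grad \<theta> p = v p \<bullet> D p + advect u v p \<bullet> grad \<phi> p" for p
      unfolding D_at_eq_grad[OF \<theta>, symmetric] unfolding \<theta>_def[abs_def]
      by (simp add: D_at_bilinear[OF bounded_bilinear_inner v g] D_def advect_def)
    have "(\<integral>p. (a p - advect u v p) \<bullet> grad \<phi> p \<partial>vol) = (\<integral>p. E p - u p \<bullet> grad \<theta> p \<partial>vol)"
      by (simp add: D\<theta> E_def inner_diff_left algebra_simps)
    also have "\<dots> = (\<integral>p. E p \<partial>vol) - (\<integral>p. u p \<bullet> grad \<theta> p \<partial>vol)"
      by (intro Bochner_Integration.integral_diff integrable_vol smooth_fun_inner smooth_fun_grad \<theta> u E)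
    also have "\<dots> = 0" by (simp add: E0 integral_grad_div_free[OF u \<theta>])
    finally show "(\<integral>p. (a p - advect u v p) \<bullet> grad \<phi> p \<partial>vol) = 0" .
  qed
  then have "dvg a = dvg (advect u v)"
    by (simp add: dvg_diff[OF a smooth_fun_advect[OF u(1) v]] fun_eq_iff)
  moreover have "w = (\<lambda>p. a (X p))" by (simp add: aX)
  ultimately show ?thesis using a unfolding w_def[abs_def] by blast
qed

section \<open>The second fundamental form\<close>

theorem theorem2p6:
  fixes \<rho>0 :: "'d::finite torus \<Rightarrow> real" and C1 :: real
    and X :: "'d torus \<Rightarrow> 'd torus" and u v :: "'d torus \<Rightarrow> real^'d"
  assumes "smooth_fun \<rho>0" and "(\<integral>p. \<rho>0 p \<partial>vol) = 1"
    and "C1 > 1" and "\<And>p. inverse C1 \<le> \<rho>0 p \<and> \<rho>0 p \<le> C1"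
    and "X \<in> SDiff"
    and "smooth_fun u" and "\<And>p. dvg u p = 0"
    and "smooth_fun v" and "\<And>p. dvg v p = 0"
  shows "second_fundamental_form \<rho>0 X (u \<circ> X) (v \<circ> X) = Q_op (\<rho>0 \<circ> inv X) (advect u v) \<circ> X"
proof -
  have "\<rho>0 p > 0" for p
    using assms(3) assms(4)[of p] positive_imp_inverse_positive[of C1] by linarith
  then interpret sdiff_density \<rho>0 X
    by unfold_locales (use assms in auto)
  have nc: "normal_component \<rho>0 X (\<lambda>p. vector_derivative (\<lambda>t. F (\<gamma> t) p) (at 0))
      = Q_op \<rho> (advect u v) \<circ> X"
    if F: "smooth_tangent_field F" "F X = v \<circ> X"
      and \<gamma>: "smooth_curve_SDiff \<gamma>" "\<gamma> 0 = X" "velocity_at_0 \<gamma> (u \<circ> X)" for F \<gamma>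
  proof -
    obtain a where a: "smooth_fun a" "dvg a = dvg (advect u v)"
      "(\<lambda>p. vector_derivative (\<lambda>t. F (\<gamma> t) p) (at 0)) = (\<lambda>p. a (X p))"
      using tangent_field_derivative[OF assms(5,6,7,8) F \<gamma>] by (elim exE conjE)
    \<comment> \<open>\<open>Q_op\<close> sees its argument only through the divergence, so the
      unknown \<open>a\<close> can be replaced by \<open>advect u v\<close>.\<close>
    have "Q_op \<rho> a = Q_op \<rho> (advect u v)"
      by (simp add: Q_op_def[abs_def] a(2))
    then show ?thesis unfolding a(3) using normal_component_eq_Q_op[OF a(1)] by simp
  qed
  obtain \<gamma> where \<gamma>: "smooth_curve_SDiff \<gamma>" "\<gamma> 0 = X" "velocity_at_0 \<gamma> (u \<circ> X)"
    using SDiff_curve_exists[OF assms(6,7,5)] by blast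
  note F = right_translated_field[OF assms(8,9)]
  show ?thesis
    unfolding second_fundamental_form_def \<rho>_def[symmetric]
  proof (rule the_equality)
    show "\<forall>F \<gamma>. smooth_tangent_field F \<and> F X = v \<circ> X \<and> smooth_curve_SDiff \<gamma> \<and> \<gamma> 0 = X \<and>
        velocity_at_0 \<gamma> (u \<circ> X) \<longrightarrow>
        normal_component \<rho>0 X (\<lambda>p. vector_derivative (\<lambda>t. F (\<gamma> t) p) (at 0)) = Q_op \<rho> (advect u v) \<circ> X"
      using nc by blast
    fix n assume "\<forall>F \<gamma>. smooth_tangent_field F \<and> F X = v \<circ> X \<and> smooth_curve_SDiff \<gamma> \<and> \<gamma> 0 = X \<and>
        velocity_at_0 \<gamma> (u \<circ> X) \<longrightarrow>
        normal_component \<rho>0 X (\<lambda>p. vector_derivative (\<lambda>t. F (\<gamma> t) p) (at 0)) = n"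
    from this[rule_format, of "\<lambda>Y. v \<circ> Y" \<gamma>] nc[OF F refl \<gamma>] F \<gamma>
    show "n = Q_op \<rho> (advect u v) \<circ> X" by simp
  qed
qed

end
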